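(* Let $T\curvearrowright V$ be a toric GIT problem, let $X$ be a phase of it, and let $H\subset L^\vee_{\mathbb R}$ be a relevant subspace. Then the multiplicity of $D^b(Z_H)$ in the semi-orthogonal decomposition of $D^b(X)$ produced by the wall-crossing algorithm is independent of all choices of paths made in the algorithm (at every level of the recursion). In other words, the subcategories occurring in the final decomposition of $D^b(X)$, and their multiplicities, are independent of all choices.
   Context: **Toric GIT problem.** $T$ is a complex torus with lattice of one-parameter subgroups $L$ (so $T=L\otimes\mathbb C^*$) and character lattice $L^\vee$; it acts diagonally on $V=\mathbb C^n$ with weights $q_1,\dots,q_n\in L^\vee$. Let $Q:\mathbb Z^n\to L^\vee$, $e_i\mapsto q_i$; it is assumed that $Q$ has finite cokernel (equivalently $Q^\vee:L\to\mathbb Z^n$ is injective). Write $\det V=\sum_i q_i$. **Phases.** For $\theta\in L^\vee_{\mathbb R}$ the semistable locus $V^{ss}_\theta$ is the set of $v$ such that $\theta$ lies in the cone spanned by $\{q_i : v_i\neq 0\}$, and $X_\theta=[V^{ss}_\theta/T]$. The secondary fan is the fan with support $\mathrm{cone}(q_1,\dots,q_n)$ whose cones are, for $\theta$ in the support, the intersections of all cones $\mathrm{cone}(q_i:i\in I)$, $I\subset\{1,\dots,n\}$, that contain $\theta$. A chamber is a top-dimensional cone; a phase is the quotient $X_\theta$ for $\theta$ in the interior of a chamber. A wall is a codimension 1 cone of this fan. Outside the support the quotient is empty (the "empty phase"). **Higgs GIT problem.** For a subspace $H\subset L^\vee_{\mathbb R}$ spanned by the weights it contains, the associated Higgs GIT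 problem is given by the weights lying in $H$, viewed in the lattice $L^\vee\cap H$. For a wall $W$, let $\langle W\rangle$ be its linear span; $Z_W$ denotes the phase of the Higgs GIT problem for $\langle W\rangle$ whose chamber contains the relative interior of $W$. **Single wall-crossing.** Let $W$ be a wall which is a facet of a chamber $C_+$ with phase $X_+$, let $\lambda_W\in L$ be the primitive normal to $W$ which is non-negative on $C_+$, let $\kappa=(\det V)(\lambda_W)$, and let $X_-$ be the phase on the other side of $W$ (possibly the empty phase). If $\kappa\ge 0$ there is a semi-orthogonal decomposition $$D^b(X_+)=\langle D^b(X_-),\,D^b(Z_W),\dots,D^b(Z_W)\rangle$$ with $\kappa$ copies of $D^b(Z_W)$. **The wall-crossing algorithm.** Starting from the chamber of $X$, cross a sequence of walls always moving away from $\det V$ (i.e. with $\kappa>0$), refining the decomposition each time, until a minimal phase is reached, where no further such crossing is possible. A phase is minimal if $-\det V$ lies in its closed chamber; the minimal phase is the empty phase if $-\det V\notin\mathrm{cone}(q_1,\dots,q_n)$. If there are several minimal phases they are derived equivalent. Then apply the algorithm recursively to each factor $D^b(Z_W)$, where $Z_W$ is a phase of a GIT problem of smaller rank. The choices are the sequences of chambers ("paths") used at each step. Each factor of the final decomposition is the derived category of a minimal phase of the Higgs GIT problem of some subspace $H\subset L_{\mathbb R}^\vee$ (with $H=L^\vee_{\mathbb R}$ for the original problem); factors from empty minimal phases are zero and discarded. **Relevant subspaces.** A subspace $H\subset L^\vee_{\mathbb R}$ is relevant if the cone spanned by the weights lying in $H$ is the whole of $H$ (so $H=0$ is always relevant).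 Equivalently, $H$ is spanned by the weights it contains and its Higgs GIT problem has a non-empty minimal phase; this phase is denoted $Z_H$ (well-defined up to derived equivalence). The multiplicity of $D^b(Z_H)$ in $D^b(X)$ is the number of factors of the final decomposition that arise as the minimal phase of the Higgs GIT problem of $H$. *)

theory Defs
  imports "HOL-Analysis.Analysis" "HOL-Library.Multiset"
begin

text \<open>
  A toric GIT problem is given by the character lattice of the torus and the weights of its
  diagonal action. The character lattice is a lattice of arbitrary rank in a Euclidean space,
  not necessarily of full rank, so that its real extension is its span. This way the Higgs GIT
  problem of a subspace is a problem in the same ambient space, and rank 0 is allowed.
\<close>

record ('i, 'a) git =
  chars :: "'a set"
  idx :: "'i set"
  wt :: "'i \<Rightarrow> 'a"

definition is_lattice :: "'a::euclidean_space set \<Rightarrow> bool" where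
  "is_lattice \<Lambda> \<longleftrightarrow>
     (\<exists>B. independent B \<and> \<Lambda> = range (\<lambda>k :: 'a \<Rightarrow> int. \<Sum>b\<in>B. of_int (k b) *\<^sub>R b))"

definition weight_map :: "('i, 'a::euclidean_space) git \<Rightarrow> ('i \<Rightarrow> int) \<Rightarrow> 'a" where
  "weight_map G k = (\<Sum>i\<in>idx G. of_int (k i) *\<^sub>R wt G i)"

text \<open>The last condition says that the cokernel of the weight map is finite: its elements are
  the cosets of the image of the weight map.\<close>

definition git_problem :: "('i, 'a::euclidean_space) git \<Rightarrow> bool" where
  "git_problem G \<longleftrightarrow>
     is_lattice (chars G) \<and> finite (idx G) \<and> wt G ` idx G \<subseteq> chars G \<and>
     finite ((\<lambda>v. (\<lambda>u. v + u) ` range (weight_map G)) ` chars G)"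

definition det_wt :: "('i, 'a::euclidean_space) git \<Rightarrow> 'a" where
  "det_wt G = (\<Sum>i\<in>idx G. wt G i)"

definition wcone :: "('i, 'a::euclidean_space) git \<Rightarrow> 'i set \<Rightarrow> 'a set" where
  "wcone G J = convex_cone hull (wt G ` J)"

text \<open>The representation is the space of complex functions on the index set, extended by zero.\<close>

definition rep_space :: "('i, 'a::euclidean_space) git \<Rightarrow> ('i \<Rightarrow> complex) set" where
  "rep_space G = {v. \<forall>i. i \<notin> idx G \<longrightarrow> v i = 0}"

definition semistable :: "('i, 'a::euclidean_space) git \<Rightarrow> 'a \<Rightarrow> ('i \<Rightarrow> complex) set" where
  "semistable G \<theta> = {v \<in> rep_space G. \<theta> \<in> wcone G {i \<in> idx G. v i \<noteq> 0}}"

definition secondary_fan :: "('i, 'a::euclidean_space) git \<Rightarrow> 'a set set" where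
  "secondary_fan G =
     (\<lambda>\<theta>. \<Inter>{wcone G J | J. J \<subseteq> idx G \<and> \<theta> \<in> wcone G J}) ` wcone G (idx G)"

definition chamber :: "('i, 'a::euclidean_space) git \<Rightarrow> 'a set \<Rightarrow> bool" where
  "chamber G C \<longleftrightarrow> C \<in> secondary_fan G \<and> dim C = dim (chars G)"

definition wall :: "('i, 'a::euclidean_space) git \<Rightarrow> 'a set \<Rightarrow> bool" where
  "wall G W \<longleftrightarrow> W \<in> secondary_fan G \<and> dim W + 1 = dim (chars G)"

text \<open>
  A phase of a fixed problem is represented by its semistable locus, the torus acting on it being
  determined by the problem; the empty set represents the empty phase. Since a chamber has full
  dimension in the span of the character lattice, \<^term>\<open>rel_interior C\<close> is its interior
  relative to that span.
\<close>

definition phase_of_chamber ::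
  "('i, 'a::euclidean_space) git \<Rightarrow> 'a set \<Rightarrow> ('i \<Rightarrow> complex) set \<Rightarrow> bool" where
  "phase_of_chamber G C X \<longleftrightarrow> chamber G C \<and> (\<exists>\<theta>\<in>rel_interior C. X = semistable G \<theta>)"

definition phase :: "('i, 'a::euclidean_space) git \<Rightarrow> ('i \<Rightarrow> complex) set \<Rightarrow> bool" where
  "phase G X \<longleftrightarrow> (\<exists>C. phase_of_chamber G C X)"

definition higgs :: "('i, 'a::euclidean_space) git \<Rightarrow> 'a set \<Rightarrow> ('i, 'a) git" where
  "higgs G H = \<lparr>chars = chars G \<inter> H, idx = {i \<in> idx G. wt G i \<in> H}, wt = wt G\<rparr>"

text \<open>The phase \<open>Z\<^sub>W\<close>.\<close>

definition wall_phase ::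
  "('i, 'a::euclidean_space) git \<Rightarrow> 'a set \<Rightarrow> ('i \<Rightarrow> complex) set \<Rightarrow> bool" where
  "wall_phase G W Z \<longleftrightarrow>
     (\<exists>D. phase_of_chamber (higgs G (span W)) D Z \<and> rel_interior W \<subseteq> D)"

text \<open>The lattice of one-parameter subgroups, with the inner product as the pairing with
  characters.\<close>

definition one_params :: "('i, 'a::euclidean_space) git \<Rightarrow> 'a set" where
  "one_params G = {l \<in> span (chars G). \<forall>x\<in>chars G. x \<bullet> l \<in> \<int>}"

definition primitive :: "('i, 'a::euclidean_space) git \<Rightarrow> 'a \<Rightarrow> bool" where
  "primitive G l \<longleftrightarrow> l \<in> one_params G \<and>
     (\<forall>k::nat. \<forall>m\<in>one_params G. l = of_nat k *\<^sub>R m \<longrightarrow> k = 1)"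

definition wall_normal ::
  "('i, 'a::euclidean_space) git \<Rightarrow> 'a set \<Rightarrow> 'a set \<Rightarrow> 'a \<Rightarrow> bool" where
  "wall_normal G W C l \<longleftrightarrow>
     primitive G l \<and> (\<forall>x\<in>W. x \<bullet> l = 0) \<and> (\<forall>x\<in>C. 0 \<le> x \<bullet> l)"

definition chamber_beyond ::
  "('i, 'a::euclidean_space) git \<Rightarrow> 'a set \<Rightarrow> 'a \<Rightarrow> 'a set \<Rightarrow> bool" where
  "chamber_beyond G W l C \<longleftrightarrow> chamber G C \<and> W facet_of C \<and> (\<forall>x\<in>C. x \<bullet> l \<le> 0)"

definition phase_beyond ::
  "('i, 'a::euclidean_space) git \<Rightarrow> 'a set \<Rightarrow> 'a \<Rightarrow> ('i \<Rightarrow> complex) set \<Rightarrow> bool" where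
  "phase_beyond G W l X \<longleftrightarrow>
     (\<exists>C. chamber_beyond G W l C \<and> phase_of_chamber G C X) \<or>
     (\<nexists>C. chamber_beyond G W l C) \<and> X = {}"

text \<open>\<open>wall_crossing G X W \<kappa> X'\<close>: crossing the wall \<open>W\<close> leads from the phase \<open>X\<close> to \<open>X'\<close>,
  and the determinant pairs with the primitive normal to the natural number \<open>\<kappa>\<close>.\<close>

definition wall_crossing ::
  "('i, 'a::euclidean_space) git \<Rightarrow> ('i \<Rightarrow> complex) set \<Rightarrow> 'a set \<Rightarrow> nat \<Rightarrow>
   ('i \<Rightarrow> complex) set \<Rightarrow> bool" where
  "wall_crossing G X W \<kappa> X' \<longleftrightarrow>
     (\<exists>C l. phase_of_chamber G C X \<and> wall G W \<and> W facet_of C \<and> wall_normal G W C l \<and>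
        of_nat \<kappa> = det_wt G \<bullet> l \<and> phase_beyond G W l X')"

text \<open>
  \<open>decomposition G X fs\<close>: some run of the wall-crossing algorithm on the phase \<open>X\<close> of \<open>G\<close> produces
  a semi-orthogonal decomposition with factors \<open>fs\<close>. A factor \<open>(G', Z)\<close> stands for the derived
  category of the phase \<open>Z\<close> of the Higgs GIT problem \<open>G'\<close>. The \<open>\<kappa>\<close> copies of the derived
  category of \<open>Z\<^sub>W\<close> contributed by a wall may be decomposed by different runs, which are listed
  in \<open>gss\<close>.
\<close>

inductive decomposition ::
  "('i, 'a::euclidean_space) git \<Rightarrow> ('i \<Rightarrow> complex) set \<Rightarrow>
   (('i, 'a) git \<times> ('i \<Rightarrow> complex) set) list \<Rightarrow> bool" where
  minimal:
    "phase_of_chamber G C X \<Longrightarrow> - det_wt G \<in> C \<Longrightarrow> decomposition G X [(G, X)]"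
| minimal_empty:
    "- det_wt G \<notin> wcone G (idx G) \<Longrightarrow> decomposition G {} []"
| crossing:
    "wall_crossing G X W \<kappa> X' \<Longrightarrow> \<kappa> > 0 \<Longrightarrow> decomposition G X' fs \<Longrightarrow>
     wall_phase G W Z \<Longrightarrow> length gss = \<kappa> \<Longrightarrow>
     \<forall>gs\<in>set gss. decomposition (higgs G (span W)) Z gs \<Longrightarrow>
     decomposition G X (fs @ concat gss)"

definition relevant :: "('i, 'a::euclidean_space) git \<Rightarrow> 'a set \<Rightarrow> bool" where
  "relevant G H \<longleftrightarrow> subspace H \<and> H \<subseteq> span (chars G) \<and> wcone G {i \<in> idx G. wt G i \<in> H} = H"

definition factor_multiplicity ::
  "('i, 'a::euclidean_space) git \<Rightarrow> 'a set \<Rightarrow>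
   (('i, 'a) git \<times> ('i \<Rightarrow> complex) set) list \<Rightarrow> nat" where
  "factor_multiplicity G H fs = length (filter (\<lambda>(G', Z). G' = higgs G H) fs)"

end

theory Submission
  imports Defs
begin

text \<open>
  The multiplicities are recovered from numerical invariants of phases which the algorithm can
  only redistribute among the factors.

  Let \<open>H\<close> be a relevant subspace with basis \<open>K\<close>. The invariant \<open>\<Phi>\<^sub>H\<close> of the phase of a
  stability parameter \<open>\<theta>\<close> (\<open>phase_count\<close>) is a sum over the sets \<open>I\<close> of weights
  which complete \<open>K\<close> to a basis of the span of the characters and for which \<open>\<theta>\<close> lies
  in the cone of \<open>I\<close> plus \<open>H\<close>. The summand is the volume of the parallelotope spanned by
  \<open>K\<close> and \<open>I\<close>, divided by the covolume of the character lattice. For \<open>H = 0\<close> this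
  is the number of simplicial cones around \<open>\<theta>\<close>, each counted with the absolute value of its
  determinant, that is, the number of fixed points of the big torus on the phase, each counted with
  the order of its stabilizer. For other \<open>H\<close> it is, up to a constant factor, the same number
  for the weights modulo \<open>H\<close>.

  When \<open>\<theta>\<close> crosses a wall \<open>W\<close>, only those cones appear or disappear that are spanned by
  a basis \<open>J\<close> of the hyperplane of \<open>W\<close> and one weight \<open>q\<close> off it. The volume of such a
  basis is the volume of \<open>J\<close> times the pairing of \<open>q\<close> with the normal, up to sign and the
  length of the normal. The signs are such that summing over \<open>q\<close> gives the pairing of the
  determinant with the normal (\<open>basis_count_jump\<close>). For the primitive normal this pairing is
  \<open>\<kappa>\<close>, and its length is the ratio of the covolumes of the two character lattices
  (\<open>lattice_kernel\<close>). Hence \<open>\<Phi>\<^sub>H(X\<^sub>+) = \<Phi>\<^sub>H(X\<^sub>-) + \<kappa> \<Phi>\<^sub>H(Z\<^sub>W)\<close>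
  (\<open>phase_count_crossing\<close>), and by recursion the values of \<open>\<Phi>\<^sub>H\<close> on the factors of any
  decomposition add up to its value on the given phase (\<open>total_count_decomposition\<close>).

  Two minimal phases of the same problem are joined by a path that crosses only hyperplanes which
  contain the determinant. These have \<open>\<kappa> = 0\<close>, so that \<open>\<Phi>\<^sub>H\<close> takes the same value on both
  (\<open>phase_count_minimal_unique\<close>). So the contribution of a factor depends only on its subspace
  \<open>H'\<close>. It vanishes unless \<open>H\<close> is contained in \<open>H'\<close>, and it is positive for
  \<open>H' = H\<close>. The equations for all \<open>H\<close> thus form a triangular system for the multiplicities
  with non-zero diagonal, and its right-hand sides depend on the phase only.
\<close>

section \<open>Cones over a finite family of weights\<close>

abbreviation fcone :: "('i \<Rightarrow> 'a::euclidean_space) \<Rightarrow> 'i set \<Rightarrow> 'a set" where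
  "fcone q J \<equiv> convex_cone hull (q ` J)"

lemma fcone_explicit:
  fixes q :: "'i \<Rightarrow> 'a::euclidean_space"
  assumes "finite J"
  shows "fcone q J = {x. \<exists>a. (\<forall>i\<in>J. 0 \<le> a i) \<and> x = (\<Sum>i\<in>J. a i *\<^sub>R q i)}" (is "_ = ?S")
proof
  have "convex_cone ?S"
    unfolding convex_cone_iff
  proof (intro conjI ballI allI impI)
    show "0 \<in> ?S" by (auto intro!: exI[of _ "\<lambda>i. 0"])
    fix x y assume "x \<in> ?S" "y \<in> ?S"
    then obtain a b where ab: "\<forall>i\<in>J. 0 \<le> a i" "x = (\<Sum>i\<in>J. a i *\<^sub>R q i)"
      "\<forall>i\<in>J. 0 \<le> b i" "y = (\<Sum>i\<in>J. b i *\<^sub>R q i)" by blast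
    show "x + y \<in> ?S"
      by (rule CollectI, rule exI[of _ "\<lambda>i. a i + b i"]) (use ab in \<open>simp add: scaleR_add_left sum.distrib\<close>)
  next
    fix x and c :: real assume "x \<in> ?S" "0 \<le> c"
    then obtain a where "\<forall>i\<in>J. 0 \<le> a i" "x = (\<Sum>i\<in>J. a i *\<^sub>R q i)" by blast
    then show "c *\<^sub>R x \<in> ?S"
      by (intro CollectI exI[of _ "\<lambda>i. c * a i"]) (use \<open>0 \<le> c\<close> in \<open>simp add: scaleR_sum_right\<close>)
  qed
  moreover have "q ` J \<subseteq> ?S"
  proof clarify
    fix j assume "j \<in> J"
    then show "\<exists>a. (\<forall>i\<in>J. 0 \<le> a i) \<and> q j = (\<Sum>i\<in>J. a i *\<^sub>R q i)"
      using assms by (intro exI[of _ "\<lambda>i. if i = j then 1 else 0"]) (simp add: if_distrib[of "\<lambda>c. c *\<^sub>R _"] cong: if_cong)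
  qed
  ultimately show "fcone q J \<subseteq> ?S" by (rule hull_minimal[rotated])
  show "?S \<subseteq> fcone q J"
  proof clarify
    fix a :: "'i \<Rightarrow> real" assume a: "\<forall>i\<in>J. 0 \<le> a i"
    from assms a show "(\<Sum>i\<in>J. a i *\<^sub>R q i) \<in> fcone q J"
    proof (induction J rule: finite_induct)
      case empty then show ?case by simp
    next
      case (insert i J)
      have "fcone q J \<subseteq> fcone q (insert i J)" by (intro hull_mono) auto
      moreover have "a i *\<^sub>R q i \<in> fcone q (insert i J)"
        using insert.prems by (intro convex_cone_hull_mul hull_inc) auto
      ultimately show ?case using insert by (simp add: convex_cone_hull_add subset_iff)
    qed
  qed
qed

lemma fconeE:
  fixes q :: "'i \<Rightarrow> 'a::euclidean_space"
  assumes "finite J" "x \<in> fcone q J"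
  obtains a where "\<forall>i\<in>J. 0 \<le> a i" "x = (\<Sum>i\<in>J. a i *\<^sub>R q i)"
  using assms(2) unfolding fcone_explicit[OF assms(1)] by blast

lemma fconeI:
  fixes q :: "'i \<Rightarrow> 'a::euclidean_space"
  assumes "finite J" "\<forall>i\<in>J. 0 \<le> a i"
  shows "(\<Sum>i\<in>J. a i *\<^sub>R q i) \<in> fcone q J"
  using assms(2) unfolding fcone_explicit[OF assms(1)] by blast

lemma fcone_subset_span: "fcone q J \<subseteq> span (q ` J)"
  by (intro hull_minimal span_superset) (rule convex_cone_span)

lemma closed_fcone: "finite J \<Longrightarrow> closed (fcone q J)"
  by (intro closed_convex_cone_hull) simp

lemma convex_fcone: "convex (fcone q J)"
  by (rule convex_convex_cone_hull)

lemma fcone_mono: "J \<subseteq> J' \<Longrightarrow> fcone q J \<subseteq> fcone q J'"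
  by (intro hull_mono image_mono)

text \<open>
  Weights are an indexed family, possibly with repetitions, and are mostly used modulo the span of
  a set. This lemma and the next translate between independence and spans of sets and linear
  relations between the members of a family.
\<close>

lemma span_Un_image_explicit:
  fixes q :: "'i \<Rightarrow> 'a::euclidean_space"
  assumes "finite M" "x \<in> span (A \<union> q ` M)"
  shows "\<exists>c. x - (\<Sum>i\<in>M. c i *\<^sub>R q i) \<in> span A"
  using assms
proof (induction M arbitrary: x rule: finite_induct)
  case empty then show ?case by simp
next
  case (insert i M)
  from insert.prems have "x \<in> span (insert (q i) (A \<union> q ` M))" by simp
  then obtain k where "x - k *\<^sub>R q i \<in> span (A \<union> q ` M)"
    unfolding span_breakdown_eq by blast
  from insert.IH[OF this] obtain c where c: "x - k *\<^sub>R q i - (\<Sum>i\<in>M. c i *\<^sub>R q i) \<in> span A" by blast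
  have "(\<Sum>j\<in>M. (c(i := k)) j *\<^sub>R q j) = (\<Sum>j\<in>M. c j *\<^sub>R q j)"
    by (intro sum.cong) (use insert.hyps in auto)
  then show ?case using c insert.hyps
    by (intro exI[of _ "c(i := k)"]) (simp add: algebra_simps)
qed

lemma independent_Un_image:
  fixes q :: "'i \<Rightarrow> 'a::euclidean_space"
  assumes "finite M" "independent A"
    and "\<And>c. (\<Sum>i\<in>M. c i *\<^sub>R q i) \<in> span A \<Longrightarrow> \<forall>i\<in>M. c i = 0"
  shows "inj_on q M \<and> q ` M \<inter> A = {} \<and> independent (A \<union> q ` M)"
  using assms
proof (induction M rule: finite_induct)
  case empty then show ?case by simp
next
  case (insert i M)
  have IH: "inj_on q M \<and> q ` M \<inter> A = {} \<and> independent (A \<union> q ` M)"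
  proof (rule insert.IH[OF insert.prems(1)])
    fix c assume c: "(\<Sum>i\<in>M. c i *\<^sub>R q i) \<in> span A"
    have "(\<Sum>j\<in>M. (c(i := 0)) j *\<^sub>R q j) = (\<Sum>j\<in>M. c j *\<^sub>R q j)"
      by (intro sum.cong) (use insert.hyps in auto)
    then have "\<forall>j\<in>insert i M. (c(i := 0)) j = 0"
      using c insert.hyps by (intro insert.prems(2)) simp
    then show "\<forall>j\<in>M. c j = 0" using insert.hyps by (metis fun_upd_other insertCI)
  qed
  have "q i \<notin> span (A \<union> q ` M)"
  proof
    assume "q i \<in> span (A \<union> q ` M)"
    from span_Un_image_explicit[OF insert.hyps(1) this]
    obtain c where c: "q i - (\<Sum>i\<in>M. c i *\<^sub>R q i) \<in> span A" by blast
    have "(\<Sum>j\<in>M. ((\<lambda>j. - c j)(i := 1)) j *\<^sub>R q j) = (\<Sum>j\<in>M. (- c j) *\<^sub>R q j)"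
      by (intro sum.cong) (use insert.hyps in auto)
    then have "\<forall>j\<in>insert i M. ((\<lambda>j. - c j)(i := 1)) j = 0"
      using c insert.hyps by (intro insert.prems(2)) (simp add: sum_negf)
    then show False by simp
  qed
  moreover from this have "q i \<notin> A \<union> q ` M" by (rule contrapos_nn) (rule span_base)
  moreover have "A \<union> q ` insert i M = insert (q i) (A \<union> q ` M)" by simp
  ultimately show ?case using IH insert.hyps(2) by (auto simp add: independent_insert simp del: Un_insert_right)
qed

text \<open>
  Caratheodory's theorem for the quotient by a subspace: a combination with non-negative
  coefficients and the fewest terms is independent modulo the subspace, for otherwise a linear
  relation could be used to remove a term.
\<close>

lemma conic_caratheodory_mod:
  fixes q :: "'i \<Rightarrow> 'a::euclidean_space"
  assumes "finite J" "independent A" "x - y \<in> span A" "y \<in> fcone q J"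
  obtains M a where "M \<subseteq> J" "inj_on q M" "q ` M \<inter> A = {}" "independent (A \<union> q ` M)"
    "\<forall>i\<in>M. 0 < a i" "x - (\<Sum>i\<in>M. a i *\<^sub>R q i) \<in> span A"
proof -
  define good where "good M \<longleftrightarrow> M \<subseteq> J \<and>
    (\<exists>a. (\<forall>i\<in>M. 0 < a i) \<and> x - (\<Sum>i\<in>M. a i *\<^sub>R q i) \<in> span A)" for M
  have drop_zero: "\<exists>M'\<subseteq>M. (\<forall>i\<in>M'. 0 < a i) \<and> (\<Sum>i\<in>M'. a i *\<^sub>R q i) = (\<Sum>i\<in>M. a i *\<^sub>R q i) \<and> M' = {i\<in>M. a i \<noteq> 0}"
    if "finite M" "\<forall>i\<in>M. 0 \<le> a i" for a :: "'i \<Rightarrow> real" and M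
  proof (intro exI conjI)
    show "(\<Sum>i\<in>{i\<in>M. a i \<noteq> 0}. a i *\<^sub>R q i) = (\<Sum>i\<in>M. a i *\<^sub>R q i)"
      using that by (intro sum.mono_neutral_left) auto
  qed (use that in \<open>auto simp: order_less_le\<close>)
  obtain a where a: "\<forall>i\<in>J. 0 \<le> a i" "y = (\<Sum>i\<in>J. a i *\<^sub>R q i)"
    by (rule fconeE[OF assms(1,4)])
  obtain M0 where "M0 \<subseteq> J" "\<forall>i\<in>M0. 0 < a i" "(\<Sum>i\<in>M0. a i *\<^sub>R q i) = y"
    using drop_zero[OF assms(1) a(1)] a(2) by metis
  then have "good M0" using assms(3) unfolding good_def by blast
  define M where "M = (ARG_MIN card M. good M)"
  have M: "good M" and least: "\<And>M'. good M' \<Longrightarrow> card M \<le> card M'"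
    unfolding M_def using arg_min_nat_lemma[of good _ card] \<open>good M0\<close> by blast+
  obtain a where MJ: "M \<subseteq> J" and apos: "\<forall>i\<in>M. 0 < a i" and xa: "x - (\<Sum>i\<in>M. a i *\<^sub>R q i) \<in> span A"
    using M unfolding good_def by blast
  have finM: "finite M" using MJ assms(1) finite_subset by blast
  have "\<forall>i\<in>M. c i = 0" if c: "(\<Sum>i\<in>M. c i *\<^sub>R q i) \<in> span A" for c
  proof -
    have neg: "False" if c: "(\<Sum>i\<in>M. c i *\<^sub>R q i) \<in> span A" and j: "j \<in> M" "0 < c j" for c j
    proof -
      \<comment> \<open>move along the relation until the first coefficient vanishes\<close>
      define P where "P = {i\<in>M. 0 < c i}"
      define s where "s = Min ((\<lambda>i. a i / c i) ` P)"
      have finP: "finite ((\<lambda>i. a i / c i) ` P)" "(\<lambda>i. a i / c i) ` P \<noteq> {}"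
        using finM j unfolding P_def by auto
      have spos: "0 < s" unfolding s_def using finP apos by (subst Min_gr_iff) (auto simp: P_def)
      define b where "b i = a i - s * c i" for i
      have "\<forall>i\<in>M. 0 \<le> b i"
      proof
        fix i assume i: "i \<in> M"
        show "0 \<le> b i"
        proof (cases "0 < c i")
          case True
          then have "s \<le> a i / c i" unfolding s_def using finP i by (intro Min_le) (auto simp: P_def)
          then show ?thesis using True by (simp add: b_def field_simps)
        next
          case False
          then have "s * c i \<le> 0" using spos by (simp add: mult_nonneg_nonpos)
          then show ?thesis using apos i by (auto simp: b_def intro: order.trans[OF _ less_imp_le])
        qed
      qed
      from drop_zero[OF finM this] obtain M' where M': "M' \<subseteq> M" "\<forall>i\<in>M'. 0 < b i"
        "(\<Sum>i\<in>M'. b i *\<^sub>R q i) = (\<Sum>i\<in>M. b i *\<^sub>R q i)" "M' = {i\<in>M. b i \<noteq> 0}" by blast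
      have eq: "(\<Sum>i\<in>M. b i *\<^sub>R q i) = (\<Sum>i\<in>M. a i *\<^sub>R q i) - s *\<^sub>R (\<Sum>i\<in>M. c i *\<^sub>R q i)"
        by (simp add: b_def scaleR_sum_right scaleR_diff_left sum_subtractf)
      have "x - (\<Sum>i\<in>M'. b i *\<^sub>R q i) = (x - (\<Sum>i\<in>M. a i *\<^sub>R q i)) + s *\<^sub>R (\<Sum>i\<in>M. c i *\<^sub>R q i)"
        unfolding M'(3) eq by simp
      then have "x - (\<Sum>i\<in>M'. b i *\<^sub>R q i) \<in> span A"
        by (simp only:) (intro span_add span_scale xa c)
      then have "good M'" unfolding good_def using M' MJ by blast
      then have "card M \<le> card M'" by (rule least)
      moreover have "s \<in> (\<lambda>i. a i / c i) ` P" unfolding s_def by (rule Min_in[OF finP])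
      then obtain k where "k \<in> P" "s = a k / c k" by (elim imageE)
      then have "b k = 0" "k \<in> M" unfolding b_def P_def by auto
      then have "M' \<subset> M" using M'(4) by auto
      then have "card M' < card M" by (rule psubset_card_mono[OF finM])
      ultimately show False by linarith
    qed
    have c': "(\<Sum>i\<in>M. (- c i) *\<^sub>R q i) \<in> span A" using c by (simp add: sum_negf span_neg)
    show ?thesis using neg[OF c] neg[OF c'] by (metis linorder_neqE_linordered_idom neg_0_less_iff_less)
  qed
  then have "inj_on q M \<and> q ` M \<inter> A = {} \<and> independent (A \<union> q ` M)"
    by (intro independent_Un_image[OF finM assms(2)])
  then show thesis using that[of M a] MJ apos xa by blast
qed

lemma eventually_perturb_pos:
  fixes a b :: real
  assumes "0 < a"
  shows "\<forall>\<^sub>F t in at_right 0. 0 < a + t * b"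
proof -
  have "((\<lambda>t. a + t * b) \<longlongrightarrow> a + 0 * b) (at_right 0)" by (intro tendsto_intros)
  then show ?thesis using assms order_tendstoD(1) by fastforce
qed

lemma exists_fun_on_image:
  fixes q :: "'i \<Rightarrow> 'a::real_vector"
  assumes "inj_on q M"
  shows "\<exists>c. \<forall>i\<in>M. c (q i) = a i"
  using assms by (intro exI[of _ "\<lambda>v. a (the_inv_into M q v)"]) (simp add: the_inv_into_f_f)

lemma independent_family_unique:
  fixes q :: "'i \<Rightarrow> 'a::euclidean_space"
  assumes "finite M" "inj_on q M" "independent (q ` M)"
    "(\<Sum>i\<in>M. a i *\<^sub>R q i) = (\<Sum>i\<in>M. b i *\<^sub>R q i)" "i \<in> M"
  shows "a i = b i"
proof -
  obtain c where c: "\<forall>i\<in>M. c (q i) = a i - b i" using exists_fun_on_image[OF assms(2), of "\<lambda>i. a i - b i"] by auto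
  have "(\<Sum>v\<in>q ` M. c v *\<^sub>R v) = (\<Sum>i\<in>M. (a i - b i) *\<^sub>R q i)"
    by (subst sum.reindex[OF assms(2)]) (use c in \<open>auto intro: sum.cong\<close>)
  also have "\<dots> = 0" using assms(4) by (simp add: scaleR_diff_left sum_subtractf)
  finally have "\<forall>v\<in>q ` M. c v = 0"
    using assms(1,3) by (metis finite_imageI independent_explicit)
  then show ?thesis using c assms(5) by fastforce
qed

text \<open>
  Modulo the span of the given simplicial cone, the direction is a non-negative combination of
  independent weights, and adding these gives a larger simplicial cone which has the given one as a
  face. The coefficients on the given cone are positive to begin with and stay so at first.
\<close>

lemma cone_extension:
  fixes q :: "'i \<Rightarrow> 'a::euclidean_space"
  assumes "finite N" "J \<subseteq> N" "inj_on q J" "independent (q ` J)"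
    and p: "p = (\<Sum>i\<in>J. a i *\<^sub>R q i)" "\<forall>i\<in>J. 0 < a i"
    and s: "0 < s" "p + s *\<^sub>R u \<in> fcone q N"
  obtains M where "J \<subseteq> M" "M \<subseteq> N" "inj_on q M" "independent (q ` M)"
    "\<forall>\<^sub>F t in at_right 0. p + t *\<^sub>R u \<in> fcone q M"
proof -
  have finJ: "finite J" using assms(1,2) finite_subset by blast
  have pspan: "p \<in> span (q ` J)" unfolding p by (intro span_sum span_scale span_base) auto
  have cone: "(1/s) *\<^sub>R (p + s *\<^sub>R u) \<in> fcone q N" using s by (intro convex_cone_hull_mul) auto
  have "u - (1/s) *\<^sub>R (p + s *\<^sub>R u) = (- 1/s) *\<^sub>R p" using s by (simp add: algebra_simps)
  then have "u - (1/s) *\<^sub>R (p + s *\<^sub>R u) \<in> span (q ` J)" using pspan span_scale by metis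
  note us = this
  obtain M b where M: "M \<subseteq> N" "inj_on q M" "q ` M \<inter> q ` J = {}" "independent (q ` J \<union> q ` M)"
    "\<forall>i\<in>M. 0 < b i" "u - (\<Sum>i\<in>M. b i *\<^sub>R q i) \<in> span (q ` J)"
    by (rule conic_caratheodory_mod[OF assms(1,4) us cone])
  have finM: "finite M" using M assms(1) finite_subset by blast
  have disj: "J \<inter> M = {}" using M(3) by blast
  have "u - (\<Sum>i\<in>M. b i *\<^sub>R q i) \<in> span ({} \<union> q ` J)" using M(6) by simp
  from span_Un_image_explicit[OF finJ this]
  obtain c where "u - (\<Sum>i\<in>M. b i *\<^sub>R q i) - (\<Sum>i\<in>J. c i *\<^sub>R q i) = 0" by auto
  then have c: "u = (\<Sum>i\<in>M. b i *\<^sub>R q i) + (\<Sum>i\<in>J. c i *\<^sub>R q i)" by (simp add: algebra_simps)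
  define d where "d t i = (if i \<in> J then a i + t * c i else t * b i)" for t i
  have "p + t *\<^sub>R u = (\<Sum>i\<in>J \<union> M. d t i *\<^sub>R q i)" for t
  proof -
    have "(\<Sum>i\<in>J \<union> M. d t i *\<^sub>R q i) = (\<Sum>i\<in>J. d t i *\<^sub>R q i) + (\<Sum>i\<in>M. d t i *\<^sub>R q i)"
      using finJ finM disj by (rule sum.union_disjoint)
    also have "(\<Sum>i\<in>J. d t i *\<^sub>R q i) = p + t *\<^sub>R (\<Sum>i\<in>J. c i *\<^sub>R q i)"
      by (simp add: d_def p scaleR_sum_right scaleR_add_left sum.distrib)
    also have "(\<Sum>i\<in>M. d t i *\<^sub>R q i) = t *\<^sub>R (\<Sum>i\<in>M. b i *\<^sub>R q i)"
      unfolding scaleR_sum_right by (intro sum.cong) (use disj in \<open>auto simp: d_def\<close>)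
    finally show ?thesis by (simp add: c scaleR_add_right)
  qed
  moreover have "\<forall>\<^sub>F t in at_right 0. \<forall>i\<in>J. 0 < a i + t * c i"
    using finJ p(2) by (intro eventually_ball_finite) (auto intro: eventually_perturb_pos)
  then have "\<forall>\<^sub>F t in at_right 0. \<forall>i\<in>J \<union> M. 0 \<le> d t i"
    using eventually_at_right_less[of "0::real"]
    by eventually_elim (use M(5) in \<open>auto simp: d_def less_imp_le\<close>)
  ultimately have "\<forall>\<^sub>F t in at_right 0. p + t *\<^sub>R u \<in> fcone q (J \<union> M)"
    using fcone_explicit[of "J \<union> M" q] finJ finM by (auto elim!: eventually_mono)
  moreover have "inj_on q (J \<union> M)"
    using assms(3) M(2,3) disj by (auto simp: inj_on_Un)
  ultimately show thesis using that[of "J \<union> M"] M assms(2) by (simp add: image_Un)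
qed

section \<open>Cells of the secondary fan\<close>

text \<open>
  The cone of the secondary fan through a point, stated for a bare family of weights.
\<close>

definition fan_cell :: "('i \<Rightarrow> 'a::euclidean_space) \<Rightarrow> 'i set \<Rightarrow> 'a \<Rightarrow> 'a set" where
  "fan_cell q N \<theta> = \<Inter>{fcone q J | J. J \<subseteq> N \<and> \<theta> \<in> fcone q J}"

lemma fan_cell_self: "\<theta> \<in> fan_cell q N \<theta>"
  by (auto simp: fan_cell_def)

lemma fan_cell_subset: "J \<subseteq> N \<Longrightarrow> \<theta> \<in> fcone q J \<Longrightarrow> fan_cell q N \<theta> \<subseteq> fcone q J"
  by (auto simp: fan_cell_def)

lemma convex_fan_cell: "convex (fan_cell q N \<theta>)"
  unfolding fan_cell_def by (intro convex_Inter) (auto intro: convex_fcone)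

lemma closed_fan_cell: "finite N \<Longrightarrow> closed (fan_cell q N \<theta>)"
  unfolding fan_cell_def by (intro closed_Inter) (auto intro: closed_fcone finite_subset)

lemma zero_in_fan_cell: "0 \<in> fan_cell q N \<theta>"
  unfolding fan_cell_def by (auto intro: convex_cone_hull_contains_0)

lemma segment_closed_last:
  fixes f :: "real \<Rightarrow> 'a::topological_space"
  assumes "closed S" "continuous_on {0..1} f" "t0 \<in> {0..1}" "f t0 \<in> S" "f 1 \<notin> S"
  obtains T where "T \<in> {0..<1}" "f T \<in> S" "\<And>t. T < t \<Longrightarrow> t \<le> 1 \<Longrightarrow> f t \<notin> S"
proof -
  let ?K = "{t\<in>{0..1}. f t \<in> S}"
  have "closed ?K" using continuous_closed_preimage[OF assms(2) closed_atLeastAtMost assms(1)]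
    by (simp add: vimage_def Int_def conj_commute)
  moreover have "bounded ?K" by (rule bounded_subset[OF bounded_closed_interval[of 0 1]]) auto
  ultimately have "compact ?K" by (simp add: compact_eq_bounded_closed)
  moreover have "?K \<noteq> {}" using assms by auto
  ultimately have "\<exists>T\<in>?K. \<forall>t\<in>?K. t \<le> T" by (rule compact_attains_sup)
  then obtain T where T: "T \<in> ?K" "\<And>t. t \<in> ?K \<Longrightarrow> t \<le> T" by blast
  then have "T \<noteq> 1" using assms(5) by auto
  then have "T \<in> {0..<1}" using T(1) by auto
  then show thesis using T that[of T] by (metis (no_types, lifting) atLeastAtMost_iff atLeastLessThan_iff dual_order.strict_trans1 less_imp_le linorder_not_less mem_Collect_eq)
qed

text \<open>
  All points in the relative interior of a cell lie in the same cones, so that the semistable locus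
  is constant there. Otherwise walk from an exceptional point towards the point \<open>\<theta>0\<close> that
  defines the cell. The last exceptional point \<open>p\<close> is still in the relative interior and lies in
  a simplicial cone that misses \<open>\<theta>0\<close>. By \<open>cone_extension\<close> that cone is a face of a
  simplicial cone entered right after \<open>p\<close>, which therefore contains \<open>\<theta>0\<close> and the whole
  cell. As the cell extends beyond \<open>p\<close>, the coordinates of \<open>p\<close> in it are positive wherever
  those of \<open>\<theta>0\<close> are. So \<open>\<theta>0\<close> lies in the face, a contradiction.
\<close>

lemma rel_interior_fan_cell_pattern:
  fixes q :: "'i \<Rightarrow> 'a::euclidean_space"
  assumes N: "finite N" and \<theta>0: "\<theta>0 \<in> fcone q N"
    and \<theta>: "\<theta> \<in> rel_interior (fan_cell q N \<theta>0)"
    and J: "J \<subseteq> N" "\<theta> \<in> fcone q J"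
  shows "\<theta>0 \<in> fcone q J"
proof (rule ccontr)
  let ?C = "fan_cell q N \<theta>0"
  assume out: "\<theta>0 \<notin> fcone q J"
  \<comment> \<open>the union of the cones that miss the point defining the cell\<close>
  define S where "S = (\<Union>J\<in>{J. J \<subseteq> N \<and> \<theta>0 \<notin> fcone q J}. fcone q J)"
  define f where "f t = \<theta> + t *\<^sub>R (\<theta>0 - \<theta>)" for t
  have "closed S" unfolding S_def using N
    by (intro closed_UN) (auto intro: closed_fcone finite_subset)
  moreover have "continuous_on {0..1} f" unfolding f_def by (intro continuous_intros)
  moreover have "f 0 \<in> S" "f 1 \<notin> S" using J out unfolding S_def f_def by auto
  ultimately obtain T where T: "T \<in> {0..<1}" "f T \<in> S" "\<And>t. T < t \<Longrightarrow> t \<le> 1 \<Longrightarrow> f t \<notin> S"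
    using segment_closed_last[of S f 0] by auto
  define p where "p = f T"
  define u where "u = \<theta>0 - \<theta>"
  have pint: "p \<in> rel_interior ?C"
  proof -
    have "\<theta>0 - (1 - T) *\<^sub>R (\<theta>0 - \<theta>) \<in> rel_interior ?C"
      using T(1) by (intro rel_interior_convex_shrink[OF convex_fan_cell \<theta> fan_cell_self]) auto
    then show ?thesis by (simp add: p_def f_def algebra_simps)
  qed
  have fp: "f (T + t) = p + t *\<^sub>R u" for t by (simp add: p_def f_def u_def algebra_simps)
  obtain J1 where J1: "J1 \<subseteq> N" "\<theta>0 \<notin> fcone q J1" "p \<in> fcone q J1"
    using T(2) unfolding S_def p_def by blast
  have finJ1: "finite J1" using J1 N finite_subset by blast
  obtain J2 a where J2: "J2 \<subseteq> J1" "inj_on q J2" "independent (q ` J2)"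
    "\<forall>i\<in>J2. 0 < a i" "p = (\<Sum>i\<in>J2. a i *\<^sub>R q i)"
    by (rule conic_caratheodory_mod[OF finJ1 independent_empty _ J1(3), of p]) auto
  have "?C \<subseteq> fcone q N" by (rule fan_cell_subset[OF order_refl \<theta>0])
  have mem: "f t \<in> ?C" if "0 \<le> t" "t \<le> 1" for t
  proof -
    have "(1 - t) *\<^sub>R \<theta> + t *\<^sub>R \<theta>0 \<in> ?C"
      using that \<theta> rel_interior_subset by (intro convexD[OF convex_fan_cell]) (auto intro: fan_cell_self)
    then show ?thesis by (simp add: f_def algebra_simps)
  qed
  define s where "s = 1 - T"
  have s: "0 < s" "p + s *\<^sub>R u \<in> fcone q N"
    using T(1) mem[of 1] \<open>?C \<subseteq> fcone q N\<close> unfolding s_def fp[symmetric] by auto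
  obtain M where M: "J2 \<subseteq> M" "M \<subseteq> N" "inj_on q M" "independent (q ` M)"
    "\<forall>\<^sub>F t in at_right 0. p + t *\<^sub>R u \<in> fcone q M"
    by (rule cone_extension[OF N subset_trans[OF J2(1) J1(1)] J2(2,3,5,4) s])
  have finM: "finite M" using M N finite_subset by blast
  have "\<forall>\<^sub>F t in at_right 0. 0 < t \<and> t < s"
    using eventually_at_right[of 0 s] s(1) by (auto simp: eventually_at_right_field)
  then obtain t where t: "0 < t" "t < s" "p + t *\<^sub>R u \<in> fcone q M"
    using eventually_happens[OF eventually_conj[OF M(5)]] by force
  have "f (T + t) \<notin> S" using t by (intro T(3)) (auto simp: s_def)
  then have \<theta>0M: "\<theta>0 \<in> fcone q M" using t(3) M(2) unfolding S_def fp by blast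
  then obtain b where b: "\<forall>i\<in>M. 0 \<le> b i" "\<theta>0 = (\<Sum>i\<in>M. b i *\<^sub>R q i)"
    by (rule fconeE[OF finM])
  define M0 where "M0 = {i\<in>M. 0 < b i}"
  have "\<theta>0 = (\<Sum>i\<in>M0. b i *\<^sub>R q i)"
    unfolding b(2) M0_def by (rule sum.mono_neutral_right) (use finM b(1) in \<open>auto simp: order_less_le\<close>)
  then have \<theta>0M0: "\<theta>0 \<in> fcone q M0" using finM fconeI[of M0 b q] by (simp add: M0_def)
  \<comment> \<open>If a positive coordinate of \<open>\<theta>0\<close> vanished at \<open>p\<close>, it would become negative beyond \<open>p\<close>, inside the cell.\<close>
  have "M0 \<subseteq> J2"
  proof (rule ccontr)
    assume "\<not> M0 \<subseteq> J2"
    then obtain j where j: "j \<in> M" "0 < b j" "j \<notin> J2" unfolding M0_def by blast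
    obtain e where e: "1 < e" "(1 - e) *\<^sub>R \<theta>0 + e *\<^sub>R p \<in> ?C"
      using pint convex_rel_interior_iff[OF convex_fan_cell] fan_cell_self by blast
    then have "(1 - e) *\<^sub>R \<theta>0 + e *\<^sub>R p \<in> fcone q M"
      using fan_cell_subset[OF M(2) \<theta>0M] by blast
    then obtain c where c: "\<forall>i\<in>M. 0 \<le> c i" "(1 - e) *\<^sub>R \<theta>0 + e *\<^sub>R p = (\<Sum>i\<in>M. c i *\<^sub>R q i)"
      by (rule fconeE[OF finM])
    define a' where "a' i = (if i \<in> J2 then a i else 0)" for i
    have "p = (\<Sum>i\<in>J2. a' i *\<^sub>R q i)" unfolding J2(5) by (simp add: a'_def)
    also have "\<dots> = (\<Sum>i\<in>M. a' i *\<^sub>R q i)"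
      by (rule sum.mono_neutral_left) (use finM M(1) in \<open>auto simp: a'_def\<close>)
    finally have "(\<Sum>i\<in>M. c i *\<^sub>R q i) = (\<Sum>i\<in>M. ((1 - e) * b i + e * a' i) *\<^sub>R q i)"
      unfolding c(2)[symmetric] b(2) by (simp add: scaleR_sum_right scaleR_add_left sum.distrib)
    then have "c j = (1 - e) * b j + e * a' j"
      by (rule independent_family_unique[OF finM M(3,4) _ j(1)])
    then have "c j < 0" using j e(1) by (simp add: a'_def mult_neg_pos)
    then show False using c(1) j(1) by fastforce
  qed
  then have "\<theta>0 \<in> fcone q J1" using \<theta>0M0 J2(1) fcone_mono by (metis subset_iff subset_trans)
  then show False using J1(2) by blast
qed

section \<open>Volumes of parallelotopes\<close>

lemma infdist_subspace:
  fixes x :: "'a::euclidean_space"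
  assumes "subspace U" "y \<in> U" "\<And>w. w \<in> U \<Longrightarrow> z \<bullet> w = 0" "x = y + z"
  shows "infdist x U = norm z"
proof (rule antisym)
  have U: "U \<noteq> {}" using assms(2) by blast
  show "infdist x U \<le> norm z" by (rule infdist_le2[OF assms(2)]) (simp add: assms(4) dist_norm)
  have "norm z \<le> dist x w" if "w \<in> U" for w
  proof -
    have "orthogonal (y - w) z"
      using assms(3)[OF subspace_diff[OF assms(1,2) that]] by (simp add: orthogonal_def inner_commute)
    from norm_add_Pythagorean[OF this] have "(norm (x - w))\<^sup>2 = (norm (y - w))\<^sup>2 + (norm z)\<^sup>2"
      by (simp add: assms(4) algebra_simps)
    then have "(norm z)\<^sup>2 \<le> (norm (x - w))\<^sup>2" by simp
    then show ?thesis unfolding dist_norm by (rule power2_le_imp_le) simp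
  qed
  then show "norm z \<le> infdist x U" unfolding infdist_notempty[OF U] by (intro cINF_greatest U)
qed

lemma span_decomposition:
  fixes x :: "'a::euclidean_space"
  obtains y z where "y \<in> span U" "\<And>w. w \<in> span U \<Longrightarrow> z \<bullet> w = 0" "x = y + z"
proof -
  obtain y z where "y \<in> span U" "\<And>w. w \<in> span U \<Longrightarrow> orthogonal z w" "x = y + z"
    by (rule orthogonal_subspace_decomp_exists[of U x]) blast
  then show thesis using that[of y z] unfolding orthogonal_def by blast
qed

text \<open>
  The right-hand side is the area of the parallelogram spanned by the components orthogonal to
  \<open>U\<close>. It is symmetric in the two vectors, which makes the volume below independent of the order
  in which vectors are adjoined.
\<close>

lemma infdist_span_insert:
  fixes v w :: "'a::euclidean_space"
  assumes v: "v1 \<in> span U" "\<And>x. x \<in> span U \<Longrightarrow> v2 \<bullet> x = 0" "v = v1 + v2"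
    and w: "w1 \<in> span U" "\<And>x. x \<in> span U \<Longrightarrow> w2 \<bullet> x = 0" "w = w1 + w2"
  shows "infdist v (span U) * infdist w (span (insert v U))
    = sqrt ((v2 \<bullet> v2) * (w2 \<bullet> w2) - (v2 \<bullet> w2)\<^sup>2)"
proof -
  have dv: "infdist v (span U) = norm v2" using v by (intro infdist_subspace) auto
  show ?thesis
  proof (cases "v2 = 0")
    case True then show ?thesis using dv by simp
  next
    case False
    define c where "c = (w2 \<bullet> v2) / (v2 \<bullet> v2)"
    define w3 where "w3 = w2 - c *\<^sub>R v2"
    have nz: "v2 \<bullet> v2 \<noteq> 0" using False by simp
    have orth: "w3 \<bullet> x = 0" if x: "x \<in> span U" for x using v(2)[OF x] w(2)[OF x] by (simp add: w3_def inner_diff_left)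
    have "w3 \<bullet> v2 = 0" using nz by (simp add: w3_def c_def inner_diff_left)
    then have orthv: "w3 \<bullet> v = 0" using orth[OF v(1)] by (simp add: v(3) inner_add_right)
    have "infdist w (span (insert v U)) = norm w3"
    proof (rule infdist_subspace[OF subspace_span])
      have "span U \<subseteq> span (insert v U)" by (intro span_mono) auto
      then show "w1 - c *\<^sub>R v1 + c *\<^sub>R v \<in> span (insert v U)"
        using v(1) w(1) by (intro span_add span_diff span_scale) (auto intro: span_base)
      show "w = w1 - c *\<^sub>R v1 + c *\<^sub>R v + w3" by (simp add: v(3) w(3) w3_def algebra_simps)
      fix x assume "x \<in> span (insert v U)"
      then obtain k where k: "x - k *\<^sub>R v \<in> span U" unfolding span_breakdown_eq by blast
      have "w3 \<bullet> x = w3 \<bullet> (x - k *\<^sub>R v) + k * (w3 \<bullet> v)" by (simp add: inner_diff_right)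
      then show "w3 \<bullet> x = 0" using orth[OF k] orthv by simp
    qed
    then have "infdist v (span U) * infdist w (span (insert v U)) = sqrt ((v2 \<bullet> v2) * (w3 \<bullet> w3))"
      by (simp add: dv norm_eq_sqrt_inner real_sqrt_mult)
    moreover have "(v2 \<bullet> v2) * (w3 \<bullet> w3) = (v2 \<bullet> v2) * (w2 \<bullet> w2) - (v2 \<bullet> w2)\<^sup>2"
      unfolding w3_def c_def
      using nz by (simp add: inner_diff_left inner_diff_right inner_commute field_simps power2_eq_square)
    ultimately show ?thesis by simp
  qed
qed

lemma infdist_span_insert_commute:
  fixes v w :: "'a::euclidean_space"
  shows "infdist v (span U) * infdist w (span (insert v U)) = infdist w (span U) * infdist v (span (insert w U))"
proof -
  obtain v1 v2 where v: "v1 \<in> span U" "\<And>x. x \<in> span U \<Longrightarrow> v2 \<bullet> x = 0" "v = v1 + v2"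
    using span_decomposition[of U v] by metis
  obtain w1 w2 where w: "w1 \<in> span U" "\<And>x. x \<in> span U \<Longrightarrow> w2 \<bullet> x = 0" "w = w1 + w2"
    using span_decomposition[of U w] by metis
  show ?thesis
    using infdist_span_insert[OF v w] infdist_span_insert[OF w v] by (simp add: inner_commute mult.commute)
qed

definition parallelotope_vol_step :: "'a::euclidean_space \<Rightarrow> 'a set \<times> real \<Rightarrow> 'a set \<times> real" where
  "parallelotope_vol_step v = (\<lambda>(U, p). (span (insert v U), p * infdist v (span U)))"

text \<open>
  The volume of the parallelotope spanned by a set of vectors, in the span of the set, as the
  product of the successive heights. The fold carries the vectors adjoined so far, up to their
  span, together with the product. This needs no choice of coordinates and makes sense in
  every dimension, so that the volumes in a space and in a hyperplane can be compared.
\<close>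

definition parallelotope_vol :: "'a::euclidean_space set \<Rightarrow> real" where
  "parallelotope_vol S = snd (Finite_Set.fold parallelotope_vol_step ({}, 1) S)"

lemma span_insert_span: "span (insert v (span U)) = span (insert v U)"
  using span_Un[of "{v}" "span U"] span_Un[of "{v}" U] by (simp add: span_span)

lemma comp_fun_commute_parallelotope_vol_step: "comp_fun_commute (parallelotope_vol_step :: 'a::euclidean_space \<Rightarrow> _)"
proof
  fix v w :: 'a
  have "parallelotope_vol_step w (parallelotope_vol_step v (U, p)) = parallelotope_vol_step v (parallelotope_vol_step w (U, p))" for U p
    using infdist_span_insert_commute[of v U w]
    by (simp add: parallelotope_vol_step_def span_insert_span insert_commute mult.assoc span_span)
  then show "parallelotope_vol_step w \<circ> parallelotope_vol_step v = parallelotope_vol_step v \<circ> parallelotope_vol_step w" by auto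
qed

lemma parallelotope_vol_empty [simp]: "parallelotope_vol {} = 1"
  by (simp add: parallelotope_vol_def)

lemma parallelotope_vol_insert:
  assumes "finite S" "v \<notin> S"
  shows "parallelotope_vol (insert v S) = parallelotope_vol S * infdist v (span S)"
proof -
  interpret comp_fun_commute "parallelotope_vol_step :: 'a \<Rightarrow> _" by (rule comp_fun_commute_parallelotope_vol_step)
  have step: "parallelotope_vol_step x P = (span (insert x (fst P)), snd P * infdist x (span (fst P)))" for x :: 'a and P
    by (simp add: parallelotope_vol_step_def case_prod_unfold)
  have "span (fst (Finite_Set.fold parallelotope_vol_step ({}, 1) S)) = span S" using assms(1)
  proof (induction rule: finite_induct)
    case empty then show ?case by simp
  next
    case (insert x F)
    have fold_insert: "Finite_Set.fold parallelotope_vol_step ({}, 1) (insert x F) = parallelotope_vol_step x (Finite_Set.fold parallelotope_vol_step ({}, 1) F)"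
      using insert.hyps by (rule fold_insert)
    let ?U = "fst (Finite_Set.fold parallelotope_vol_step ({}, 1) F)"
    have "span (insert x ?U) = span (insert x (span ?U))" by (rule span_insert_span[symmetric])
    also have "\<dots> = span (insert x F)" unfolding insert.IH by (rule span_insert_span)
    finally show ?case 
      by (simp add: fold_insert step[of x "Finite_Set.fold parallelotope_vol_step ({}, 1) F"] span_span)
  qed
  then show ?thesis using fold_insert[OF assms, of "({}, 1)"]
    by (simp add: parallelotope_vol_def step[of v "Finite_Set.fold parallelotope_vol_step ({}, 1) S"])
qed

lemma parallelotope_vol_pos:
  fixes S :: "'a::euclidean_space set"
  assumes "independent S"
  shows "0 < parallelotope_vol S"
proof -
  have "finite S" using assms by (rule independent_imp_finite)
  then show ?thesis using assms
  proof (induction rule: finite_induct)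
    case empty then show ?case by simp
  next
    case (insert x F)
    then have "x \<notin> span F" "independent F" by (auto simp: independent_insert)
    moreover then have "0 < infdist x (span F)"
      by (intro infdist_pos_not_in_closed closed_span) (auto intro: span_zero)
    ultimately show ?case using insert by (simp add: parallelotope_vol_insert)
  qed
qed

text \<open>
  The height of a weight over a hyperplane is its pairing with the unit normal: this is how
  \<open>\<kappa>\<close> enters.
\<close>

lemma infdist_along_normal:
  fixes l :: "'a::euclidean_space"
  assumes "l \<noteq> 0" "\<And>y. y \<in> U \<Longrightarrow> y \<bullet> l = 0" "x \<in> span (insert l U)"
  shows "infdist x (span U) = \<bar>x \<bullet> l\<bar> / norm l"
proof -
  have orth: "l \<bullet> y = 0" if "y \<in> span U" for y
    using that by (induction rule: span_induct_alt) (use assms(2) in \<open>simp_all add: inner_add_right inner_commute\<close>)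
  obtain k where k: "x - k *\<^sub>R l \<in> span U" using assms(3) unfolding span_breakdown_eq by blast
  have "infdist x (span U) = norm (k *\<^sub>R l)"
    by (rule infdist_subspace[OF subspace_span k]) (simp_all add: orth)
  moreover have "x \<bullet> l = k * (l \<bullet> l)" using orth[OF k] by (simp add: inner_diff_right inner_commute)
  ultimately show ?thesis using assms(1) by (simp add: dot_square_norm abs_mult power2_eq_square)
qed

section \<open>Lattices and covolumes\<close>

definition zspan :: "'a::euclidean_space set \<Rightarrow> 'a set" where
  "zspan B = range (\<lambda>k :: 'a \<Rightarrow> int. \<Sum>b\<in>B. of_int (k b) *\<^sub>R b)"

lemma zspan_empty [simp]: "zspan {} = {0}"
  by (auto simp: zspan_def)

lemma zspan_insert:
  assumes "finite S" "b \<notin> S"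
  shows "zspan (insert b S) = {of_int k *\<^sub>R b + s | k s. s \<in> zspan S}"
proof (intro set_eqI iffI)
  fix x assume "x \<in> zspan (insert b S)"
  then show "x \<in> {of_int k *\<^sub>R b + s | k s. s \<in> zspan S}" using assms by (auto simp: zspan_def)
next
  fix x assume "x \<in> {of_int k *\<^sub>R b + s | k s. s \<in> zspan S}"
  then obtain k f where x: "x = of_int k *\<^sub>R b + (\<Sum>b\<in>S. of_int (f b) *\<^sub>R b)" by (auto simp: zspan_def)
  have "(\<Sum>c\<in>S. of_int ((f(b := k)) c) *\<^sub>R c) = (\<Sum>b\<in>S. of_int (f b) *\<^sub>R b)"
    using assms(2) by (intro sum.cong) auto
  then have "x = (\<Sum>c\<in>insert b S. of_int ((f(b := k)) c) *\<^sub>R c)" using assms x by simp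
  then show "x \<in> zspan (insert b S)" unfolding zspan_def by blast
qed

lemma zspan_add: "x \<in> zspan B \<Longrightarrow> y \<in> zspan B \<Longrightarrow> x + y \<in> zspan B"
  unfolding zspan_def
proof clarify
  fix k k' :: "'a \<Rightarrow> int"
  show "(\<Sum>b\<in>B. of_int (k b) *\<^sub>R b) + (\<Sum>b\<in>B. of_int (k' b) *\<^sub>R b) \<in> range (\<lambda>k. \<Sum>b\<in>B. of_int (k b) *\<^sub>R b)"
    by (intro range_eqI[of _ _ "\<lambda>b. k b + k' b"]) (simp add: scaleR_add_left sum.distrib)
qed

lemma zspan_scale: "x \<in> zspan B \<Longrightarrow> of_int m *\<^sub>R x \<in> zspan B"
  unfolding zspan_def
proof clarify
  fix k :: "'a \<Rightarrow> int"
  show "of_int m *\<^sub>R (\<Sum>b\<in>B. of_int (k b) *\<^sub>R b) \<in> range (\<lambda>k. \<Sum>b\<in>B. of_int (k b) *\<^sub>R b)"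
    by (intro range_eqI[of _ _ "\<lambda>b. m * k b"]) (simp add: scaleR_sum_right)
qed

lemma zspan_base: "finite B \<Longrightarrow> b \<in> B \<Longrightarrow> b \<in> zspan B"
  unfolding zspan_def by (intro range_eqI[of _ _ "\<lambda>c. if c = b then 1 else 0"])
    (simp add: if_distrib[of of_int] if_distrib[of "\<lambda>c. c *\<^sub>R _"] cong: if_cong)

lemma zspan_subset_span: "zspan B \<subseteq> span B"
  unfolding zspan_def by (auto intro!: span_sum span_scale intro: span_base)

lemma span_zspan: "finite B \<Longrightarrow> span (zspan B) = span B"
  by (metis zspan_base zspan_subset_span span_eq span_superset subset_iff)

lemma inner_span_zero: "x \<in> span T \<Longrightarrow> (\<And>y. y \<in> T \<Longrightarrow> y \<bullet> l = 0) \<Longrightarrow> x \<bullet> l = 0"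
  by (induction rule: span_induct_alt) (simp_all add: inner_add_left)

lemma zspan_kernel:
  assumes "finite T" "b \<notin> T" "\<And>x. x \<in> T \<Longrightarrow> x \<bullet> l = 0" "b \<bullet> l \<noteq> 0"
  shows "{x \<in> zspan (insert b T). x \<bullet> l = 0} = zspan T"
proof -
  have T: "s \<bullet> l = 0" if "s \<in> zspan T" for s
    using that zspan_subset_span inner_span_zero[OF _ assms(3)] by blast
  show ?thesis unfolding zspan_insert[OF assms(1,2)]
    using T assms(4) by (fastforce simp: inner_add_left intro: exI[of _ "0::int"])
qed

text \<open>
  One step of the Euclidean algorithm on a lattice basis: adding to a basis vector an integral
  combination of the others is a shear.
\<close>

lemma zspan_shear:
  assumes "independent (insert b S)" "b \<notin> S" "c \<in> zspan S"
  shows "independent (insert (b + c) S) \<and> zspan (insert (b + c) S) = zspan (insert b S) \<and>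
    parallelotope_vol (insert (b + c) S) = parallelotope_vol (insert b S) \<and> b + c \<notin> S"
proof -
  have ind: "independent S" "b \<notin> span S" using assms by (auto simp: independent_insert)
  have fin: "finite S" by (rule independent_imp_finite[OF ind(1)])
  have cS: "c \<in> span S" using assms(3) zspan_subset_span by blast
  have out: "b + c \<notin> span S" using ind(2) cS span_diff[of "b + c" S c] by auto
  then have out': "b + c \<notin> S" using span_base by metis
  have sub: "zspan (insert (b + c) S) \<subseteq> zspan (insert b S)" if h: "c \<in> zspan S" "b \<notin> S" "b + c \<notin> S" for b c
  proof
    fix x assume "x \<in> zspan (insert (b + c) S)"
    then obtain k s where "x = of_int k *\<^sub>R (b + c) + s" "s \<in> zspan S"
      unfolding zspan_insert[OF fin h(3)] by blast
    then have "x = of_int k *\<^sub>R b + (of_int k *\<^sub>R c + s)" "of_int k *\<^sub>R c + s \<in> zspan S"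
      using h(1) by (auto simp: scaleR_add_right intro: zspan_add zspan_scale)
    then show "x \<in> zspan (insert b S)" unfolding zspan_insert[OF fin h(2)] by blast
  qed
  have "- c \<in> zspan S" using zspan_scale[OF assms(3), of "-1"] by simp
  then have "zspan (insert b S) \<subseteq> zspan (insert (b + c) S)"
    using sub[of "- c" "b + c"] assms(2) out' by simp
  moreover have "infdist (b + c) (span S) = infdist b (span S)"
  proof -
    obtain y z where yz: "y \<in> span S" "\<And>w. w \<in> span S \<Longrightarrow> z \<bullet> w = 0" "b = y + z"
      using span_decomposition[of S b] by metis
    have "infdist b (span S) = norm z" by (rule infdist_subspace[OF subspace_span yz])
    moreover have "infdist (b + c) (span S) = norm z"
      by (rule infdist_subspace[OF subspace_span span_add[OF yz(1) cS] yz(2)]) (simp_all add: yz(3))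
    ultimately show ?thesis by simp
  qed
  ultimately show ?thesis
    using sub[OF assms(3,2) out'] ind out out' fin assms(2) by (auto simp: parallelotope_vol_insert independent_insert)
qed

text \<open>
  The Euclidean algorithm, applied to the pairings of the basis vectors with \<open>l\<close>: subtracting
  the vector with the smaller pairing from the one with the larger decreases the sum of the absolute
  values, until at most one basis vector pairs non-trivially with \<open>l\<close>.
\<close>

lemma euclid_basis:
  fixes B :: "'a::euclidean_space set"
  assumes "independent B" "\<forall>b\<in>B. b \<bullet> l \<in> \<int>"
  shows "\<exists>B'. independent B' \<and> zspan B' = zspan B \<and> parallelotope_vol B' = parallelotope_vol B \<and>
    (\<forall>x\<in>B'. \<forall>y\<in>B'. x \<bullet> l \<noteq> 0 \<longrightarrow> y \<bullet> l \<noteq> 0 \<longrightarrow> x = y)"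
  using assms
proof (induction "\<Sum>b\<in>B. nat \<lfloor>\<bar>b \<bullet> l\<bar>\<rfloor>" arbitrary: B rule: less_induct)
  case less
  show ?case
  proof (cases "\<forall>x\<in>B. \<forall>y\<in>B. x \<bullet> l \<noteq> 0 \<longrightarrow> y \<bullet> l \<noteq> 0 \<longrightarrow> x = y")
    case True then show ?thesis using less.prems by blast
  next
    case False
    then obtain b c where bc: "b \<in> B" "c \<in> B" "b \<noteq> c" "c \<bullet> l \<noteq> 0" "\<bar>c \<bullet> l\<bar> \<le> \<bar>b \<bullet> l\<bar>"
      by (metis linear)
    define S where "S = B - {b}"
    have B: "B = insert b S" "b \<notin> S" "c \<in> S" unfolding S_def using bc by auto
    have fin: "finite B" "finite S" using independent_imp_finite[OF less.prems(1)] S_def by auto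
    define m :: int where "m = (if (b \<bullet> l > 0) = (c \<bullet> l > 0) then -1 else 1)"
    define c' where "c' = of_int m *\<^sub>R c"
    have c': "c' \<in> zspan S" unfolding c'_def using fin B by (intro zspan_scale zspan_base)
    have small: "\<bar>(b + c') \<bullet> l\<bar> < \<bar>b \<bullet> l\<bar>"
      using bc(4,5) unfolding c'_def m_def by (auto simp: inner_add_left)
    have c'int: "c' \<bullet> l \<in> \<int>" unfolding c'_def using less.prems(2) bc(2) by (simp add: Ints_mult)
    note shear = zspan_shear[OF less.prems(1)[unfolded B(1)] B(2) c']
    have bint: "b \<bullet> l \<in> \<int>" using less.prems(2) bc(1) by blast
    have int': "(b + c') \<bullet> l \<in> \<int>" using bint c'int by (simp add: inner_add_left)
    obtain i j :: int where ij: "b \<bullet> l = of_int i" "(b + c') \<bullet> l = of_int j"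
      using bint int' by (auto elim!: Ints_cases)
    have "nat \<lfloor>\<bar>(b + c') \<bullet> l\<bar>\<rfloor> < nat \<lfloor>\<bar>b \<bullet> l\<bar>\<rfloor>"
      using small unfolding ij by (simp flip: of_int_abs)
    then have "(\<Sum>b\<in>insert (b + c') S. nat \<lfloor>\<bar>b \<bullet> l\<bar>\<rfloor>) < (\<Sum>b\<in>B. nat \<lfloor>\<bar>b \<bullet> l\<bar>\<rfloor>)"
      unfolding B(1) using fin B(2) shear by simp
    then have "\<exists>B'. independent B' \<and> zspan B' = zspan (insert (b + c') S) \<and> parallelotope_vol B' = parallelotope_vol (insert (b + c') S) \<and>
      (\<forall>x\<in>B'. \<forall>y\<in>B'. x \<bullet> l \<noteq> 0 \<longrightarrow> y \<bullet> l \<noteq> 0 \<longrightarrow> x = y)"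
      using shear int' less.prems(2) B(1) by (intro less.hyps) auto
    then show ?thesis using shear unfolding B(1) by metis
  qed
qed

lemma euclid_basis_split:
  fixes B :: "'a::euclidean_space set"
  assumes "independent B" "\<forall>b\<in>B. b \<bullet> l \<in> \<int>" "x \<in> span B" "x \<bullet> l \<noteq> 0"
  obtains T c where "c \<notin> T" "independent (insert c T)" "zspan (insert c T) = zspan B"
    "parallelotope_vol (insert c T) = parallelotope_vol B" "\<And>x. x \<in> T \<Longrightarrow> x \<bullet> l = 0" "c \<bullet> l \<noteq> 0"
proof -
  obtain B' where B': "independent B'" "zspan B' = zspan B" "parallelotope_vol B' = parallelotope_vol B"
    "\<forall>x\<in>B'. \<forall>y\<in>B'. x \<bullet> l \<noteq> 0 \<longrightarrow> y \<bullet> l \<noteq> 0 \<longrightarrow> x = y"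
    using euclid_basis[OF assms(1,2)] by blast
  have "span B' = span B"
    using B'(1,2) assms(1) span_zspan independent_imp_finite by metis
  then have "\<exists>c\<in>B'. c \<bullet> l \<noteq> 0" using inner_span_zero[of x B' l] assms(3,4) by blast
  then obtain c where c: "c \<in> B'" "c \<bullet> l \<noteq> 0" by blast
  show thesis
    by (rule that[of c "B' - {c}"]) (use B' c in \<open>auto simp: insert_absorb\<close>)
qed

text \<open>
  Take \<open>l\<close> dual to a vector \<open>b\<close> of the first basis and run the Euclidean algorithm on the
  second. Both bases then consist of a basis of the sublattice orthogonal to \<open>l\<close>, where induction
  applies, and one vector which pairs to \<open>1\<close> or \<open>-1\<close> with \<open>l\<close>.
\<close>

lemma parallelotope_vol_zspan_unique:
  fixes B1 B2 :: "'a::euclidean_space set"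
  assumes "independent B1" "independent B2" "zspan B1 = zspan B2"
  shows "parallelotope_vol B1 = parallelotope_vol B2"
proof -
  have "finite B1" using assms(1) by (rule independent_imp_finite)
  then show ?thesis using assms
  proof (induction B1 arbitrary: B2 rule: finite_induct)
    case empty
    have "B2 \<subseteq> {0}" using empty.prems zspan_base[OF independent_imp_finite[OF empty.prems(2)]] by auto
    then have "B2 = {}" using empty.prems(2) dependent_zero by blast
    then show ?case by simp
  next
    case (insert b T)
    have ind: "independent T" "b \<notin> span T" using insert by (auto simp: independent_insert)
    obtain y z where yz: "y \<in> span T" "\<And>w. w \<in> span T \<Longrightarrow> z \<bullet> w = 0" "b = y + z"
      using span_decomposition[of T b] by metis
    have z: "z \<noteq> 0" using ind(2) yz by auto
    define l where "l = (1 / (z \<bullet> z)) *\<^sub>R z"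
    have l0: "l \<noteq> 0" unfolding l_def using z by simp
    have "y \<bullet> z = 0" using yz(2)[OF yz(1)] by (simp add: inner_commute)
    then have bl: "b \<bullet> l = 1" using z by (simp add: l_def yz(3) inner_add_left)
    have Tl: "x \<bullet> l = 0" if "x \<in> T" for x
      using yz(2)[OF span_base[OF that]] by (simp add: l_def inner_commute)
    have integral: "\<exists>k::int. x \<bullet> l = of_int k \<and> x - of_int k *\<^sub>R b \<in> span T" if x: "x \<in> zspan B2" for x
    proof -
      obtain k s where "x = of_int k *\<^sub>R b + s" "s \<in> zspan T"
        using x unfolding insert.prems(3)[symmetric] zspan_insert[OF insert.hyps(1,2)] by blast
      moreover from this have "s \<in> span T" using zspan_subset_span by blast
      moreover from this have "s \<bullet> l = 0" by (rule inner_span_zero) (rule Tl)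
      ultimately show ?thesis using bl by (intro exI[of _ k]) (simp add: inner_add_left)
    qed
    have finB2: "finite B2" by (rule independent_imp_finite[OF insert.prems(2)])
    have bB2: "b \<in> zspan B2" unfolding insert.prems(3)[symmetric] using insert.hyps by (intro zspan_base) auto
    have B2int: "\<forall>x\<in>B2. x \<bullet> l \<in> \<int>"
      using integral zspan_base[OF finB2] by (metis Ints_of_int)
    obtain T2 c where T2: "c \<notin> T2" "independent (insert c T2)" "zspan (insert c T2) = zspan B2"
      "parallelotope_vol (insert c T2) = parallelotope_vol B2" "\<And>x. x \<in> T2 \<Longrightarrow> x \<bullet> l = 0" "c \<bullet> l \<noteq> 0"
      by (rule euclid_basis_split[OF insert.prems(2) B2int, of b])
        (use bB2 zspan_subset_span[of B2] bl in auto)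
    have finT2: "finite T2" "independent T2"
      using T2(1,2) independent_imp_finite[OF T2(2)] by (auto simp: independent_insert)
    have "zspan T2 = {x \<in> zspan B2. x \<bullet> l = 0}"
      using zspan_kernel[OF finT2(1) T2(1,5,6)] T2(3) by simp
    also have "\<dots> = zspan T"
      unfolding insert.prems(3)[symmetric] by (rule zspan_kernel) (use insert.hyps Tl bl in auto)
    finally have zT: "zspan T = zspan T2" by simp
    then have pv: "parallelotope_vol T = parallelotope_vol T2" by (intro insert.IH ind finT2)
    have spT: "span T2 = span T" using zT span_zspan[OF finT2(1)] span_zspan[OF insert.hyps(1)] by simp
    have c: "c \<in> zspan B2" unfolding T2(3)[symmetric] using finT2 by (intro zspan_base) auto
    obtain k where k: "c \<bullet> l = of_int k" "c - of_int k *\<^sub>R b \<in> span T" using integral[OF c] by blast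
    obtain k' s where k': "b = of_int k' *\<^sub>R c + s" "s \<in> zspan T2"
      using bB2 unfolding T2(3)[symmetric] zspan_insert[OF finT2(1) T2(1)] by blast
    have "s \<bullet> l = 0" using k'(2) zspan_subset_span inner_span_zero[OF _ T2(5)] by blast
    then have "of_int (k' * k) = (1::real)" using bl k(1) unfolding k'(1) by (simp add: inner_add_left)
    then have "k' * k = 1" by (simp only: of_int_eq_1_iff)
    then have "k = 1 \<or> k = -1" by (auto simp: zmult_eq_1_iff)
    then have "\<bar>c \<bullet> l\<bar> = 1" unfolding k(1) by auto
    moreover have lin: "b \<in> span (insert l T)"
    proof -
      have "b - (z \<bullet> z) *\<^sub>R l \<in> span T" using yz z by (simp add: l_def)
      then show ?thesis unfolding span_breakdown_eq by blast
    qed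
    moreover have "c \<in> span (insert l T)"
    proof -
      have "c - of_int k *\<^sub>R b + of_int k *\<^sub>R b \<in> span (insert l T)"
        using k(2) lin span_mono[of T "insert l T"] by (intro span_add span_scale) auto
      then show ?thesis by simp
    qed
    ultimately have "infdist c (span T2) = infdist b (span T)"
      unfolding spT using infdist_along_normal[OF l0 Tl, of T] bl by simp
    then have "parallelotope_vol (insert b T) = parallelotope_vol (insert c T2)"
      using insert.hyps finT2 T2(1) pv by (simp add: parallelotope_vol_insert)
    then show ?case using T2(4) by simp
  qed
qed

definition covol :: "'a::euclidean_space set \<Rightarrow> real" where
  "covol \<Lambda> = parallelotope_vol (SOME B. independent B \<and> \<Lambda> = zspan B)"

lemma is_lattice_iff_zspan: "is_lattice \<Lambda> \<longleftrightarrow> (\<exists>B. independent B \<and> \<Lambda> = zspan B)"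
  by (simp add: is_lattice_def zspan_def)

lemma covol_zspan:
  assumes "independent B"
  shows "covol (zspan B) = parallelotope_vol B"
proof -
  have "independent (SOME B'. independent B' \<and> zspan B = zspan B') \<and> zspan B = zspan (SOME B'. independent B' \<and> zspan B = zspan B')"
    by (rule someI[of _ B]) (use assms in simp)
  then show ?thesis unfolding covol_def using parallelotope_vol_zspan_unique assms by metis
qed

lemma covol_pos: "is_lattice \<Lambda> \<Longrightarrow> 0 < covol \<Lambda>"
  unfolding is_lattice_iff_zspan by (auto simp: covol_zspan parallelotope_vol_pos)

text \<open>
  The Euclidean algorithm gives a lattice basis with a single vector that does not pair to
  \<open>0\<close> with \<open>l\<close>. By primitivity it pairs to \<open>1\<close> or \<open>-1\<close>, so that its height over the
  other vectors, which is the ratio of the covolumes, is the inverse of the length of \<open>l\<close>.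
\<close>

lemma lattice_kernel:
  fixes \<Lambda> :: "'a::euclidean_space set"
  assumes "is_lattice \<Lambda>" "l \<in> span \<Lambda>" "l \<noteq> 0" "\<forall>x\<in>\<Lambda>. x \<bullet> l \<in> \<int>"
    and prim: "\<And>k::nat. \<And>m. m \<in> span \<Lambda> \<Longrightarrow> \<forall>x\<in>\<Lambda>. x \<bullet> m \<in> \<int> \<Longrightarrow> l = of_nat k *\<^sub>R m \<Longrightarrow> k = 1"
  shows "is_lattice {x\<in>\<Lambda>. x \<bullet> l = 0} \<and> covol \<Lambda> * norm l = covol {x\<in>\<Lambda>. x \<bullet> l = 0} \<and>
    span {x\<in>\<Lambda>. x \<bullet> l = 0} = {x\<in>span \<Lambda>. x \<bullet> l = 0}"
proof -
  obtain B where B: "independent B" "\<Lambda> = zspan B" using assms(1) unfolding is_lattice_iff_zspan by blast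
  have finB: "finite B" by (rule independent_imp_finite[OF B(1)])
  have spB: "span \<Lambda> = span B" unfolding B(2) by (rule span_zspan[OF finB])
  have Bint: "\<forall>b\<in>B. b \<bullet> l \<in> \<int>" using assms(4) zspan_base[OF finB] B(2) by blast
  obtain T c where T: "c \<notin> T" "independent (insert c T)" "zspan (insert c T) = zspan B"
      "parallelotope_vol (insert c T) = parallelotope_vol B" "\<And>x. x \<in> T \<Longrightarrow> x \<bullet> l = 0" "c \<bullet> l \<noteq> 0"
    by (rule euclid_basis_split[OF B(1) Bint, of l]) (use assms(2,3) spB in auto)
  have finT: "finite T" "independent T"
    using T(1,2) independent_imp_finite[OF T(2)] by (auto simp: independent_insert)
  have ker: "{x\<in>\<Lambda>. x \<bullet> l = 0} = zspan T"
    unfolding B(2) T(3)[symmetric] by (rule zspan_kernel[OF finT(1) T(1,5,6)])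
  have \<Lambda>: "\<Lambda> = zspan (insert c T)" using B(2) T(3) by simp
  have sp\<Lambda>: "span \<Lambda> = span (insert c T)" unfolding \<Lambda> by (intro span_zspan) (simp add: finT)
  have c\<Lambda>: "c \<in> \<Lambda>" unfolding \<Lambda> by (intro zspan_base) (auto simp: finT)
  have T0: "x \<bullet> l = 0" if "x \<in> span T" for x using that inner_span_zero[OF _ T(5)] by blast
  obtain i where i: "c \<bullet> l = of_int i" using assms(4) c\<Lambda> by (auto elim: Ints_cases)
  define k where "k = nat \<bar>i\<bar>"
  have i0: "i \<noteq> 0" using T(6) i by auto
  have k: "real k = \<bar>of_int i\<bar>" unfolding k_def by simp
  have "k = 1"
  proof (rule prim)
    show "(1 / real k) *\<^sub>R l \<in> span \<Lambda>" using assms(2) by (rule span_scale)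
    show "l = of_nat k *\<^sub>R (1 / real k) *\<^sub>R l" using i0 k by simp
    show "\<forall>x\<in>\<Lambda>. x \<bullet> (1 / real k) *\<^sub>R l \<in> \<int>"
    proof
      fix x assume "x \<in> \<Lambda>"
      then obtain j s where x: "x = of_int j *\<^sub>R c + s" "s \<in> zspan T"
        unfolding \<Lambda> zspan_insert[OF finT(1) T(1)] by blast
      have "s \<bullet> l = 0" using x(2) zspan_subset_span T0 by blast
      then have "x \<bullet> (1 / real k) *\<^sub>R l = of_int (j * sgn i)"
        unfolding x(1) k using i i0 by (simp add: inner_add_left sgn_if abs_if)
      then show "x \<bullet> (1 / real k) *\<^sub>R l \<in> \<int>" by simp
    qed
  qed
  then have c1: "\<bar>c \<bullet> l\<bar> = 1" using k i by simp
  have "l \<in> span (insert c T)" using assms(2) sp\<Lambda> by simp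
  moreover have "l \<notin> span T" using T0[of l] assms(3) by auto
  ultimately have "c \<in> span (insert l T)" by (rule in_span_insert)
  then have "infdist c (span T) = 1 / norm l"
    using infdist_along_normal[OF assms(3) T(5)] c1 by simp
  then have "parallelotope_vol (insert c T) * norm l = parallelotope_vol T"
    using finT T(1) assms(3) by (simp add: parallelotope_vol_insert)
  then have "covol \<Lambda> * norm l = covol {x\<in>\<Lambda>. x \<bullet> l = 0}"
    unfolding ker unfolding \<Lambda> covol_zspan[OF T(2)] covol_zspan[OF finT(2)] .
  moreover have "span {x\<in>\<Lambda>. x \<bullet> l = 0} = {x\<in>span \<Lambda>. x \<bullet> l = 0}"
  proof -
    have "x \<in> span T" if "x \<in> span (insert c T)" "x \<bullet> l = 0" for x
    proof -
      have "\<exists>a. x - a *\<^sub>R c \<in> span T" using that(1) unfolding span_breakdown_eq .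
      then obtain a where a: "x - a *\<^sub>R c \<in> span T" ..
      then have "a * (c \<bullet> l) = 0" using T0[OF a] that(2) by (simp add: inner_diff_left)
      then show ?thesis using a T(6) by simp
    qed
    moreover have "span T \<subseteq> span (insert c T)" by (intro span_mono) auto
    ultimately show ?thesis unfolding ker sp\<Lambda> span_zspan[OF finT(1)] using T0 by blast
  qed
  moreover have "is_lattice {x\<in>\<Lambda>. x \<bullet> l = 0}" unfolding ker is_lattice_iff_zspan using finT(2) by blast
  ultimately show ?thesis by blast
qed

section \<open>Weighted counts of simplicial cones around a point\<close>

text \<open>
  With \<open>K\<close> a basis of a subspace, these are the bases of the quotient of \<open>V\<close> by that
  subspace that consist of weights, without forming the quotient.
\<close>

definition bases :: "('i \<Rightarrow> 'a::euclidean_space) \<Rightarrow> 'i set \<Rightarrow> 'a set \<Rightarrow> 'a set \<Rightarrow> 'i set set" where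
  "bases q N K V = {I. I \<subseteq> N \<and> inj_on q I \<and> q ` I \<inter> K = {} \<and>
     independent (K \<union> q ` I) \<and> span (K \<union> q ` I) = V}"

text \<open>
  In the applications \<open>P I\<close> says that a point lies in the cone spanned by \<open>I\<close> modulo the
  span of \<open>K\<close>. When \<open>K\<close> is empty and \<open>V\<close> is the span of the characters, the summands are,
  up to the covolume, the absolute values of the determinants of the simplicial cones around the
  point.
\<close>

definition basis_count ::
  "('i \<Rightarrow> 'a::euclidean_space) \<Rightarrow> 'i set \<Rightarrow> 'a set \<Rightarrow> 'a set \<Rightarrow> ('i set \<Rightarrow> bool) \<Rightarrow> real" where
  "basis_count q N K V P = (\<Sum>I\<in>bases q N K V. parallelotope_vol (K \<union> q ` I) * of_bool (P I))"

definition coord :: "('i \<Rightarrow> 'a::euclidean_space) \<Rightarrow> 'a set \<Rightarrow> 'i set \<Rightarrow> 'a \<Rightarrow> 'i \<Rightarrow> real" where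
  "coord q K I x i = representation (K \<union> q ` I) x (q i)"

lemma finite_bases: "finite N \<Longrightarrow> finite (bases q N K V)"
  by (rule finite_subset[of _ "Pow N"]) (auto simp: bases_def)

lemma coord_decomp:
  assumes "finite N" "I \<in> bases q N K V" "x \<in> V"
  shows "x - (\<Sum>i\<in>I. coord q K I x i *\<^sub>R q i) \<in> span K"
proof -
  let ?B = "K \<union> q ` I"
  have B: "inj_on q I" "q ` I \<inter> K = {}" "independent ?B" "span ?B = V" "I \<subseteq> N"
    using assms(2) by (auto simp: bases_def)
  have fin: "finite ?B" by (rule independent_imp_finite[OF B(3)])
  have "(\<Sum>b\<in>?B. representation ?B x b *\<^sub>R b) = x"
    using sum_representation_eq[OF B(3) _ fin order_refl] B(4) assms(3) by blast
  moreover have "(\<Sum>b\<in>?B. representation ?B x b *\<^sub>R b) =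
      (\<Sum>b\<in>K. representation ?B x b *\<^sub>R b) + (\<Sum>b\<in>q ` I. representation ?B x b *\<^sub>R b)"
    using fin B(2) by (intro sum.union_disjoint) auto
  moreover have "(\<Sum>b\<in>q ` I. representation ?B x b *\<^sub>R b) = (\<Sum>i\<in>I. coord q K I x i *\<^sub>R q i)"
    by (simp add: sum.reindex[OF B(1)] coord_def)
  ultimately have "x - (\<Sum>i\<in>I. coord q K I x i *\<^sub>R q i) = (\<Sum>b\<in>K. representation ?B x b *\<^sub>R b)"
    by (simp add: algebra_simps)
  then show ?thesis by (simp add: span_sum span_scale span_base)
qed

lemma coord_unique:
  assumes "finite N" "I \<in> bases q N K V" "x - (\<Sum>i\<in>I. c i *\<^sub>R q i) \<in> span K" "j \<in> I"
  shows "coord q K I x j = c j"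
proof -
  let ?B = "K \<union> q ` I"
  have B: "inj_on q I" "q ` I \<inter> K = {}" "independent ?B" "I \<subseteq> N"
    using assms(2) by (auto simp: bases_def)
  have finI: "finite I" using B(4) assms(1) finite_subset by blast
  define s where "s = x - (\<Sum>i\<in>I. c i *\<^sub>R q i)"
  have x: "x = s + (\<Sum>i\<in>I. c i *\<^sub>R q i)" by (simp add: s_def)
  have sK: "s \<in> span K" "s \<in> span ?B" using assms(3) span_mono[of K ?B] by (auto simp: s_def)
  have qB: "q i \<in> ?B" "q i \<in> span ?B" if "i \<in> I" for i using that by (auto intro: span_base)
  have "representation ?B s = representation K s"
    by (rule representation_extend[OF B(3) sK(1)]) auto
  moreover have "representation K s (q j) = 0"
    using representation_ne_zero[of K s "q j"] B(2) assms(4) by blast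
  moreover have "representation ?B (\<Sum>i\<in>I. c i *\<^sub>R q i) (q j) = (\<Sum>i\<in>I. c i * (if q j = q i then 1 else 0))"
    using qB B(3) by (simp add: representation_sum representation_scale representation_basis span_scale)
  moreover have "(\<Sum>i\<in>I. c i * (if q j = q i then 1 else 0)) = (\<Sum>i\<in>I. if i = j then c i else 0)"
    using B(1) assms(4) by (intro sum.cong) (auto simp: inj_on_eq_iff)
  moreover have "(\<Sum>i\<in>I. c i *\<^sub>R q i) \<in> span ?B" using qB by (intro span_sum span_scale)
  ultimately show ?thesis
    using finI assms(4) sK(2) unfolding coord_def x by (simp add: representation_add[OF B(3)])
qed

lemma coord_affine:
  assumes "finite N" "I \<in> bases q N K V" "x \<in> V" "y \<in> V" "i \<in> I"
  shows "coord q K I (x + t *\<^sub>R y) i = coord q K I x i + t * coord q K I y i"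
proof (rule coord_unique[OF assms(1,2) _ assms(5)])
  have "x + t *\<^sub>R y - (\<Sum>i\<in>I. (coord q K I x i + t * coord q K I y i) *\<^sub>R q i) =
     (x - (\<Sum>i\<in>I. coord q K I x i *\<^sub>R q i)) + t *\<^sub>R (y - (\<Sum>i\<in>I. coord q K I y i *\<^sub>R q i))"
    by (simp add: scaleR_add_left scaleR_diff_right scaleR_sum_right sum.distrib)
  also have "\<dots> \<in> span K" by (intro span_add span_scale coord_decomp[OF assms(1,2,3)] coord_decomp[OF assms(1,2,4)])
  finally show "x + t *\<^sub>R y - (\<Sum>i\<in>I. (coord q K I x i + t * coord q K I y i) *\<^sub>R q i) \<in> span K" .
qed

text \<open>
  The set \<open>M\<close> stands for the weights in a relevant subspace with basis \<open>K\<close>. Since their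
  cone is the whole subspace, membership only depends on the coordinates modulo \<open>K\<close>.
\<close>

lemma mem_fcone_iff_coord:
  assumes "finite N" "I \<in> bases q N K V" "fcone q M = span K" "x \<in> V"
  shows "x \<in> fcone q (I \<union> M) \<longleftrightarrow> (\<forall>i\<in>I. 0 \<le> coord q K I x i)"
proof
  have finI: "finite I" using assms(1,2) by (auto simp: bases_def intro: finite_subset)
  have Un: "fcone q (I \<union> M) = (\<Union>x\<in>fcone q I. \<Union>y\<in>fcone q M. {x + y})"
    by (simp only: image_Un convex_cone_hull_Un)
  show "\<forall>i\<in>I. 0 \<le> coord q K I x i" if mem: "x \<in> fcone q (I \<union> M)"
  proof -
    obtain y z where yz: "x = y + z" "y \<in> fcone q I" "z \<in> span K" using mem unfolding Un assms(3) by blast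
    obtain a where a: "\<forall>i\<in>I. 0 \<le> a i" "y = (\<Sum>i\<in>I. a i *\<^sub>R q i)" by (rule fconeE[OF finI yz(2)])
    have "x - (\<Sum>i\<in>I. a i *\<^sub>R q i) \<in> span K" using yz a by simp
    then show ?thesis using coord_unique[OF assms(1,2)] a(1) by metis
  qed
  show "x \<in> fcone q (I \<union> M)" if nonneg: "\<forall>i\<in>I. 0 \<le> coord q K I x i"
  proof -
    have "x = (\<Sum>i\<in>I. coord q K I x i *\<^sub>R q i) + (x - (\<Sum>i\<in>I. coord q K I x i *\<^sub>R q i))" by simp
    then show ?thesis unfolding Un assms(3) using fconeI[OF finI nonneg] coord_decomp[OF assms(1,2,4)] by blast
  qed
qed

lemma coord_zero_imp_mem_span:
  assumes "finite N" "I \<in> bases q N K V" "x \<in> V" "i \<in> I" "coord q K I x i = 0"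
  shows "x \<in> span (K \<union> q ` (I - {i}))"
proof -
  have finI: "finite I" using assms(1,2) by (auto simp: bases_def intro: finite_subset)
  let ?S = "span (K \<union> q ` (I - {i}))"
  have "(\<Sum>i\<in>I. coord q K I x i *\<^sub>R q i) = (\<Sum>j\<in>I - {i}. coord q K I x j *\<^sub>R q j)"
    using finI assms(4,5) by (simp add: sum.remove)
  also have "\<dots> \<in> ?S" by (intro span_sum span_scale span_base) auto
  finally have "(\<Sum>i\<in>I. coord q K I x i *\<^sub>R q i) \<in> ?S" .
  moreover have "x - (\<Sum>i\<in>I. coord q K I x i *\<^sub>R q i) \<in> ?S"
    using coord_decomp[OF assms(1-3)] span_mono[of K "K \<union> q ` (I - {i})"] by blast
  ultimately show ?thesis by (metis diff_add_cancel span_add)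
qed

lemma eventually_nonneg_perturb:
  fixes a b :: real
  shows "\<forall>\<^sub>F t in at_right 0. 0 \<le> a + t * b \<longleftrightarrow> 0 < a \<or> a = 0 \<and> 0 \<le> b"
proof -
  consider "0 < a" | "a < 0" | "a = 0" by linarith
  then show ?thesis
  proof cases
    case 1 then show ?thesis using eventually_perturb_pos[OF 1, of b] by (auto elim!: eventually_mono)
  next
    case 2
    then have "\<forall>\<^sub>F t in at_right 0. 0 < - a + t * (- b)" by (intro eventually_perturb_pos) simp
    then show ?thesis using 2 by (auto elim!: eventually_mono)
  next
    case 3
    show ?thesis using eventually_at_right_less[of "0::real"]
      by eventually_elim (use 3 in \<open>auto simp: zero_le_mult_iff\<close>)
  qed
qed

text \<open>
  Moving a little from \<open>w\<close> in the direction \<open>u\<close>, a cone is decided by the coordinates of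
  \<open>w\<close>, and by those of \<open>u\<close> where a coordinate of \<open>w\<close> vanishes.
\<close>

lemma eventually_mem_fcone:
  assumes "finite N" "I \<in> bases q N K V" "fcone q M = span K" "w \<in> V" "u \<in> V" "subspace V"
  shows "\<forall>\<^sub>F t in at_right 0. w + t *\<^sub>R u \<in> fcone q (I \<union> M) \<longleftrightarrow>
    (\<forall>i\<in>I. 0 < coord q K I w i \<or> coord q K I w i = 0 \<and> 0 \<le> coord q K I u i)"
proof -
  have finI: "finite I" using assms(1,2) by (auto simp: bases_def intro: finite_subset)
  have "\<forall>\<^sub>F t in at_right 0. \<forall>i\<in>I. 0 \<le> coord q K I w i + t * coord q K I u i \<longleftrightarrow>
      0 < coord q K I w i \<or> coord q K I w i = 0 \<and> 0 \<le> coord q K I u i"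
    by (intro eventually_ball_finite finI ballI eventually_nonneg_perturb)
  then show ?thesis
  proof (rule eventually_mono)
    fix t assume h: "\<forall>i\<in>I. 0 \<le> coord q K I w i + t * coord q K I u i \<longleftrightarrow>
      0 < coord q K I w i \<or> coord q K I w i = 0 \<and> 0 \<le> coord q K I u i"
    have "w + t *\<^sub>R u \<in> V" using assms(4-6) by (simp add: subspace_add subspace_scale)
    then show "w + t *\<^sub>R u \<in> fcone q (I \<union> M) \<longleftrightarrow>
      (\<forall>i\<in>I. 0 < coord q K I w i \<or> coord q K I w i = 0 \<and> 0 \<le> coord q K I u i)"
      using mem_fcone_iff_coord[OF assms(1-3)] coord_affine[OF assms(1,2,4,5)] h by simp
  qed
qed

lemma basis_count_eventually:
  assumes "finite N" "fcone q M = span K" "w \<in> V" "u \<in> V" "subspace V"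
  shows "\<forall>\<^sub>F t in at_right 0. basis_count q N K V (\<lambda>I. w + t *\<^sub>R u \<in> fcone q (I \<union> M)) =
    basis_count q N K V (\<lambda>I. \<forall>i\<in>I. 0 < coord q K I w i \<or> coord q K I w i = 0 \<and> 0 \<le> coord q K I u i)"
proof -
  have "\<forall>\<^sub>F t in at_right 0. \<forall>I\<in>bases q N K V. w + t *\<^sub>R u \<in> fcone q (I \<union> M) \<longleftrightarrow>
    (\<forall>i\<in>I. 0 < coord q K I w i \<or> coord q K I w i = 0 \<and> 0 \<le> coord q K I u i)"
    using assms by (intro eventually_ball_finite finite_bases ballI eventually_mem_fcone)
  then show ?thesis
    by (rule eventually_mono) (unfold basis_count_def, intro sum.cong refl, simp)
qed

text \<open>
  The two ways in which a point may be in general position with respect to the hyperplanes spanned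
  by weights.
\<close>

definition on_no_hyperplane :: "('i \<Rightarrow> 'a::euclidean_space) \<Rightarrow> 'i set \<Rightarrow> 'a set \<Rightarrow> 'a \<Rightarrow> bool" where
  "on_no_hyperplane q N V w \<longleftrightarrow> (\<forall>J\<subseteq>N. dim (q ` J) + 1 = dim V \<longrightarrow> w \<notin> span (q ` J))"

definition only_on_hyperplane ::
  "('i \<Rightarrow> 'a::euclidean_space) \<Rightarrow> 'i set \<Rightarrow> 'a set \<Rightarrow> 'a set \<Rightarrow> 'a \<Rightarrow> bool" where
  "only_on_hyperplane q N V E w \<longleftrightarrow> w \<in> E \<and>
     (\<forall>J\<subseteq>N. dim (q ` J) + 1 = dim V \<longrightarrow> w \<in> span (q ` J) \<longrightarrow> span (q ` J) = E)"

text \<open>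
  A facet of a simplicial cone, modulo the span of \<open>K\<close>, spans a hyperplane which is spanned by
  weights, since the weights in \<open>M\<close> span the same subspace as \<open>K\<close>.
\<close>

lemma span_basis_remove:
  assumes "finite N" "I \<in> bases q N K V" "M \<subseteq> N" "fcone q M = span K" "i \<in> I"
  shows "span (K \<union> q ` (I - {i})) = span (q ` (M \<union> (I - {i})))"
    "dim (q ` (M \<union> (I - {i}))) + 1 = dim V" "M \<union> (I - {i}) \<subseteq> N"
    "q i \<notin> span (K \<union> q ` (I - {i}))"
proof -
  have B: "inj_on q I" "q ` I \<inter> K = {}" "independent (K \<union> q ` I)" "span (K \<union> q ` I) = V" "I \<subseteq> N"
    using assms(2) by (auto simp: bases_def)
  show "M \<union> (I - {i}) \<subseteq> N" using assms(3) B(5) by blast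
  have "span K \<subseteq> span (q ` M)" using fcone_subset_span[of q M] assms(4) by simp
  moreover have "span (q ` M) \<subseteq> span K"
    using hull_subset[of "q ` M" convex_cone] assms(4) by (metis span_minimal subspace_span)
  ultimately have KM: "span K = span (q ` M)" by blast
  show sp: "span (K \<union> q ` (I - {i})) = span (q ` (M \<union> (I - {i})))"
    unfolding image_Un span_Un KM ..
  have ins: "insert (q i) (K \<union> q ` (I - {i})) = K \<union> q ` I" using assms(5) by blast
  have notin: "q i \<notin> K \<union> q ` (I - {i})" using B(1,2) assms(5) by (auto simp: inj_on_def)
  show out: "q i \<notin> span (K \<union> q ` (I - {i}))"
    using B(3) notin unfolding ins[symmetric] independent_insert by simp
  have "dim V = dim (insert (q i) (K \<union> q ` (I - {i})))" unfolding ins B(4)[symmetric] by simp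
  also have "\<dots> = dim (K \<union> q ` (I - {i})) + 1" using out by (simp add: dim_insert)
  finally show "dim (q ` (M \<union> (I - {i}))) + 1 = dim V" using sp by (metis dim_span)
qed

lemma coord_nonzero:
  assumes "finite N" "I \<in> bases q N K V" "M \<subseteq> N" "fcone q M = span K" "w \<in> V"
    "on_no_hyperplane q N V w" "i \<in> I"
  shows "coord q K I w i \<noteq> 0"
  using coord_zero_imp_mem_span[OF assms(1,2,5,7)] span_basis_remove[OF assms(1-4,7)] assms(6)
  unfolding on_no_hyperplane_def by metis

lemma basis_count_generic:
  assumes "finite N" "M \<subseteq> N" "fcone q M = span K" "w \<in> V" "u \<in> V" "subspace V" "on_no_hyperplane q N V w"
  shows "\<forall>\<^sub>F t in at_right 0. basis_count q N K V (\<lambda>I. w + t *\<^sub>R u \<in> fcone q (I \<union> M)) =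
    basis_count q N K V (\<lambda>I. w \<in> fcone q (I \<union> M))"
proof -
  have "(\<forall>i\<in>I. 0 < coord q K I w i \<or> coord q K I w i = 0 \<and> 0 \<le> coord q K I u i) \<longleftrightarrow> w \<in> fcone q (I \<union> M)"
    if I: "I \<in> bases q N K V" for I
    using coord_nonzero[OF assms(1) I assms(2-4,7)] mem_fcone_iff_coord[OF assms(1) I assms(3,4)]
    by (auto simp: less_le)
  then have "basis_count q N K V (\<lambda>I. \<forall>i\<in>I. 0 < coord q K I w i \<or> coord q K I w i = 0 \<and> 0 \<le> coord q K I u i) =
     basis_count q N K V (\<lambda>I. w \<in> fcone q (I \<union> M))"
    unfolding basis_count_def by (intro sum.cong refl) simp
  then show ?thesis using basis_count_eventually[OF assms(1,3-6)] by simp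
qed

text \<open>
  A basis whose cone has no facet in the hyperplane through \<open>w\<close> contributes equally on both
  sides. The others arise from a basis \<open>J\<close> of the hyperplane and a weight \<open>q i\<close> off it, and
  count only on the side of \<open>q i\<close>. Their volume is the volume of \<open>J\<close> times the height of
  \<open>q i\<close>, so that with the sign of the side the contribution is linear in \<open>q i\<close>, and the
  weights can be summed up.
\<close>

theorem basis_count_jump:
  fixes q :: "'i \<Rightarrow> 'a::euclidean_space"
  assumes N: "finite N" and M: "M \<subseteq> N" "fcone q M = span K" and V: "subspace V"
    and l: "l \<in> V" "l \<noteq> 0" and E: "E = {x\<in>V. x \<bullet> l = 0}" and qV: "q ` N \<subseteq> V"
    and w: "w \<in> V" "only_on_hyperplane q N V E w"
    and u: "u \<in> V" "0 < u \<bullet> l" and u': "u' \<in> V" "u' \<bullet> l < 0"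
  shows "\<forall>\<^sub>F t in at_right 0.
    basis_count q N K V (\<lambda>I. w + t *\<^sub>R u \<in> fcone q (I \<union> M)) -
    basis_count q N K V (\<lambda>I. w + t *\<^sub>R u' \<in> fcone q (I \<union> M)) =
    ((\<Sum>i\<in>N. q i) \<bullet> l / norm l) *
      basis_count q {i\<in>N. q i \<in> E} K E (\<lambda>J. w \<in> fcone q (J \<union> M))"
proof -
  let ?NE = "{i\<in>N. q i \<in> E}"
  let ?Out = "{i\<in>N. q i \<notin> E}"
  let ?P = "\<lambda>u I. \<forall>i\<in>I. 0 < coord q K I w i \<or> coord q K I w i = 0 \<and> 0 \<le> coord q K I u i"
  define \<phi> where "\<phi> = (\<lambda>(J, i :: 'i). insert i J)"
  define S where "S = bases q ?NE K E \<times> ?Out"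
  define g where "g I = parallelotope_vol (K \<union> q ` I) * (of_bool (?P u I) - of_bool (?P u' I))" for I
  have subE: "subspace E" unfolding E using V
    by (auto simp: subspace_def inner_add_left)
  have Vinsert: "V \<subseteq> span (insert x E)" if "x \<in> V" "x \<notin> E" for x
  proof
    fix y assume y: "y \<in> V"
    have x: "x \<bullet> l \<noteq> 0" using that E by blast
    have "y - ((y \<bullet> l) / (x \<bullet> l)) *\<^sub>R x \<in> E"
      unfolding E using y that(1) V x by (simp add: subspace_diff subspace_scale inner_diff_left)
    then show "y \<in> span (insert x E)" unfolding span_breakdown_eq using span_base by blast
  qed
  have qi: "q i \<bullet> l \<noteq> 0" "q i \<in> V" if "i \<in> ?Out" for i using that qV E by auto
  have E0: "x \<bullet> l = 0" if "x \<in> E" for x using that E by blast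
  \<comment> \<open>bases of the hyperplane extend by any weight off it\<close>
  have ext: "insert i J \<in> bases q N K V" "i \<notin> J" "parallelotope_vol (K \<union> q ` insert i J) = parallelotope_vol (K \<union> q ` J) * (\<bar>q i \<bullet> l\<bar> / norm l)"
    if J: "J \<in> bases q ?NE K E" and i: "i \<in> ?Out" for J i
  proof -
    have B: "inj_on q J" "q ` J \<inter> K = {}" "independent (K \<union> q ` J)" "span (K \<union> q ` J) = E" "J \<subseteq> ?NE"
      using J by (auto simp: bases_def)
    show iJ: "i \<notin> J" using B(5) i by blast
    have out: "q i \<notin> span (K \<union> q ` J)" using B(4) i by simp
    then have notin: "q i \<notin> K \<union> q ` J" using span_base by metis
    have eq: "K \<union> q ` insert i J = insert (q i) (K \<union> q ` J)" by simp
    have "span (K \<union> q ` insert i J) = V"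
    proof
      have "K \<union> q ` J \<subseteq> V" using B(4) span_superset[of "K \<union> q ` J"] E by blast
      then show "span (K \<union> q ` insert i J) \<subseteq> V" unfolding eq using qi(2)[OF i] V by (intro span_minimal) auto
      have "span (insert (q i) E) \<subseteq> span (K \<union> q ` insert i J)"
        unfolding eq B(4)[symmetric] span_insert_span ..
      then show "V \<subseteq> span (K \<union> q ` insert i J)" using Vinsert[OF qi(2)[OF i]] i by blast
    qed
    then show "insert i J \<in> bases q N K V"
      using B out notin i iJ by (auto simp: bases_def independent_insert)
    have "infdist (q i) (span (K \<union> q ` J)) = \<bar>q i \<bullet> l\<bar> / norm l"
    proof (rule infdist_along_normal[OF l(2)])
      show "y \<bullet> l = 0" if "y \<in> K \<union> q ` J" for y using span_base[OF that] B(4) E by blast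
      have "l \<notin> E" using E l by auto
      then have "q i \<in> span (insert l E)" using Vinsert[OF l(1)] qi(2)[OF i] by blast
      then show "q i \<in> span (insert l (K \<union> q ` J))" unfolding B(4)[symmetric] span_insert_span .
    qed
    then show "parallelotope_vol (K \<union> q ` insert i J) = parallelotope_vol (K \<union> q ` J) * (\<bar>q i \<bullet> l\<bar> / norm l)"
      unfolding eq using notin independent_imp_finite[OF B(3)] by (subst parallelotope_vol_insert) auto
  qed
  \<comment> \<open>a vanishing coordinate of \<open>w\<close> exhibits such an extension\<close>
  have vanish: "I - {i} \<in> bases q ?NE K E" "i \<in> ?Out" if I: "I \<in> bases q N K V" and i: "i \<in> I" "coord q K I w i = 0" for I i
  proof -
    have B: "inj_on q I" "q ` I \<inter> K = {}" "independent (K \<union> q ` I)" "span (K \<union> q ` I) = V" "I \<subseteq> N"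
      using I by (auto simp: bases_def)
    note rem = span_basis_remove[OF N I M i(1)]
    have "w \<in> span (q ` (M \<union> (I - {i})))"
      using coord_zero_imp_mem_span[OF N I w(1) i] rem(1) by simp
    then have "span (q ` (M \<union> (I - {i}))) = E"
      using w(2) rem(2,3) unfolding only_on_hyperplane_def by blast
    then have sp: "span (K \<union> q ` (I - {i})) = E" using rem(1) by simp
    show "i \<in> ?Out" using rem(4) sp i(1) B(5) by auto
    have "q ` (I - {i}) \<subseteq> E" using sp span_superset[of "K \<union> q ` (I - {i})"] by blast
    moreover have "independent (K \<union> q ` (I - {i}))" by (rule independent_mono[OF B(3)]) auto
    ultimately show "I - {i} \<in> bases q ?NE K E" using B sp
      by (auto simp: bases_def intro: inj_on_subset)
  qed
  \<comment> \<open>The index \<open>i\<close> is recovered from \<open>insert i J\<close> as the only one whose weight is off the hyperplane.\<close>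
  have inj: "inj_on \<phi> S"
  proof (rule inj_onI)
    fix a b assume ab: "a \<in> S" "b \<in> S" "\<phi> a = \<phi> b"
    have dec: "fst a = {i\<in>\<phi> a. q i \<in> E} \<and> \<phi> a - fst a = {snd a}" if "a \<in> S" for a
      using that by (auto simp: S_def \<phi>_def bases_def)
    show "a = b" using dec[OF ab(1)] dec[OF ab(2)] ab(3) by (metis prod.expand singleton_inject)
  qed
  have finS: "finite S" unfolding S_def using N by (simp add: finite_bases)
  have img: "\<phi> ` S \<subseteq> bases q N K V" unfolding S_def \<phi>_def using ext(1) by auto
  have zero: "g I = 0" if "I \<in> bases q N K V - \<phi> ` S" for I
  proof -
    have I: "I \<in> bases q N K V" using that by blast
    have nz: "coord q K I w i \<noteq> 0" if i: "i \<in> I" for i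
    proof
      assume "coord q K I w i = 0"
      then have "(I - {i}, i) \<in> S" using vanish[OF I i] unfolding S_def by blast
      then have "\<phi> (I - {i}, i) \<in> \<phi> ` S" by (rule imageI)
      then show False using \<open>I \<in> _ - _\<close> i by (simp add: \<phi>_def insert_absorb)
    qed
    have "?P u I \<longleftrightarrow> ?P u' I" using nz by auto
    then show ?thesis unfolding g_def by simp
  qed
  have val: "g (insert i J) = parallelotope_vol (K \<union> q ` J) * of_bool (w \<in> fcone q (J \<union> M)) * ((q i \<bullet> l) / norm l)"
    if J: "J \<in> bases q ?NE K E" and i: "i \<in> ?Out" for J i
  proof -
    note I = ext[OF J i]
    have finNE: "finite ?NE" using N by simp
    have wE: "w \<in> E" using w(2) by (simp add: only_on_hyperplane_def)
    have finJ: "finite J" using J N by (auto simp: bases_def intro: finite_subset)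
    have spJ: "span (K \<union> q ` J) = E" using J by (simp add: bases_def)
    have KE: "x \<bullet> l = 0" if "x \<in> span K" for x
      using that span_mono[of K "K \<union> q ` J"] spJ E0 by blast
    have JE: "q j \<bullet> l = 0" if "j \<in> J" for j using that J E0 by (auto simp: bases_def)
    have "w - (\<Sum>j\<in>insert i J. (if j = i then 0 else coord q K J w j) *\<^sub>R q j) =
        w - (\<Sum>j\<in>J. coord q K J w j *\<^sub>R q j)"
    proof -
      have "(\<Sum>j\<in>J. (if j = i then 0 else coord q K J w j) *\<^sub>R q j) = (\<Sum>j\<in>J. coord q K J w j *\<^sub>R q j)"
        using I(2) by (intro sum.cong) auto
      then show ?thesis using finJ I(2) by simp
    qed
    then have mem: "w - (\<Sum>j\<in>insert i J. (if j = i then 0 else coord q K J w j) *\<^sub>R q j) \<in> span K"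
      using coord_decomp[OF finNE J wE] by simp
    have cw: "coord q K (insert i J) w j = (if j = i then 0 else coord q K J w j)" if "j \<in> insert i J" for j
      by (rule coord_unique[OF N I(1) mem that])
    have nz: "coord q K (insert i J) w j \<noteq> 0" if "j \<in> J" for j
    proof
      assume z: "coord q K (insert i J) w j = 0"
      have j: "j \<in> insert i J" "j \<noteq> i" using that I(2) by auto
      have "insert i J - {j} \<in> bases q ?NE K E" using vanish(1)[OF I(1) j(1) z] .
      then have "i \<in> ?NE" using j(2) unfolding bases_def by blast
      then show False using i by blast
    qed
    have cu: "v \<bullet> l = coord q K (insert i J) v i * (q i \<bullet> l)" if v: "v \<in> V" for v
    proof -
      have "(v - (\<Sum>j\<in>insert i J. coord q K (insert i J) v j *\<^sub>R q j)) \<bullet> l = 0"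
        by (rule KE[OF coord_decomp[OF N I(1) v]])
      then show ?thesis using finJ I(2) JE by (simp add: inner_diff_left inner_add_left inner_sum_left)
    qed
    have P: "?P v (insert i J) \<longleftrightarrow> w \<in> fcone q (J \<union> M) \<and> 0 \<le> coord q K (insert i J) v i" for v
    proof -
      have "w \<in> fcone q (J \<union> M) \<longleftrightarrow> (\<forall>j\<in>J. 0 \<le> coord q K J w j)"
        by (rule mem_fcone_iff_coord[OF finNE J M(2) wE])
      also have "\<dots> \<longleftrightarrow> (\<forall>j\<in>J. 0 < coord q K (insert i J) w j)"
      proof (intro ball_cong refl)
        fix j assume j: "j \<in> J"
        then have "coord q K (insert i J) w j = coord q K J w j" using cw[of j] I(2) by auto
        then show "0 \<le> coord q K J w j \<longleftrightarrow> 0 < coord q K (insert i J) w j" using nz[OF j] by linarith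
      qed
      finally show ?thesis using cw[of i] nz by auto
    qed
    have "0 \<le> coord q K (insert i J) u i \<longleftrightarrow> 0 < q i \<bullet> l"
      using cu[OF u(1)] u(2) by (auto simp: zero_less_mult_iff)
    moreover have "0 \<le> coord q K (insert i J) u' i \<longleftrightarrow> q i \<bullet> l < 0"
      using cu[OF u'(1)] u'(2) qi(1)[OF i] by (auto simp: mult_less_0_iff)
    ultimately show ?thesis unfolding g_def P I(3) using qi(1)[OF i] by auto
  qed
  have "basis_count q N K V (?P u) - basis_count q N K V (?P u') = (\<Sum>I\<in>bases q N K V. g I)"
    by (simp add: basis_count_def g_def right_diff_distrib sum_subtractf)
  also have "\<dots> = (\<Sum>I\<in>\<phi> ` S. g I)"
    using zero img by (intro sum.mono_neutral_right finite_bases N) auto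
  also have "\<dots> = (\<Sum>a\<in>S. g (\<phi> a))" by (simp add: sum.reindex[OF inj])
  also have "\<dots> = (\<Sum>J\<in>bases q ?NE K E. \<Sum>i\<in>?Out. g (insert i J))"
    unfolding S_def \<phi>_def by (simp add: sum.cartesian_product case_prod_unfold)
  also have "\<dots> = (\<Sum>J\<in>bases q ?NE K E. \<Sum>i\<in>?Out. parallelotope_vol (K \<union> q ` J) * of_bool (w \<in> fcone q (J \<union> M)) * ((q i \<bullet> l) / norm l))"
    by (intro sum.cong refl val)
  also have "\<dots> = (\<Sum>i\<in>?Out. (q i \<bullet> l) / norm l) * basis_count q ?NE K E (\<lambda>J. w \<in> fcone q (J \<union> M))"
    unfolding basis_count_def sum_product by (rule trans[OF sum.swap]) (simp add: mult_ac)
  also have "(\<Sum>i\<in>?Out. (q i \<bullet> l) / norm l) = (\<Sum>i\<in>N. (q i \<bullet> l) / norm l)"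
    by (rule sum.mono_neutral_left) (use N E0 in auto)
  also have "\<dots> = (\<Sum>i\<in>N. q i) \<bullet> l / norm l" by (simp add: inner_sum_left sum_divide_distrib)
  finally have eq: "basis_count q N K V (?P u) - basis_count q N K V (?P u') =
    ((\<Sum>i\<in>N. q i) \<bullet> l / norm l) * basis_count q ?NE K E (\<lambda>J. w \<in> fcone q (J \<union> M))" .
  show ?thesis
    using basis_count_eventually[OF N M(2) w(1) u(1) V] basis_count_eventually[OF N M(2) w(1) u'(1) V]
    by eventually_elim (simp only: eq)
qed

section \<open>Walls and the chambers next to them\<close>

lemma eventually_avoids_closed:
  fixes x v :: "'a::euclidean_space"
  assumes "closed A" "x \<notin> A"
  shows "\<forall>\<^sub>F t in at_right 0. x + t *\<^sub>R v \<notin> A"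
proof -
  have "((\<lambda>t. x + t *\<^sub>R v) \<longlongrightarrow> x + 0 *\<^sub>R v) (at_right 0)" by (intro tendsto_intros)
  then have "\<forall>\<^sub>F t in at_right 0. x + t *\<^sub>R v \<in> - A"
    by (rule topological_tendstoD) (use assms in auto)
  then show ?thesis by simp
qed

lemma eventually_at_right_0_less: "0 < s \<Longrightarrow> \<forall>\<^sub>F t in at_right (0::real). 0 < t \<and> t < s"
  using eventually_at_right[of 0 s] by (auto simp: eventually_at_right_field)

lemma eventually_at_right_0_ex:
  fixes s :: real
  assumes "\<forall>\<^sub>F t in at_right 0. P t" "0 < s"
  obtains t where "P t" "0 < t" "t < s"
proof -
  have "\<forall>\<^sub>F t in at_right 0. P t \<and> 0 < t \<and> t < s"
    using assms(1) eventually_at_right_0_less[OF assms(2)] by (rule eventually_conj)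
  then have "\<exists>t. P t \<and> 0 < t \<and> t < s"
    by (rule eventually_happens'[rotated]) (rule trivial_limit_at_right_real)
  then show thesis using that by blast
qed

text \<open>
  A point outside all subspaces but one is moved a little towards a point outside the last one.
\<close>

lemma convex_avoid_subspaces:
  fixes S :: "'a::euclidean_space set"
  assumes "finite \<A>" "convex S" "S \<noteq> {}" "\<And>A. A \<in> \<A> \<Longrightarrow> subspace A \<and> \<not> S \<subseteq> A"
  shows "\<exists>x\<in>S. \<forall>A\<in>\<A>. x \<notin> A"
  using assms(1,4)
proof (induction \<A> rule: finite_induct)
  case empty then show ?case using assms(3) by blast
next
  case (insert A \<A>)
  then obtain x where x: "x \<in> S" "\<forall>A\<in>\<A>. x \<notin> A" by auto
  show ?case
  proof (cases "x \<in> A")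
    case False then show ?thesis using x by auto
  next
    case True
    have A: "subspace A" using insert.prems by blast
    obtain y where y: "y \<in> S" "y \<notin> A" using insert.prems by blast
    have "\<forall>\<^sub>F t in at_right 0. \<forall>A\<in>\<A>. x + t *\<^sub>R (y - x) \<notin> A"
      using insert x by (intro eventually_ball_finite ballI eventually_avoids_closed closed_subspace) auto
    then obtain t where t: "\<forall>A\<in>\<A>. x + t *\<^sub>R (y - x) \<notin> A" "0 < t" "t < 1"
      by (rule eventually_at_right_0_ex[of _ 1]) simp
    have "(1 - t) *\<^sub>R x + t *\<^sub>R y \<in> S" using t x(1) y(1) assms(2) by (intro convexD) auto
    then have "x + t *\<^sub>R (y - x) \<in> S" by (simp add: algebra_simps)
    moreover have "x + t *\<^sub>R (y - x) \<notin> A"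
    proof
      assume "x + t *\<^sub>R (y - x) \<in> A"
      then have "t *\<^sub>R (y - x) \<in> A" using subspace_diff[OF A _ True] by fastforce
      then have "(1 / t) *\<^sub>R t *\<^sub>R (y - x) \<in> A" by (rule subspace_scale[OF A])
      then have "y - x \<in> A" using t by simp
      then have "y - x + x \<in> A" using subspace_add[OF A _ True] by blast
      then show False using y(2) by simp
    qed
    ultimately show ?thesis using t(1) by blast
  qed
qed

lemma rel_interior_subset_closed:
  fixes C :: "'a::euclidean_space set"
  assumes "convex C" "closed A" "rel_interior C \<subseteq> A"
  shows "C \<subseteq> A"
  using closure_minimal[OF assms(3,2)] convex_closure_rel_interior[OF assms(1)] closure_subset by blast

text \<open>
  Usable form of \<open>rel_interior_fan_cell_pattern\<close>: the cones containing an interior point of a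
  cell are those containing the cell.
\<close>

lemma mem_rel_interior_fan_cell_iff:
  fixes q :: "'i \<Rightarrow> 'a::euclidean_space"
  assumes "finite N" "\<theta>0 \<in> fcone q N" "\<theta> \<in> rel_interior (fan_cell q N \<theta>0)" "J \<subseteq> N"
  shows "\<theta> \<in> fcone q J \<longleftrightarrow> fan_cell q N \<theta>0 \<subseteq> fcone q J"
  using rel_interior_fan_cell_pattern[OF assms] fan_cell_subset[OF assms(4), of \<theta>0] assms(3) rel_interior_subset by blast

lemma fan_cell_eq_Inter:
  "fan_cell q N \<theta>0 = \<Inter>{fcone q J | J. J \<subseteq> N \<and> fan_cell q N \<theta>0 \<subseteq> fcone q J}"
proof (intro equalityI)
  show "\<Inter>{fcone q J | J. J \<subseteq> N \<and> fan_cell q N \<theta>0 \<subseteq> fcone q J} \<subseteq> fan_cell q N \<theta>0"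
    unfolding fan_cell_def by (rule Inter_anti_mono) blast
qed blast

lemma aff_dim_fan_cell: "aff_dim (fan_cell q N \<theta>) = int (dim (fan_cell q N \<theta>))"
  by (intro aff_dim_zero hull_inc zero_in_fan_cell)

lemma eventually_mem_fcone_interior:
  fixes q :: "'i \<Rightarrow> 'a::euclidean_space"
  assumes "finite M" "w = (\<Sum>i\<in>M. a i *\<^sub>R q i)" "\<forall>i\<in>M. 0 < a i" "v \<in> span (q ` M)"
  shows "\<forall>\<^sub>F t in at_right 0. w + t *\<^sub>R v \<in> fcone q M"
proof -
  have "v \<in> span ({} \<union> q ` M)" using assms(4) by simp
  from span_Un_image_explicit[OF assms(1) this] obtain c where v: "v = (\<Sum>i\<in>M. c i *\<^sub>R q i)" by auto
  have eq: "w + t *\<^sub>R v = (\<Sum>i\<in>M. (a i + t * c i) *\<^sub>R q i)" for t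
    by (simp add: assms(2) v scaleR_add_left scaleR_sum_right sum.distrib)
  have "\<forall>\<^sub>F t in at_right 0. \<forall>i\<in>M. 0 < a i + t * c i"
    using assms(1,3) by (intro eventually_ball_finite ballI eventually_perturb_pos) auto
  then show ?thesis
    by (rule eventually_mono) (unfold eq, intro fconeI[OF assms(1)], auto intro: less_imp_le)
qed

lemma positive_representation:
  fixes q :: "'i \<Rightarrow> 'a::euclidean_space"
  assumes "finite J" "w \<in> fcone q J"
  obtains M a where "M \<subseteq> J" "finite M" "inj_on q M" "independent (q ` M)"
    "\<forall>i\<in>M. 0 < a i" "w = (\<Sum>i\<in>M. a i *\<^sub>R q i)" "w \<in> span (q ` M)" "w \<in> fcone q M"
proof -
  obtain M a where M: "M \<subseteq> J" "inj_on q M" "q ` M \<inter> {} = {}" "independent ({} \<union> q ` M)"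
    "\<forall>i\<in>M. 0 < a i" "w - (\<Sum>i\<in>M. a i *\<^sub>R q i) \<in> span {}"
    by (rule conic_caratheodory_mod[OF assms(1) independent_empty _ assms(2), of w]) auto
  have fin: "finite M" using M(1) assms(1) finite_subset by blast
  have w: "w = (\<Sum>i\<in>M. a i *\<^sub>R q i)" using M(6) by simp
  have "w \<in> fcone q M" unfolding w using M(5) by (intro fconeI[OF fin]) (auto intro: less_imp_le)
  moreover from this have "w \<in> span (q ` M)" using fcone_subset_span by blast
  moreover have "independent (q ` M)" using M(4) by simp
  ultimately show thesis using that[of M a] M(1,2,5) fin w by blast
qed

definition generic_in :: "('i \<Rightarrow> 'a::euclidean_space) \<Rightarrow> 'i set \<Rightarrow> 'a set \<Rightarrow> 'a \<Rightarrow> bool" where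
  "generic_in q N E w \<longleftrightarrow> (\<forall>J\<subseteq>N. w \<in> span (q ` J) \<longrightarrow> E \<subseteq> span (q ` J))"

lemma exists_generic_in_rel_interior:
  fixes q :: "'i \<Rightarrow> 'a::euclidean_space"
  assumes "finite N" "convex W" "W \<noteq> {}"
  shows "\<exists>w\<in>rel_interior W. generic_in q N (span W) w"
proof -
  let ?\<A> = "{span (q ` J) | J. J \<subseteq> N \<and> \<not> span W \<subseteq> span (q ` J)}"
  have "\<exists>w\<in>rel_interior W. \<forall>A\<in>?\<A>. w \<notin> A"
  proof (rule convex_avoid_subspaces)
    show "finite ?\<A>" by (rule finite_subset[of _ "(\<lambda>J. span (q ` J)) ` Pow N"]) (use assms(1) in auto)
    show "convex (rel_interior W)" by (rule convex_rel_interior[OF assms(2)])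
    show "rel_interior W \<noteq> {}" using rel_interior_eq_empty[OF assms(2)] assms(3) by simp
    fix A assume "A \<in> ?\<A>"
    then obtain J where J: "A = span (q ` J)" "\<not> span W \<subseteq> span (q ` J)" by blast
    have "\<not> rel_interior W \<subseteq> A"
    proof
      assume "rel_interior W \<subseteq> A"
      then have "W \<subseteq> A" using J(1) by (intro rel_interior_subset_closed[OF assms(2)]) (simp_all add: closed_span)
      then show False using J span_minimal[OF _ subspace_span] by blast
    qed
    then show "subspace A \<and> \<not> rel_interior W \<subseteq> A" using J(1) by simp
  qed
  then obtain w where w: "w \<in> rel_interior W" "\<forall>A\<in>?\<A>. w \<notin> A" ..
  have "generic_in q N (span W) w" unfolding generic_in_def
  proof (intro allI impI, rule ccontr)
    fix J assume "J \<subseteq> N" "w \<in> span (q ` J)" "\<not> span W \<subseteq> span (q ` J)"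
    then have "span (q ` J) \<in> ?\<A>" by blast
    then show False using w(2) \<open>w \<in> span (q ` J)\<close> by blast
  qed
  then show ?thesis using w(1) ..
qed

text \<open>
  If all simplicial cones around a generic point \<open>w\<close> of the wall were full-dimensional, then each
  would contain a neighbourhood of \<open>w\<close>, and so would their intersection, the wall.
\<close>

lemma wall_spanned_by_weights:
  fixes q :: "'i \<Rightarrow> 'a::euclidean_space"
  assumes N: "finite N" and \<theta>0: "\<theta>0 \<in> fcone q N" and W: "W = fan_cell q N \<theta>0"
    and dim: "dim W + 1 = dim (q ` N)"
    and w: "w \<in> rel_interior W" "generic_in q N (span W) w"
  obtains M a where "M \<subseteq> N" "finite M" "inj_on q M" "independent (q ` M)"
    "\<forall>i\<in>M. 0 < a i" "w = (\<Sum>i\<in>M. a i *\<^sub>R q i)" "span (q ` M) = span W"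
proof -
  have iff: "w \<in> fcone q J \<longleftrightarrow> W \<subseteq> fcone q J" if "J \<subseteq> N" for J
    using mem_rel_interior_fan_cell_iff[OF N \<theta>0 w(1)[unfolded W] that] W by simp
  have "\<exists>J\<subseteq>N. w \<in> fcone q J \<and> (\<exists>M\<subseteq>J. \<exists>a. finite M \<and> inj_on q M \<and> independent (q ` M) \<and>
     (\<forall>i\<in>M. 0 < a i) \<and> w = (\<Sum>i\<in>M. a i *\<^sub>R q i) \<and> w \<in> span (q ` M) \<and> span (q ` M) \<noteq> span (q ` N))"
  proof (rule ccontr)
    assume neg: "\<not> ?thesis"
    have near: "\<forall>\<^sub>F t in at_right 0. w + t *\<^sub>R v \<in> fcone q J"
      if J: "J \<subseteq> N" "w \<in> fcone q J" and v: "v \<in> span (q ` N)" for J v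
    proof -
      have finJ: "finite J" using J(1) N finite_subset by blast
      obtain M a where M: "M \<subseteq> J" "finite M" "inj_on q M" "independent (q ` M)"
        "\<forall>i\<in>M. 0 < a i" "w = (\<Sum>i\<in>M. a i *\<^sub>R q i)" "w \<in> span (q ` M)" "w \<in> fcone q M"
        by (rule positive_representation[OF finJ J(2)])
      have "span (q ` M) = span (q ` N)" using neg J M by blast
      then have "\<forall>\<^sub>F t in at_right 0. w + t *\<^sub>R v \<in> fcone q M"
        using v by (intro eventually_mem_fcone_interior[OF M(2,6,5)]) simp
      then show ?thesis by (rule eventually_mono) (use fcone_mono[OF M(1)] in blast)
    qed
    have "span (q ` N) \<subseteq> span W"
    proof
      fix v assume v: "v \<in> span (q ` N)"
      have "\<forall>\<^sub>F t in at_right 0. \<forall>J\<in>{J. J \<subseteq> N \<and> w \<in> fcone q J}. w + t *\<^sub>R v \<in> fcone q J"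
        using N near v by (intro eventually_ball_finite) auto
      then obtain t where t: "\<forall>J\<in>{J. J \<subseteq> N \<and> w \<in> fcone q J}. w + t *\<^sub>R v \<in> fcone q J" "0 < t"
        by (rule eventually_at_right_0_ex[of _ 1]) simp_all
      have "w + t *\<^sub>R v \<in> W"
      proof -
        have "w + t *\<^sub>R v \<in> fcone q J" if "J \<subseteq> N" "W \<subseteq> fcone q J" for J using t(1) iff that by blast
        then show ?thesis unfolding W by (subst fan_cell_eq_Inter) (use W in blast)
      qed
      moreover have "w \<in> W" using w(1) rel_interior_subset by blast
      ultimately have "(1 / t) *\<^sub>R ((w + t *\<^sub>R v) - w) \<in> span W" by (intro span_scale span_diff span_base)
      then show "v \<in> span W" using t(2) by simp
    qed
    then have "dim (span (q ` N)) \<le> dim (span W)" by (rule dim_subset)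
    then show False using dim by simp
  qed
  then obtain J M a where J: "J \<subseteq> N" and M: "M \<subseteq> J" "finite M" "inj_on q M" "independent (q ` M)"
     "\<forall>i\<in>M. 0 < a i" "w = (\<Sum>i\<in>M. a i *\<^sub>R q i)" "w \<in> span (q ` M)" "span (q ` M) \<noteq> span (q ` N)" by blast
  have MN: "M \<subseteq> N" using J M(1) by blast
  have sub: "span W \<subseteq> span (q ` M)" using w(2) MN M(7) unfolding generic_in_def by blast
  have "span (q ` M) \<subseteq> span (q ` N)" using MN by (intro span_mono) auto
  then have "dim (q ` M) < dim (q ` N)" using M(8) by (intro dim_psubset) blast
  then have "dim (span (q ` M)) \<le> dim (span W)" using dim by simp
  then have "span (q ` M) = span W" using sub by (metis subspace_dim_equal subspace_span)
  then show thesis using that[of M a] MN M by blast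
qed

lemma hyperplane_eq:
  fixes V :: "'a::euclidean_space set"
  assumes "subspace V" "subspace E" "E \<subseteq> V" "dim E + 1 = dim V" "l \<in> V" "l \<noteq> 0" "\<forall>x\<in>E. x \<bullet> l = 0"
  shows "E = {x\<in>V. x \<bullet> l = 0}"
proof -
  let ?F = "{x\<in>V. x \<bullet> l = 0}"
  have F: "subspace ?F" using assms(1) by (auto simp: subspace_def inner_add_left)
  have "l \<notin> ?F" using assms(6) by simp
  then have "?F \<subset> V" using assms(5) by blast
  then have "span ?F \<subset> span V" using F assms(1) by (metis span_eq_iff)
  then have "dim ?F < dim V" by (rule dim_psubset)
  then show ?thesis using assms F by (intro subspace_dim_equal) auto
qed

text \<open>
  The chamber is the cell of a point \<open>\<theta>\<close> just beyond a generic point \<open>w\<close> of the wall.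
  The cones containing \<open>\<theta>\<close> contain \<open>w\<close>, hence the wall. Conversely, consider a cone
  containing \<open>w\<close> and a simplicial cone inside it that has \<open>w\<close> in its relative interior.
  Either the latter is full-dimensional and contains \<open>\<theta>\<close>, or it lies in the hyperplane of the
  wall and contains \<open>\<theta>\<close> after adding one weight beyond the wall. In both cases the cell of
  \<open>\<theta>\<close> meets the hyperplane inside the given cone. So it meets the hyperplane in the wall.
\<close>

lemma chamber_beyond_exists:
  fixes q :: "'i \<Rightarrow> 'a::euclidean_space"
  assumes N: "finite N" and \<theta>0: "\<theta>0 \<in> fcone q N" and W: "W = fan_cell q N \<theta>0"
    and dim: "dim W + 1 = dim (q ` N)"
    and w: "w \<in> rel_interior W" "generic_in q N (span W) w"
    and E: "span W = {x\<in>span (q ` N). x \<bullet> l = 0}"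
    and u: "u \<in> span (q ` N)" "u \<bullet> l < 0" and s: "0 < s" "w + s *\<^sub>R u \<in> fcone q N"
  shows "\<exists>\<theta>\<in>fcone q N. dim (fan_cell q N \<theta>) = dim (q ` N) \<and> W facet_of fan_cell q N \<theta> \<and>
    (\<forall>x\<in>fan_cell q N \<theta>. x \<bullet> l \<le> 0)"
proof -
  have iff: "w \<in> fcone q J \<longleftrightarrow> W \<subseteq> fcone q J" if "J \<subseteq> N" for J
    using mem_rel_interior_fan_cell_iff[OF N \<theta>0 w(1)[unfolded W] that] W by simp
  have wW: "w \<in> W" using w(1) rel_interior_subset by blast
  have wl: "w \<bullet> l = 0" using wW span_base[OF wW] E by blast
  have wN: "w \<in> fcone q N" using iff[OF order_refl] \<theta>0 W fan_cell_subset[of N N \<theta>0 q] wW by blast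
  \<comment> \<open>the cones that contain all points sufficiently close to \<open>w\<close> on the ray from \<open>w\<close> in the direction \<open>u\<close>\<close>
  define Q where "Q J \<longleftrightarrow> w \<in> fcone q J \<and> (\<exists>t>0. w + t *\<^sub>R u \<in> fcone q J)" for J
  have pattern: "\<forall>\<^sub>F t in at_right 0. w + t *\<^sub>R u \<in> fcone q J \<longleftrightarrow> Q J" if "J \<subseteq> N" for J
  proof -
    have finJ: "finite J" using that N finite_subset by blast
    consider "w \<notin> fcone q J" | "w \<in> fcone q J" "\<forall>t>0. w + t *\<^sub>R u \<notin> fcone q J"
      | t0 where "w \<in> fcone q J" "0 < t0" "w + t0 *\<^sub>R u \<in> fcone q J" by blast
    then show ?thesis
    proof cases
      case 1
      then have "\<forall>\<^sub>F t in at_right 0. w + t *\<^sub>R u \<notin> fcone q J"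
        by (intro eventually_avoids_closed closed_fcone[OF finJ])
      then show ?thesis using 1 by (auto simp: Q_def elim: eventually_mono)
    next
      case 2
      then show ?thesis using eventually_at_right_less[of "0::real"] by (auto simp: Q_def elim!: eventually_mono)
    next
      case 3
      have "w + t *\<^sub>R u \<in> fcone q J" if t: "0 < t" "t < t0" for t
      proof -
        have "(1 - t / t0) *\<^sub>R w + (t / t0) *\<^sub>R (w + t0 *\<^sub>R u) \<in> fcone q J"
          using 3 t by (intro convexD[OF convex_fcone]) auto
        then show ?thesis using 3(2) by (simp add: algebra_simps)
      qed
      then show ?thesis using eventually_at_right_0_less[OF 3(2)] 3 by (auto simp: Q_def elim!: eventually_mono)
    qed
  qed
  have "\<forall>\<^sub>F t in at_right 0. \<forall>J\<in>Pow N. w + t *\<^sub>R u \<in> fcone q J \<longleftrightarrow> Q J"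
    using N pattern by (intro eventually_ball_finite) auto
  then obtain t where t: "\<forall>J\<in>Pow N. w + t *\<^sub>R u \<in> fcone q J \<longleftrightarrow> Q J" "0 < t"
    by (rule eventually_at_right_0_ex[of _ 1]) simp_all
  define \<theta> where "\<theta> = w + t *\<^sub>R u"
  have \<theta>Q: "\<theta> \<in> fcone q J \<longleftrightarrow> Q J" if "J \<subseteq> N" for J using t(1) that by (simp add: \<theta>_def)
  have QI: "\<theta> \<in> fcone q J" if J: "J \<subseteq> N" and ev: "\<forall>\<^sub>F t in at_right 0. w + t *\<^sub>R u \<in> fcone q J" for J
  proof -
    have "\<forall>\<^sub>F t in at_right (0::real). Q J" using ev pattern[OF J] by eventually_elim blast
    then have "Q J" by (simp add: eventually_const_iff trivial_limit_at_right_real)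
    then show ?thesis using \<theta>Q[OF J] by blast
  qed
  have "Q N" using wN s by (auto simp: Q_def)
  then have \<theta>N: "\<theta> \<in> fcone q N" using \<theta>Q by blast
  have \<theta>l: "\<theta> \<bullet> l < 0" using wl u t(2) by (simp add: \<theta>_def inner_add_left mult_pos_neg)
  let ?C = "fan_cell q N \<theta>"
  have WC: "W \<subseteq> ?C" unfolding fan_cell_def using \<theta>Q iff by (auto simp: Q_def)
  have Cspan: "?C \<subseteq> span (q ` N)"
    using fan_cell_subset[OF order_refl \<theta>N] fcone_subset_span by blast
  have dimC: "dim ?C = dim (q ` N)"
  proof (rule antisym)
    show "dim ?C \<le> dim (q ` N)" using dim_subset[OF Cspan] by simp
    have "\<theta> \<notin> span W" using \<theta>l E by auto
    then have "dim (insert \<theta> W) = dim (q ` N)" using dim by (simp add: dim_insert)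
    moreover have "insert \<theta> W \<subseteq> ?C" using WC fan_cell_self[of \<theta> q N] by blast
    ultimately show "dim (q ` N) \<le> dim ?C" using dim_subset[of "insert \<theta> W" ?C] by simp
  qed
  obtain i where i: "i \<in> N" "q i \<bullet> l < 0"
  proof -
    obtain a where a: "\<forall>i\<in>N. 0 \<le> a i" "\<theta> = (\<Sum>i\<in>N. a i *\<^sub>R q i)" by (rule fconeE[OF N \<theta>N])
    have "\<not> (\<forall>i\<in>N. 0 \<le> q i \<bullet> l)"
    proof
      assume "\<forall>i\<in>N. 0 \<le> q i \<bullet> l"
      then have "0 \<le> \<theta> \<bullet> l" unfolding a(2) using a(1) by (auto simp: inner_sum_left intro: sum_nonneg)
      then show False using \<theta>l by simp
    qed
    then show thesis using that by force
  qed
  \<comment> \<open>a cone inside the wall through \<open>w\<close> grows, by the weight \<open>q i\<close>, to a cone containing \<open>\<theta>\<close>\<close>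
  have grow: "x \<bullet> l \<le> 0 \<and> (x \<bullet> l = 0 \<longrightarrow> x \<in> fcone q M)"
    if M: "M \<subseteq> N" "finite M" "\<forall>i\<in>M. 0 < a i" "w = (\<Sum>i\<in>M. a i *\<^sub>R q i)" "span (q ` M) = span W"
      and x: "x \<in> ?C" for M a x
  proof -
    have M0: "q j \<bullet> l = 0" if "j \<in> M" for j
      using that span_base[of "q j" "q ` M"] M(5) E by blast
    then have iM: "i \<notin> M" using i by force
    define b where "b = (u \<bullet> l) / (q i \<bullet> l)"
    have b: "0 < b" using u(2) i(2) by (simp add: b_def divide_neg_neg)
    have "u - b *\<^sub>R q i \<in> span (q ` N)" using u(1) i(1) by (intro span_diff span_scale) (auto intro: span_base)
    moreover have "(u - b *\<^sub>R q i) \<bullet> l = 0" using i(2) by (simp add: b_def inner_diff_left)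
    ultimately have "u - b *\<^sub>R q i \<in> span (q ` M)" using E M(5) by blast
    from eventually_mem_fcone_interior[OF M(2,4,3) this]
    have ev: "\<forall>\<^sub>F t in at_right 0. w + t *\<^sub>R (u - b *\<^sub>R q i) \<in> fcone q M" .
    have iMN: "insert i M \<subseteq> N" using i(1) M(1) by blast
    have "\<theta> \<in> fcone q (insert i M)"
    proof (rule QI[OF iMN])
      show "\<forall>\<^sub>F t in at_right 0. w + t *\<^sub>R u \<in> fcone q (insert i M)"
        using ev eventually_at_right_less[of "0::real"]
      proof eventually_elim
        case (elim t)
        have "w + t *\<^sub>R (u - b *\<^sub>R q i) \<in> fcone q (insert i M)" using elim(1) fcone_mono[of M "insert i M" q] by blast
        moreover have "(t * b) *\<^sub>R q i \<in> fcone q (insert i M)"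
          using elim(2) b by (intro convex_cone_hull_mul hull_inc) auto
        ultimately have "w + t *\<^sub>R (u - b *\<^sub>R q i) + (t * b) *\<^sub>R q i \<in> fcone q (insert i M)"
          by (rule convex_cone_hull_add)
        then show ?case by (simp add: algebra_simps)
      qed
    qed
    then have "x \<in> fcone q (insert i M)" using fan_cell_subset[OF iMN] x by blast
    then obtain c where c: "\<forall>j\<in>insert i M. 0 \<le> c j" "x = (\<Sum>j\<in>insert i M. c j *\<^sub>R q j)"
      using fconeE[of "insert i M" x q] M(2) by blast
    have xl: "x \<bullet> l = c i * (q i \<bullet> l)"
      unfolding c(2) using M(2) iM M0 by (simp add: inner_sum_left inner_add_left)
    have "x \<in> fcone q M" if "x \<bullet> l = 0"
    proof -
      have "c i = 0" using that xl i(2) by simp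
      then have "x = (\<Sum>j\<in>M. c j *\<^sub>R q j)" unfolding c(2) using M(2) iM by simp
      then show ?thesis using c(1) fconeI[OF M(2), of c q] by simp
    qed
    then show ?thesis using xl c(1) i(2) by (simp add: mult_nonneg_nonpos)
  qed
  obtain M a where M: "M \<subseteq> N" "finite M" "inj_on q M" "independent (q ` M)"
    "\<forall>i\<in>M. 0 < a i" "w = (\<Sum>i\<in>M. a i *\<^sub>R q i)" "span (q ` M) = span W"
    by (rule wall_spanned_by_weights[OF N \<theta>0 W dim w])
  have half: "x \<bullet> l \<le> 0" if "x \<in> ?C" for x using grow[OF M(1,2,5-7) that] by blast
  have "x \<in> W" if x: "x \<in> ?C" "x \<bullet> l = 0" for x
  proof -
    have "x \<in> fcone q J" if J: "J \<subseteq> N" "W \<subseteq> fcone q J" for J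
    proof -
      have finJ: "finite J" using J(1) N finite_subset by blast
      have wJ: "w \<in> fcone q J" using iff J by blast
      obtain M a where M: "M \<subseteq> J" "finite M" "inj_on q M" "independent (q ` M)"
        "\<forall>i\<in>M. 0 < a i" "w = (\<Sum>i\<in>M. a i *\<^sub>R q i)" "w \<in> span (q ` M)" "w \<in> fcone q M"
        by (rule positive_representation[OF finJ wJ])
      have MN: "M \<subseteq> N" using M(1) J(1) by blast
      have sub: "span W \<subseteq> span (q ` M)" using w(2) MN M(7) unfolding generic_in_def by blast
      have subN: "span (q ` M) \<subseteq> span (q ` N)" using MN by (intro span_mono) auto
      show ?thesis
      proof (cases "span (q ` M) = span W")
        case True
        then show ?thesis using grow[OF MN M(2,5,6) True x(1)] x(2) fcone_mono[OF M(1), of q] by blast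
      next
        case False
        then have "dim W < dim (q ` M)" using sub by (intro dim_psubset) blast
        then have "dim (span (q ` N)) \<le> dim (span (q ` M))" using dim by simp
        then have "span (q ` M) = span (q ` N)" using subN by (metis subspace_dim_equal subspace_span)
        then have "\<forall>\<^sub>F t in at_right 0. w + t *\<^sub>R u \<in> fcone q M"
          using u(1) by (intro eventually_mem_fcone_interior[OF M(2,6,5)]) simp
        then have "\<theta> \<in> fcone q M" by (rule QI[OF MN])
        then show ?thesis using fan_cell_subset[OF MN] x(1) fcone_mono[OF M(1), of q] by blast
      qed
    qed
    then show ?thesis unfolding W by (subst fan_cell_eq_Inter) (use W in blast)
  qed
  moreover have "x \<bullet> l = 0" if "x \<in> W" for x using span_base[OF that] E by blast
  ultimately have WC: "W = ?C \<inter> {x. l \<bullet> x = 0}" using WC by (auto simp: inner_commute)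
  have "W face_of ?C" unfolding WC
    by (rule face_of_Int_supporting_hyperplane_le[OF convex_fan_cell]) (use half in \<open>simp add: inner_commute\<close>)
  moreover have "aff_dim W = aff_dim ?C - 1"
    using dim dimC aff_dim_fan_cell[of q N \<theta>] aff_dim_fan_cell[of q N \<theta>0] by (simp add: W)
  moreover have "W \<noteq> {}" using wW by blast
  ultimately have "W facet_of ?C" unfolding facet_of_def by blast
  then show ?thesis using \<theta>N dimC half by blast
qed

section \<open>The invariant of a phase\<close>

text \<open>
  The form in which the conditions on a toric GIT problem pass to the Higgs GIT problems of walls:
  finiteness of the cokernel of the weight map becomes a condition on real spans.
\<close>

definition spanning_git :: "('i, 'a::euclidean_space) git \<Rightarrow> bool" where
  "spanning_git G \<longleftrightarrow> is_lattice (chars G) \<and> finite (idx G) \<and> wt G ` idx G \<subseteq> chars G \<and>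
     span (wt G ` idx G) = span (chars G)"

text \<open>
  By the pigeonhole principle two multiples of a character lie in the same coset of the image of
  the weight map.
\<close>

lemma git_problem_spanning:
  assumes "git_problem G"
  shows "spanning_git G"
proof -
  have G: "is_lattice (chars G)" "finite (idx G)" "wt G ` idx G \<subseteq> chars G"
    "finite ((\<lambda>v. (\<lambda>u. v + u) ` range (weight_map G)) ` chars G)"
    using assms by (auto simp: git_problem_def)
  let ?R = "range (weight_map G)"
  have Rspan: "?R \<subseteq> span (wt G ` idx G)"
    unfolding weight_map_def by (auto intro!: span_sum span_scale intro: span_base)
  have R0: "0 \<in> ?R" by (rule range_eqI[of _ _ "\<lambda>i. 0"]) (simp add: weight_map_def)
  obtain B where B: "chars G = zspan B" using G(1) unfolding is_lattice_iff_zspan by blast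
  have "chars G \<subseteq> span (wt G ` idx G)"
  proof
    fix v assume v: "v \<in> chars G"
    define c where "c k = (\<lambda>u. of_int (int k) *\<^sub>R v + u) ` ?R" for k :: nat
    have "range c \<subseteq> (\<lambda>v. (\<lambda>u. v + u) ` ?R) ` chars G"
      using v zspan_scale unfolding B c_def by blast
    then have "finite (range c)" using G(4) finite_subset by blast
    then have "\<not> inj c" using finite_imageD infinite_UNIV_nat by blast
    then obtain j k where jk: "c j = c k" "j \<noteq> k" unfolding inj_def by blast
    have "of_int (int j) *\<^sub>R v + 0 \<in> c j" unfolding c_def using R0 by (rule imageI)
    then have "of_int (int j) *\<^sub>R v \<in> c k" using jk(1) by simp
    then obtain u where u: "u \<in> ?R" "of_int (int j) *\<^sub>R v = of_int (int k) *\<^sub>R v + u"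
      unfolding c_def by (rule imageE) blast
    have "(1 / (real j - real k)) *\<^sub>R u \<in> span (wt G ` idx G)" using u(1) Rspan by (intro span_scale) blast
    moreover have "u = (real j - real k) *\<^sub>R v" using u(2) by (simp add: scaleR_diff_left)
    ultimately show "v \<in> span (wt G ` idx G)" using jk(2) by simp
  qed
  then have "span (wt G ` idx G) = span (chars G)"
    using span_mono[OF G(3)] by (metis span_minimal subspace_span subset_antisym)
  then show ?thesis using G by (simp add: spanning_git_def)
qed

lemma secondary_fan_cell:
  "C \<in> secondary_fan G \<longleftrightarrow> (\<exists>\<theta>\<in>fcone (wt G) (idx G). C = fan_cell (wt G) (idx G) \<theta>)"
  by (auto simp: secondary_fan_def wcone_def fan_cell_def)

lemma semistable_cong:
  assumes "\<And>J. J \<subseteq> idx G \<Longrightarrow> \<theta> \<in> fcone (wt G) J \<longleftrightarrow> \<theta>' \<in> fcone (wt G) J"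
  shows "semistable G \<theta> = semistable G \<theta>'"
  unfolding semistable_def wcone_def using assms[of "{i \<in> idx G. _ i \<noteq> 0}"] by auto

lemma semistable_rel_interior:
  assumes "finite (idx G)" "C \<in> secondary_fan G" "\<theta> \<in> rel_interior C" "\<theta>' \<in> rel_interior C"
  shows "semistable G \<theta> = semistable G \<theta>'"
proof -
  obtain \<theta>0 where c: "\<theta>0 \<in> fcone (wt G) (idx G)" "C = fan_cell (wt G) (idx G) \<theta>0"
    using assms(2) unfolding secondary_fan_cell by blast
  show ?thesis
    by (rule semistable_cong)
      (use mem_rel_interior_fan_cell_iff[OF assms(1) c(1)] assms(3,4) c(2) in blast)
qed

lemma secondary_fan_cone:
  assumes "finite (idx G)" "C \<in> secondary_fan G"
  shows "convex C" "closed C" "0 \<in> C" "C \<subseteq> fcone (wt G) (idx G)"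
  using assms convex_fan_cell closed_fan_cell zero_in_fan_cell fan_cell_subset[OF order_refl]
  unfolding secondary_fan_cell by metis+

lemma chamber_span:
  assumes "spanning_git G" "chamber G C"
  shows "C \<in> secondary_fan G" "span C = span (chars G)"
proof -
  show C: "C \<in> secondary_fan G" using assms(2) by (simp add: chamber_def)
  have "C \<subseteq> span (chars G)"
    using secondary_fan_cone(4)[OF _ C] fcone_subset_span[of "wt G" "idx G"] assms(1) by (auto simp: spanning_git_def)
  then have "span C \<subseteq> span (chars G)" by (intro span_minimal) auto
  then show "span C = span (chars G)"
    using assms(2) by (intro subspace_dim_equal) (auto simp: chamber_def)
qed

lemma phase_semistable:
  assumes "finite (idx G)" "phase_of_chamber G C X" "\<theta> \<in> rel_interior C"
  shows "X = semistable G \<theta>"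
  using assms semistable_rel_interior[OF assms(1) _ _ assms(3)]
  unfolding phase_of_chamber_def chamber_def by blast

lemma rel_interior_segment:
  fixes C :: "'a::euclidean_space set"
  assumes "convex C" "p \<in> C" "\<theta> \<in> rel_interior C" "0 < t" "t \<le> 1"
  shows "p + t *\<^sub>R (\<theta> - p) \<in> rel_interior C"
  using rel_interior_convex_shrink[OF assms(1,3,2,4,5)] by (simp add: algebra_simps)

text \<open>
  One basis per subspace, fixed once and for all, so that the invariants for a subspace \<open>H\<close> of
  different Higgs GIT problems are comparable.
\<close>

definition basis_of :: "'a::euclidean_space set \<Rightarrow> 'a set" where
  "basis_of H = (SOME K. independent K \<and> span K = H)"

lemma basis_of_subspace:
  assumes "subspace H"
  shows "independent (basis_of H)" "span (basis_of H) = H"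
proof -
  obtain K where K: "K \<subseteq> H" "independent K" "H \<subseteq> span K" using basis_exists[of H] by metis
  then have "independent K \<and> span K = H" using assms span_minimal by blast
  then have "independent (basis_of H) \<and> span (basis_of H) = H" unfolding basis_of_def by (rule someI)
  then show "independent (basis_of H)" "span (basis_of H) = H" by auto
qed

definition idx_in :: "('i, 'a::euclidean_space) git \<Rightarrow> 'a set \<Rightarrow> 'i set" where
  "idx_in G H = {i \<in> idx G. wt G i \<in> H}"

definition point_count :: "('i, 'a::euclidean_space) git \<Rightarrow> 'a set \<Rightarrow> 'a \<Rightarrow> real" where
  "point_count G H \<theta> = basis_count (wt G) (idx G) (basis_of H) (span (chars G))
     (\<lambda>I. \<theta> \<in> fcone (wt G) (I \<union> idx_in G H))"

text \<open>
  The invariant of a phase attached to a subspace \<open>H\<close>. A phase is only known as a semistable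
  locus, so that membership of a stability parameter in a cone is tested by a point of the
  representation whose non-zero coordinates are those of the cone; the empty phase gets the value
  \<open>0\<close>. Dividing by the covolume makes the value comparable between the lattices of a problem
  and of its Higgs GIT problems.
\<close>

definition phase_count :: "('i, 'a::euclidean_space) git \<Rightarrow> 'a set \<Rightarrow> ('i \<Rightarrow> complex) set \<Rightarrow> real" where
  "phase_count G H X = basis_count (wt G) (idx G) (basis_of H) (span (chars G))
     (\<lambda>I. (\<lambda>i. of_bool (i \<in> I \<union> idx_in G H)) \<in> X) / covol (chars G)"

lemma basis_count_cong:
  assumes "\<And>I. I \<in> bases q N K V \<Longrightarrow> P I \<longleftrightarrow> P' I"
  shows "basis_count q N K V P = basis_count q N K V P'"
  unfolding basis_count_def using assms by (intro sum.cong) auto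

lemma phase_count_semistable: "phase_count G H (semistable G \<theta>) = point_count G H \<theta> / covol (chars G)"
proof -
  have "(\<lambda>i. of_bool (i \<in> I \<union> idx_in G H)) \<in> semistable G \<theta> \<longleftrightarrow> \<theta> \<in> fcone (wt G) (I \<union> idx_in G H)"
    if "I \<in> bases (wt G) (idx G) (basis_of H) (span (chars G))" for I
  proof -
    have sub: "I \<union> idx_in G H \<subseteq> idx G" using that by (auto simp: bases_def idx_in_def)
    then have "{i \<in> idx G. of_bool (i \<in> I \<union> idx_in G H) \<noteq> (0::complex)} = I \<union> idx_in G H" by auto
    then show ?thesis using sub by (auto simp: semistable_def rep_space_def wcone_def)
  qed
  then show ?thesis unfolding phase_count_def point_count_def by (simp cong: basis_count_cong)
qed

lemma phase_count_empty [simp]: "phase_count G H {} = 0"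
  by (simp add: phase_count_def basis_count_def)

lemma bases_nonempty_imp:
  assumes "subspace H" "bases q N (basis_of H) V \<noteq> {}"
  shows "H \<subseteq> V"
proof -
  obtain I where "span (basis_of H \<union> q ` I) = V" using assms(2) by (auto simp: bases_def)
  then show ?thesis using span_mono[of "basis_of H" "basis_of H \<union> q ` I"] basis_of_subspace(2)[OF assms(1)] by auto
qed

text \<open>
  A basis of \<open>H\<close> cannot be completed to a basis of a space that does not contain \<open>H\<close>.
\<close>

lemma phase_count_not_subset:
  assumes "subspace H" "\<not> H \<subseteq> span (chars G)"
  shows "phase_count G H X = 0"
proof -
  have "bases (wt G) (idx G) (basis_of H) (span (chars G)) = {}"
    using bases_nonempty_imp[OF assms(1)] assms(2) by metis
  then show ?thesis by (simp add: phase_count_def basis_count_def)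
qed

lemma relevant_fcone:
  assumes "relevant G H"
  shows "subspace H" "fcone (wt G) (idx_in G H) = span (basis_of H)" "idx_in G H \<subseteq> idx G"
  using assms basis_of_subspace(2)[of H] by (auto simp: relevant_def wcone_def idx_in_def)

text \<open>
  This is \<open>lattice_kernel\<close> for the primitive normal of a wall, together with the fact that the
  weights in the span of the wall span it, from \<open>wall_spanned_by_weights\<close>.
\<close>

lemma wall_normal_higgs:
  assumes G: "spanning_git G" and W: "wall G W" and l: "wall_normal G W C l"
  shows "l \<in> span (chars G)" "l \<noteq> 0" "span W = {x \<in> span (chars G). x \<bullet> l = 0}"
    "spanning_git (higgs G (span W))" "span (chars (higgs G (span W))) = span W"
    "covol (chars G) * norm l = covol (chars (higgs G (span W)))"
proof -
  have G': "is_lattice (chars G)" "finite (idx G)" "wt G ` idx G \<subseteq> chars G" "span (wt G ` idx G) = span (chars G)"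
    using G by (auto simp: spanning_git_def)
  have Wf: "W \<in> secondary_fan G" "dim W + 1 = dim (chars G)" using W by (auto simp: wall_def)
  have l': "primitive G l" "\<forall>x\<in>W. x \<bullet> l = 0" using l by (auto simp: wall_normal_def)
  show lV: "l \<in> span (chars G)" using l'(1) by (simp add: primitive_def one_params_def)
  have lint: "\<forall>x\<in>chars G. x \<bullet> l \<in> \<int>" using l'(1) by (simp add: primitive_def one_params_def)
  have zero: "0 \<in> one_params G" by (simp add: one_params_def span_zero)
  show l0: "l \<noteq> 0"
  proof
    assume "l = 0"
    then have "l = of_nat 2 *\<^sub>R 0" by simp
    moreover have "\<forall>k::nat. \<forall>m\<in>one_params G. l = of_nat k *\<^sub>R m \<longrightarrow> k = 1"
      using l'(1) by (simp add: primitive_def)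
    ultimately have "(2::nat) = 1" using zero by metis
    then show False by simp
  qed
  have WV: "span W \<subseteq> span (chars G)"
    using secondary_fan_cone(4)[OF G'(2) Wf(1)] fcone_subset_span[of "wt G" "idx G"] G'(4)
    by (intro span_minimal) auto
  have Wl: "\<forall>x\<in>span W. x \<bullet> l = 0" using inner_span_zero[of _ W l] l'(2) by blast
  show E: "span W = {x \<in> span (chars G). x \<bullet> l = 0}"
    by (rule hyperplane_eq) (use WV Wl Wf(2) lV l0 in auto)
  have ch: "chars (higgs G (span W)) = {x \<in> chars G. x \<bullet> l = 0}"
    unfolding higgs_def E using span_superset[of "chars G"] by auto
  have prim: "k = 1" if "m \<in> span (chars G)" "\<forall>x\<in>chars G. x \<bullet> m \<in> \<int>" "l = of_nat k *\<^sub>R m" for k :: nat and m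
    using that l'(1) by (auto simp: primitive_def one_params_def)
  note ker = lattice_kernel[OF G'(1) lV l0 lint prim]
  show spE: "span (chars (higgs G (span W))) = span W" unfolding ch using ker E by simp
  show "covol (chars G) * norm l = covol (chars (higgs G (span W)))" unfolding ch using ker by simp
  obtain \<theta>0 where c: "\<theta>0 \<in> fcone (wt G) (idx G)" "W = fan_cell (wt G) (idx G) \<theta>0"
    using Wf(1) unfolding secondary_fan_cell by blast
  have dimN: "dim W + 1 = dim (wt G ` idx G)" using Wf(2) G'(4) by (metis dim_span)
  have Wne: "W \<noteq> {}" using secondary_fan_cone(3)[OF G'(2) Wf(1)] by blast
  obtain w where w: "w \<in> rel_interior W" "generic_in (wt G) (idx G) (span W) w"
    using exists_generic_in_rel_interior[OF G'(2) secondary_fan_cone(1)[OF G'(2) Wf(1)] Wne, of "wt G"] by blast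
  obtain M a where M: "M \<subseteq> idx G" "finite M" "inj_on (wt G) M" "independent (wt G ` M)"
    "\<forall>i\<in>M. 0 < a i" "w = (\<Sum>i\<in>M. a i *\<^sub>R wt G i)" "span (wt G ` M) = span W"
    by (rule wall_spanned_by_weights[OF G'(2) c dimN w])
  have "wt G ` M \<subseteq> span W" using span_superset[of "wt G ` M"] M(7) by simp
  then have "M \<subseteq> idx (higgs G (span W))" using M(1) by (auto simp: higgs_def)
  then have "span W \<subseteq> span (wt G ` idx (higgs G (span W)))"
    unfolding M(7)[symmetric] by (intro span_mono image_mono)
  moreover have "wt G ` idx (higgs G (span W)) \<subseteq> span W" by (auto simp: higgs_def)
  ultimately have "span (wt G ` idx (higgs G (span W))) = span W" using span_minimal by blast
  then show "spanning_git (higgs G (span W))"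
    using ker G'(2,3) spE unfolding spanning_git_def ch by (auto simp: higgs_def ch[unfolded higgs_def, simplified])
qed

lemma wall_phase_semistable:
  assumes G: "spanning_git G" and W: "wall G W" and l: "wall_normal G W C l"
    and Z: "wall_phase G W Z" and w: "w \<in> rel_interior W"
  shows "Z = semistable (higgs G (span W)) w"
proof -
  let ?G = "higgs G (span W)"
  note hg = wall_normal_higgs[OF G W l]
  have fin: "finite (idx G)" "finite (idx ?G)" using G by (auto simp: spanning_git_def higgs_def)
  have Wf: "W \<in> secondary_fan G" using W by (simp add: wall_def)
  obtain D where D: "phase_of_chamber ?G D Z" "rel_interior W \<subseteq> D"
    using Z by (auto simp: wall_phase_def)
  have ch: "chamber ?G D" using D(1) by (simp add: phase_of_chamber_def)
  note Df = chamber_span[OF hg(4) ch]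
  have WD: "W \<subseteq> D"
    by (rule rel_interior_subset_closed[OF secondary_fan_cone(1)[OF fin(1) Wf] secondary_fan_cone(2)[OF fin(2) Df(1)] D(2)])
  have "affine hull W = span W" "affine hull D = span D"
    using secondary_fan_cone(3)[OF fin(1) Wf] secondary_fan_cone(3)[OF fin(2) Df(1)] by (intro affine_hull_span_0 hull_inc; simp)+
  then have "rel_interior W \<subseteq> rel_interior D"
    using Df(2) hg(5) by (intro subset_rel_interior[OF WD]) simp
  then show ?thesis using w phase_semistable[OF fin(2) D(1)] by blast
qed

text \<open>
  Otherwise the chamber, which lies on one side of the hyperplane and has an interior point on it,
  would be contained in it.
\<close>

lemma rel_interior_chamber_normal_pos:
  assumes G: "spanning_git G" and C: "chamber G C" and l: "l \<in> span (chars G)" "l \<noteq> 0"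
    and half: "\<forall>x\<in>C. 0 \<le> x \<bullet> l" and \<theta>: "\<theta> \<in> rel_interior C"
  shows "0 < \<theta> \<bullet> l"
proof (rule ccontr)
  assume neg: "\<not> 0 < \<theta> \<bullet> l"
  have fin: "finite (idx G)" using G by (simp add: spanning_git_def)
  note Cf = chamber_span[OF G C]
  have \<theta>C: "\<theta> \<in> C" using \<theta> rel_interior_subset by blast
  then have \<theta>0: "\<theta> \<bullet> l = 0" using neg half by (meson not_le antisym)
  have "x \<bullet> l = 0" if x: "x \<in> C" for x
  proof -
    have "C \<noteq> {}" using x by blast
    then obtain e where e: "1 < e" "(1 - e) *\<^sub>R x + e *\<^sub>R \<theta> \<in> C"
      using \<theta> x convex_rel_interior_iff[OF secondary_fan_cone(1)[OF fin Cf(1)]] by blast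
    then have "0 \<le> (1 - e) * (x \<bullet> l)" using half \<theta>0 by (force simp: inner_add_left)
    then have "x \<bullet> l \<le> 0" using e(1) by (simp add: zero_le_mult_iff)
    then show ?thesis using half x by force
  qed
  then have "l \<bullet> l = 0" using inner_span_zero[of l C l] l(1) Cf(2) by blast
  then show False using l(2) by simp
qed

lemma higgs_simps [simp]:
  "wt (higgs G H) = wt G" "idx (higgs G H) = {i \<in> idx G. wt G i \<in> H}" "chars (higgs G H) = chars G \<inter> H"
  by (auto simp: higgs_def)

lemma basis_count_higgs:
  assumes H: "subspace H" and spE: "span (chars G \<inter> E) = E"
  shows "basis_count (wt G) {i\<in>idx G. wt G i \<in> E} (basis_of H) E (\<lambda>J. w \<in> fcone (wt G) (J \<union> idx_in G H)) =
    point_count (higgs G E) H w"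
proof (cases "H \<subseteq> E")
  case True
  then have "idx_in (higgs G E) H = idx_in G H" by (auto simp: idx_in_def)
  then show ?thesis by (simp add: point_count_def spE)
next
  case False
  then have "bases (wt G) {i\<in>idx G. wt G i \<in> E} (basis_of H) E = {}" using bases_nonempty_imp[OF H] by metis
  then show ?thesis by (simp add: point_count_def spE basis_count_def)
qed

text \<open>
  The numerical shadow of the semi-orthogonal decomposition of a wall-crossing. Both phases are
  those of points near a generic point of the wall, or the points beyond the wall are outside the
  support of the fan. In either case the difference is the jump of
  \<open>basis_count_jump\<close>. The length of the normal in it is the ratio of the two covolumes.
\<close>

theorem phase_count_crossing:
  assumes G: "spanning_git G" and cross: "wall_crossing G X W \<kappa> X'" and Z: "wall_phase G W Z"
    and H: "relevant G H"
  shows "phase_count G H X = phase_count G H X' + of_nat \<kappa> * phase_count (higgs G (span W)) H Z"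
proof -
  let ?q = "wt G" and ?N = "idx G" and ?V = "span (chars G)" and ?E = "span W" and ?M = "idx_in G H"
  have G': "is_lattice (chars G)" "finite ?N" "?q ` ?N \<subseteq> chars G" "span (?q ` ?N) = ?V"
    using G by (auto simp: spanning_git_def)
  obtain C l where C: "phase_of_chamber G C X" "wall G W" "W facet_of C" "wall_normal G W C l"
    "of_nat \<kappa> = det_wt G \<bullet> l" "phase_beyond G W l X'"
    using cross by (auto simp: wall_crossing_def)
  note hg = wall_normal_higgs[OF G C(2,4)]
  have chC: "chamber G C" using C(1) by (simp add: phase_of_chamber_def)
  have Wf: "W \<in> secondary_fan G" using C(2) by (simp add: wall_def)
  obtain \<theta>0 where cell: "\<theta>0 \<in> fcone ?q ?N" "W = fan_cell ?q ?N \<theta>0"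
    using Wf unfolding secondary_fan_cell by blast
  have dimN: "dim W + 1 = dim (?q ` ?N)" using C(2) G'(4) unfolding wall_def by (metis dim_span)
  have Wne: "W \<noteq> {}" using secondary_fan_cone(3)[OF G'(2) Wf] by blast
  obtain w where w: "w \<in> rel_interior W" "generic_in ?q ?N ?E w"
    using exists_generic_in_rel_interior[OF G'(2) secondary_fan_cone(1)[OF G'(2) Wf] Wne, of ?q] by blast
  have wW: "w \<in> W" using w(1) rel_interior_subset by blast
  have wE: "w \<in> ?E" using wW by (rule span_base)
  then have wV: "w \<in> ?V" using hg(3) by blast
  have wl: "w \<bullet> l = 0" using wE hg(3) by blast
  have only: "only_on_hyperplane ?q ?N ?V ?E w"
    unfolding only_on_hyperplane_def
  proof (intro conjI allI impI wE)
    fix J assume J: "J \<subseteq> ?N" "dim (?q ` J) + 1 = dim ?V" "w \<in> span (?q ` J)"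
    have "?E \<subseteq> span (?q ` J)" using w(2) J unfolding generic_in_def by blast
    moreover have "dim (span (?q ` J)) \<le> dim ?E" using J(2) C(2) by (simp add: wall_def)
    ultimately show "span (?q ` J) = ?E" by (metis subspace_dim_equal subspace_span)
  qed
  obtain \<theta> where \<theta>: "\<theta> \<in> rel_interior C" using C(1) by (auto simp: phase_of_chamber_def)
  note Cf = chamber_span[OF G chC]
  have \<theta>V: "\<theta> \<in> ?V" using \<theta> rel_interior_subset[of C] Cf(2) span_superset[of C] by blast
  have half: "\<forall>x\<in>C. 0 \<le> x \<bullet> l" using C(4) by (simp add: wall_normal_def)
  have \<theta>l: "0 < \<theta> \<bullet> l" by (rule rel_interior_chamber_normal_pos[OF G chC hg(1,2) half \<theta>])
  have wC: "w \<in> C" using C(3) wW facet_of_imp_subset by blast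
  define u where "u = \<theta> - w"
  have u: "u \<in> ?V" "0 < u \<bullet> l" using \<theta>V wV \<theta>l wl by (auto simp: u_def span_diff inner_diff_left)
  have near: "point_count G H (w + t *\<^sub>R u) = covol (chars G) * phase_count G H X" if "0 < t" "t < 1" for t
  proof -
    have "w + t *\<^sub>R u \<in> rel_interior C"
      unfolding u_def using that by (intro rel_interior_segment secondary_fan_cone(1)[OF G'(2) Cf(1)] wC \<theta>) auto
    then have "X = semistable G (w + t *\<^sub>R u)" by (rule phase_semistable[OF G'(2) C(1)])
    then show ?thesis using covol_pos[OF G'(1)] by (simp add: phase_count_semistable)
  qed
  \<comment> \<open>On the far side, points near the wall are in the next chamber, or outside the support when there is none.\<close>
  have "\<exists>u'. u' \<in> ?V \<and> u' \<bullet> l < 0 \<and>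
    (\<exists>s>0. \<forall>t. 0 < t \<and> t < s \<longrightarrow> point_count G H (w + t *\<^sub>R u') = covol (chars G) * phase_count G H X')"
  proof (cases "\<exists>C'. chamber_beyond G W l C'")
    case True
    then obtain C' where C': "chamber_beyond G W l C'" "phase_of_chamber G C' X'"
      using C(6) unfolding phase_beyond_def by blast
    have ch': "chamber G C'" "W facet_of C'" "\<forall>x\<in>C'. x \<bullet> l \<le> 0" using C'(1) by (auto simp: chamber_beyond_def)
    note Cf' = chamber_span[OF G ch'(1)]
    obtain \<theta>' where \<theta>': "\<theta>' \<in> rel_interior C'" using C'(2) by (auto simp: phase_of_chamber_def)
    have "0 < \<theta>' \<bullet> (- l)"
      by (rule rel_interior_chamber_normal_pos[OF G ch'(1) _ _ _ \<theta>']) (use hg(1,2) ch'(3) in \<open>auto simp: span_neg\<close>)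
    then have l': "(\<theta>' - w) \<bullet> l < 0" using wl by (simp add: inner_diff_left)
    have V': "\<theta>' - w \<in> ?V"
      using \<theta>' rel_interior_subset[of C'] Cf'(2) span_superset[of C'] wV by (intro span_diff) blast+
    have wC': "w \<in> C'" using ch'(2) wW facet_of_imp_subset by blast
    have "point_count G H (w + t *\<^sub>R (\<theta>' - w)) = covol (chars G) * phase_count G H X'" if "0 < t" "t < 1" for t
    proof -
      have "w + t *\<^sub>R (\<theta>' - w) \<in> rel_interior C'"
        using that by (intro rel_interior_segment secondary_fan_cone(1)[OF G'(2) Cf'(1)] wC' \<theta>') auto
      then have "X' = semistable G (w + t *\<^sub>R (\<theta>' - w))" by (rule phase_semistable[OF G'(2) C'(2)])
      then show ?thesis using covol_pos[OF G'(1)] by (simp add: phase_count_semistable)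
    qed
    then show ?thesis using l' V' by (intro exI[of _ "\<theta>' - w"] conjI exI[of _ 1]) auto
  next
    case False
    then have X': "X' = {}" using C(6) unfolding phase_beyond_def by blast
    have out: "w + t *\<^sub>R (- u) \<notin> fcone ?q ?N" if t: "0 < t" for t
    proof
      assume mem: "w + t *\<^sub>R (- u) \<in> fcone ?q ?N"
      have "\<exists>\<theta>\<in>fcone ?q ?N. dim (fan_cell ?q ?N \<theta>) = dim (?q ` ?N) \<and> W facet_of fan_cell ?q ?N \<theta> \<and>
          (\<forall>x\<in>fan_cell ?q ?N \<theta>. x \<bullet> l \<le> 0)"
      proof (rule chamber_beyond_exists[OF G'(2) cell dimN w _ _ _ t mem])
        show "span W = {x \<in> span (?q ` ?N). x \<bullet> l = 0}" using hg(3) G'(4) by simp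
      qed (use u G'(4) in \<open>auto simp: span_neg\<close>)
      then obtain \<theta> where "\<theta> \<in> fcone ?q ?N" "dim (fan_cell ?q ?N \<theta>) = dim (?q ` ?N)"
        "W facet_of fan_cell ?q ?N \<theta>" "\<forall>x\<in>fan_cell ?q ?N \<theta>. x \<bullet> l \<le> 0" by blast
      moreover have "dim (?q ` ?N) = dim (chars G)" using G'(4) by (metis dim_span)
      ultimately have "chamber_beyond G W l (fan_cell ?q ?N \<theta>)"
        unfolding chamber_beyond_def chamber_def secondary_fan_cell by auto
      then show False using False by blast
    qed
    have "point_count G H (w + t *\<^sub>R (- u)) = covol (chars G) * phase_count G H X'" if "0 < t" for t
    proof -
      have "w + t *\<^sub>R (- u) \<notin> fcone ?q (I \<union> ?M)" if "I \<in> bases ?q ?N (basis_of H) ?V" for I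
        using out[OF \<open>0 < t\<close>] that fcone_mono[of "I \<union> ?M" ?N ?q] by (auto simp: bases_def idx_in_def)
      then show ?thesis unfolding X' by (simp add: point_count_def basis_count_def)
    qed
    then show ?thesis using u by (intro exI[of _ "- u"] conjI exI[of _ 1]) (auto simp: span_neg)
  qed
  then obtain u' s where u': "u' \<in> ?V" "u' \<bullet> l < 0" "0 < s"
    "\<And>t. 0 < t \<and> t < s \<Longrightarrow> point_count G H (w + t *\<^sub>R u') = covol (chars G) * phase_count G H X'" by blast
  note rf = relevant_fcone[OF H]
  have qV: "?q ` ?N \<subseteq> ?V" using G'(3) span_superset[of "chars G"] by (rule subset_trans)
  obtain t where t: "point_count G H (w + t *\<^sub>R u) - point_count G H (w + t *\<^sub>R u') =
      ((\<Sum>i\<in>?N. ?q i) \<bullet> l / norm l) *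
      basis_count ?q {i\<in>?N. ?q i \<in> ?E} (basis_of H) ?E (\<lambda>J. w \<in> fcone ?q (J \<union> ?M))" "0 < t" "t < min 1 s"
    unfolding point_count_def
    by (rule eventually_at_right_0_ex[OF basis_count_jump[OF G'(2) rf(3,2) subspace_span hg(1,2,3) qV wV only u u'(1,2)], of "min 1 s"])
      (use u'(3) in auto)
  have "point_count (higgs G ?E) H w = covol (chars (higgs G ?E)) * phase_count (higgs G ?E) H Z"
    using covol_pos[of "chars (higgs G ?E)"] hg(4)
    unfolding wall_phase_semistable[OF G C(2,4) Z w(1)] phase_count_semistable by (simp add: spanning_git_def)
  then have "point_count (higgs G ?E) H w = covol (chars G) * norm l * phase_count (higgs G ?E) H Z"
    using hg(6) by simp
  moreover have "basis_count ?q {i\<in>?N. ?q i \<in> ?E} (basis_of H) ?E (\<lambda>J. w \<in> fcone ?q (J \<union> ?M)) =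
      point_count (higgs G ?E) H w"
    using hg(5) by (intro basis_count_higgs rf(1)) simp
  ultimately have "covol (chars G) * phase_count G H X - covol (chars G) * phase_count G H X' =
     (of_nat \<kappa> / norm l) * (covol (chars G) * norm l * phase_count (higgs G ?E) H Z)"
    using t near u'(4)[of t] C(5) by (simp add: det_wt_def)
  also have "\<dots> = covol (chars G) * (of_nat \<kappa> * phase_count (higgs G ?E) H Z)"
    using hg(2) by simp
  finally have "covol (chars G) * (phase_count G H X - phase_count G H X') =
     covol (chars G) * (of_nat \<kappa> * phase_count (higgs G ?E) H Z)" by (simp add: right_diff_distrib)
  then show ?thesis using covol_pos[OF G'(1)] by simp
qed

section \<open>Minimal phases\<close>

lemma eventually_at_from_right:
  fixes t :: real
  assumes "\<forall>\<^sub>F s in at_right 0. P (t + s)" "\<forall>\<^sub>F s in at_right 0. P (t - s)"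
  shows "\<forall>\<^sub>F s in at t. P s"
proof -
  obtain b where b: "0 < b" "\<And>s. 0 < s \<Longrightarrow> s < b \<Longrightarrow> P (t + s)"
    using assms(1) unfolding eventually_at_right_field by blast
  obtain c where c: "0 < c" "\<And>s. 0 < s \<Longrightarrow> s < c \<Longrightarrow> P (t - s)"
    using assms(2) unfolding eventually_at_right_field by blast
  have "P s" if "s \<noteq> t" "dist s t < min b c" for s
  proof (cases "t < s")
    case True then show ?thesis using b(2)[of "s - t"] that by (simp add: dist_real_def)
  next
    case False then show ?thesis using c(2)[of "t - s"] that by (simp add: dist_real_def)
  qed
  then show ?thesis unfolding eventually_at using b(1) c(1) by (intro exI[of _ "min b c"]) auto
qed

text \<open>
  The common value just before and just after a point is a locally constant function of the point.
\<close>

lemma constant_off_jumps: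
  fixes g :: "real \<Rightarrow> real"
  assumes ex: "\<And>t. t \<in> {0..1} \<Longrightarrow> \<exists>c. \<forall>\<^sub>F s in at t. g s = c"
    and "\<forall>\<^sub>F s in at 0. g s = g 0" "\<forall>\<^sub>F s in at 1. g s = g 1"
  shows "g 0 = g 1"
proof -
  have uniq: "c = c'" if "\<forall>\<^sub>F s in at t. g s = c" "\<forall>\<^sub>F s in at t. g s = c'" for t c c'
  proof -
    have "\<forall>\<^sub>F s in at t. c = c'" using that by eventually_elim simp
    then show ?thesis by (simp add: eventually_const_iff)
  qed
  define h where "h t = (SOME c. \<forall>\<^sub>F s in at t. g s = c)" for t
  have h: "\<forall>\<^sub>F s in at t. g s = h t" if "t \<in> {0..1}" for t
    unfolding h_def by (rule someI_ex[OF ex[OF that]])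
  have "h 0 = h 1"
  proof (rule connected_local_const[of "{0..1::real}" 0 1 h])
    show "\<forall>a\<in>{0..1}. \<forall>\<^sub>F b in at a within {0..1}. h a = h b"
    proof
      fix a :: real assume a: "a \<in> {0..1}"
      obtain d where d: "0 < d" "\<And>s. s \<noteq> a \<Longrightarrow> dist s a < d \<Longrightarrow> g s = h a"
        using h[OF a] unfolding eventually_at by blast
      have "h a = h b" if b: "b \<in> {0..1}" "b \<noteq> a" "dist b a < d" for b
      proof -
        have "open (ball a d - {a})" by (intro open_Diff open_ball) simp
        moreover have "b \<in> ball a d - {a}" using b by (simp add: dist_commute)
        moreover have "g s = h a" if "s \<in> ball a d - {a}" for s using that d(2)[of s] by (simp add: dist_commute)
        ultimately have "\<forall>\<^sub>F s in at b. g s = h a" unfolding eventually_at_topological by blast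
        then show ?thesis using uniq h[OF b(1)] by blast
      qed
      then show "\<forall>\<^sub>F b in at a within {0..1}. h a = h b"
        unfolding eventually_at using d(1) by (intro exI[of _ d]) auto
    qed
  qed auto
  moreover have "h 0 = g 0" using uniq[OF h assms(2)] by simp
  moreover have "h 1 = g 1" using uniq[OF h assms(3)] by simp
  ultimately show ?thesis by simp
qed

lemma subspace_normal:
  fixes V :: "'a::euclidean_space set"
  assumes "subspace V" "subspace A" "A \<subseteq> V" "dim A + 1 = dim V"
  obtains l where "l \<in> V" "l \<noteq> 0" "A = {x\<in>V. x \<bullet> l = 0}"
proof -
  have "A \<noteq> V" using assms(4) by auto
  then obtain x where x: "x \<in> V" "x \<notin> A" using assms(3) by blast
  have sA: "span A = A" using assms(2) by (rule span_eq_iff[THEN iffD2])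
  obtain y z where yz: "y \<in> span A" "\<And>w. w \<in> span A \<Longrightarrow> z \<bullet> w = 0" "x = y + z"
    using span_decomposition[of A x] by metis
  have y: "y \<in> A" using yz(1) sA by simp
  have "x - y \<in> V" using x(1) y assms(3) by (intro subspace_diff[OF assms(1)]) auto
  then have zV: "z \<in> V" using yz(3) by simp
  have z0: "z \<noteq> 0" using yz(3) y x(2) by auto
  have "\<forall>x\<in>A. x \<bullet> z = 0" using yz(2) sA by (simp add: inner_commute)
  then show thesis using that[OF zV z0] hyperplane_eq[OF assms zV z0] by blast
qed

text \<open>
  A convex set containing \<open>p\<close> is star-shaped around \<open>p\<close>, so that its part near \<open>p\<close> spans
  no less than the whole set.
\<close>

lemma chamber_part_spans:
  fixes C :: "'a::euclidean_space set"
  assumes "convex C" "rel_interior C \<noteq> {}" "p \<in> C" "0 < \<delta>" "subspace A" "rel_interior C \<inter> ball p \<delta> \<subseteq> A"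
  shows "span C \<subseteq> A"
proof -
  have "x \<in> A" if x: "x \<in> rel_interior C" for x
  proof -
    have "((\<lambda>t. p + t *\<^sub>R (x - p)) \<longlongrightarrow> p + 0 *\<^sub>R (x - p)) (at_right 0)" by (intro tendsto_intros)
    then have "\<forall>\<^sub>F t in at_right 0. p + t *\<^sub>R (x - p) \<in> ball p \<delta>"
      by (rule topological_tendstoD) (use assms(4) in auto)
    then obtain s where s: "p + s *\<^sub>R (x - p) \<in> ball p \<delta>" "0 < s" "s < 1"
      by (rule eventually_at_right_0_ex[of _ 1]) simp_all
    have "0 \<le> s * norm (x - p)" "s * norm (x - p) < \<delta>" using s(1,2) by (auto simp: dist_norm)
    then have "s * norm (x - p) / 2 < \<delta>" by linarith
    then have s2: "p + (s / 2) *\<^sub>R (x - p) \<in> ball p \<delta>" using s(2) by (simp add: dist_norm)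
    have "p + s *\<^sub>R (x - p) \<in> rel_interior C" "p + (s / 2) *\<^sub>R (x - p) \<in> rel_interior C"
      using s by (auto intro!: rel_interior_segment[OF assms(1,3) x])
    then have A: "p + s *\<^sub>R (x - p) \<in> A" "p + (s / 2) *\<^sub>R (x - p) \<in> A" using s(1) s2 assms(6) by blast+
    have "(2 / s) *\<^sub>R ((p + s *\<^sub>R (x - p)) - (p + (s / 2) *\<^sub>R (x - p))) \<in> A"
      using A by (intro subspace_scale[OF assms(5)] subspace_diff[OF assms(5)])
    moreover have "(2 / s) *\<^sub>R ((p + s *\<^sub>R (x - p)) - (p + (s / 2) *\<^sub>R (x - p))) = x - p"
      using s(2) by (simp flip: scaleR_diff_left)
    ultimately have xp: "x - p \<in> A" by simp
    have "p + s *\<^sub>R (x - p) - s *\<^sub>R (x - p) \<in> A"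
      by (rule subspace_diff[OF assms(5) A(1) subspace_scale[OF assms(5) xp]])
    then have "x - p + p \<in> A" using xp subspace_add[OF assms(5)] by (metis add_diff_cancel_right')
    then show ?thesis by simp
  qed
  then have "C \<subseteq> A" using assms(5) by (intro rel_interior_subset_closed[OF assms(1)] closed_subspace) auto
  then show ?thesis using assms(5) by (rule span_minimal)
qed

text \<open>
  Join interior points of the two chambers close to \<open>p\<close>, the negative of the determinant, by a
  segment in general position. It crosses the hyperplanes spanned by weights one at a time, and only
  those that contain \<open>p\<close>. For such a hyperplane the determinant pairs to \<open>0\<close> with the
  normal, so that there is no jump.
\<close>

theorem phase_count_minimal_unique:
  assumes G: "spanning_git G" and H: "relevant G H"
    and C1: "phase_of_chamber G C1 X1" "- det_wt G \<in> C1"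
    and C2: "phase_of_chamber G C2 X2" "- det_wt G \<in> C2"
  shows "phase_count G H X1 = phase_count G H X2"
proof -
  let ?q = "wt G" and ?N = "idx G" and ?V = "span (chars G)" and ?M = "idx_in G H"
  define p where "p = - det_wt G"
  have G': "is_lattice (chars G)" "finite ?N" "?q ` ?N \<subseteq> chars G" "span (?q ` ?N) = ?V"
    using G by (auto simp: spanning_git_def)
  note rf = relevant_fcone[OF H]
  have qV: "?q ` ?N \<subseteq> ?V" using G'(3) span_superset[of "chars G"] by (rule subset_trans)
  define \<A> where "\<A> = {span (?q ` J) | J. J \<subseteq> ?N \<and> dim (?q ` J) + 1 = dim ?V}"
  have fin\<A>: "finite \<A>"
    by (rule finite_subset[of _ "(\<lambda>J. span (?q ` J)) ` Pow ?N"]) (use G'(2) in \<open>auto simp: \<A>_def\<close>)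
  have \<A>: "subspace A" "A \<subseteq> ?V" "dim A + 1 = dim ?V" if A: "A \<in> \<A>" for A
  proof -
    obtain J where J: "A = span (?q ` J)" "J \<subseteq> ?N" "dim (?q ` J) + 1 = dim ?V"
      using A unfolding \<A>_def by blast
    show "subspace A" "dim A + 1 = dim ?V" using J by auto
    have "?q ` J \<subseteq> ?V" using J(2) qV by blast
    then show "A \<subseteq> ?V" unfolding J(1) by (intro span_minimal) auto
  qed
  \<comment> \<open>near \<open>p\<close> only the hyperplanes through \<open>p\<close> are met\<close>
  obtain \<delta> where \<delta>: "0 < \<delta>" "\<And>A. A \<in> \<A> \<Longrightarrow> ball p \<delta> \<inter> A \<noteq> {} \<Longrightarrow> p \<in> A"
  proof -
    have "open (- (\<Union>{A \<in> \<A>. p \<notin> A}))"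
      using fin\<A> \<A>(1) by (intro open_Compl closed_Union) (auto intro: closed_subspace)
    then obtain \<delta> where "0 < \<delta>" "ball p \<delta> \<subseteq> - (\<Union>{A \<in> \<A>. p \<notin> A})"
      unfolding open_contains_ball by blast
    then show thesis using that[of \<delta>] by blast
  qed
  have avoid: "\<exists>x\<in>rel_interior C \<inter> ball p \<delta>. \<forall>A\<in>\<B>. x \<notin> A"
    if C: "phase_of_chamber G C X" "p \<in> C" and \<B>: "finite \<B>" "\<And>A. A \<in> \<B> \<Longrightarrow> subspace A \<and> \<not> ?V \<subseteq> A" for C X \<B>
  proof -
    have ch: "chamber G C" using C(1) by (simp add: phase_of_chamber_def)
    note Cf = chamber_span[OF G ch]
    note cv = secondary_fan_cone(1)[OF G'(2) Cf(1)]
    have ne: "rel_interior C \<noteq> {}" using rel_interior_eq_empty[OF cv] C(2) by blast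
    have no: "\<not> rel_interior C \<inter> ball p \<delta> \<subseteq> A" if "subspace A" "\<not> ?V \<subseteq> A" for A
      using chamber_part_spans[OF cv ne C(2) \<delta>(1) that(1)] that(2) Cf(2) by blast
    have ne': "rel_interior C \<inter> ball p \<delta> \<noteq> {}"
    proof -
      have "p \<in> closure (rel_interior C)"
        using convex_closure_rel_interior[OF cv] C(2) closure_subset[of C] by blast
      then obtain y where "y \<in> rel_interior C" "dist y p < \<delta>" unfolding closure_approachable using \<delta>(1) by blast
      then show ?thesis by (auto simp: dist_commute)
    qed
    show ?thesis
      using \<B> no by (intro convex_avoid_subspaces convex_Int convex_rel_interior[OF cv] ne' convex_ball) auto
  qed
  have \<A>V: "\<not> ?V \<subseteq> A" if "A \<in> \<A>" for A using \<A>[OF that] dim_subset[of ?V A] by force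
  obtain \<theta>1 where \<theta>1: "\<theta>1 \<in> rel_interior C1" "\<theta>1 \<in> ball p \<delta>" "\<And>A. A \<in> \<A> \<Longrightarrow> \<theta>1 \<notin> A"
    using avoid[OF C1(1) _ fin\<A>] C1(2) \<A>(1) \<A>V unfolding p_def by blast
  \<comment> \<open>keep the segment away from the intersections of two hyperplanes\<close>
  define \<B> where "\<B> = {span (insert \<theta>1 (A \<inter> B)) | A B. A \<in> \<A> \<and> B \<in> \<A> \<and> A \<noteq> B}"
  have fin\<B>: "finite \<B>"
    by (rule finite_subset[of _ "(\<lambda>(A, B). span (insert \<theta>1 (A \<inter> B))) ` (\<A> \<times> \<A>)"])
      (use fin\<A> in \<open>auto simp: \<B>_def\<close>)
  have \<B>: "subspace D \<and> \<not> ?V \<subseteq> D" if D: "D \<in> \<B>" for D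
  proof -
    obtain A B where AB: "D = span (insert \<theta>1 (A \<inter> B))" "A \<in> \<A>" "B \<in> \<A>" "A \<noteq> B"
      using D unfolding \<B>_def by blast
    have sub: "subspace (A \<inter> B)" using \<A>(1)[OF AB(2)] \<A>(1)[OF AB(3)] by (rule subspace_inter)
    have "A \<inter> B \<noteq> A"
    proof
      assume "A \<inter> B = A"
      then have "A = B" using \<A>[OF AB(2)] \<A>[OF AB(3)] by (intro subspace_dim_equal) auto
      then show False using AB(4) by blast
    qed
    then have "span (A \<inter> B) \<subset> span A" using sub \<A>(1)[OF AB(2)] by (metis Int_lower1 psubsetI span_eq_iff)
    then have "dim (A \<inter> B) < dim A" by (rule dim_psubset)
    then have "dim D < dim ?V" using \<A>(3)[OF AB(2)] by (simp add: AB(1) dim_insert)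
    then show ?thesis using AB(1) dim_subset[of ?V D] by force
  qed
  obtain \<theta>2 where \<theta>2: "\<theta>2 \<in> rel_interior C2" "\<theta>2 \<in> ball p \<delta>" "\<And>A. A \<in> \<A> \<union> \<B> \<Longrightarrow> \<theta>2 \<notin> A"
  proof -
    have "\<exists>x\<in>rel_interior C2 \<inter> ball p \<delta>. \<forall>A\<in>\<A> \<union> \<B>. x \<notin> A"
      by (rule avoid[OF C2(1)]) (use C2(2) \<A>(1) \<A>V \<B> fin\<A> fin\<B> in \<open>auto simp: p_def\<close>)
    then show thesis using that by blast
  qed
  define u where "u = \<theta>2 - \<theta>1"
  define v where "v t = \<theta>1 + t *\<^sub>R u" for t
  define g where "g t = point_count G H (v t)" for t
  have inV: "\<theta> \<in> ?V" if "phase_of_chamber G C X" "\<theta> \<in> rel_interior C" for C X \<theta>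
    using chamber_span(2)[OF G] that rel_interior_subset[of C] span_superset[of C]
    unfolding phase_of_chamber_def by blast
  have uV: "u \<in> ?V" "- u \<in> ?V" "v t \<in> ?V" for t
    using inV[OF C1(1) \<theta>1(1)] inV[OF C2(1) \<theta>2(1)]
    by (auto simp: u_def v_def intro: span_add span_diff span_scale)
  have vadd: "v (t + s) = v t + s *\<^sub>R u" "v (t - s) = v t + s *\<^sub>R (- u)" for t s
    by (simp_all add: v_def algebra_simps)
  have generic: "\<forall>\<^sub>F s in at t. g s = g t" if "\<And>A. A \<in> \<A> \<Longrightarrow> v t \<notin> A" for t
  proof (rule eventually_at_from_right)
    have no: "on_no_hyperplane ?q ?N ?V (v t)"
      unfolding on_no_hyperplane_def using that by (auto simp: \<A>_def)
    show "\<forall>\<^sub>F s in at_right 0. g (t + s) = g t" "\<forall>\<^sub>F s in at_right 0. g (t - s) = g t"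
      unfolding g_def point_count_def vadd
      by (intro basis_count_generic[OF G'(2) rf(3,2) uV(3) _ subspace_span no] uV)+
  qed
  have "g 0 = g 1"
  proof (rule constant_off_jumps)
    show "\<forall>\<^sub>F s in at 0. g s = g 0" using \<theta>1(3) by (intro generic) (simp add: v_def)
    show "\<forall>\<^sub>F s in at 1. g s = g 1" using \<theta>2(3) by (intro generic) (simp add: v_def u_def)
    fix t :: real assume t: "t \<in> {0..1}"
    show "\<exists>c. \<forall>\<^sub>F s in at t. g s = c"
    proof (cases "\<exists>A\<in>\<A>. v t \<in> A")
      case False then show ?thesis using generic by blast
    next
      case True
      then obtain A where A: "A \<in> \<A>" "v t \<in> A" by blast
      have t0: "t \<noteq> 0" using \<theta>1(3)[OF A(1)] A(2) by (auto simp: v_def)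
      have "(1 - t) *\<^sub>R \<theta>1 + t *\<^sub>R \<theta>2 \<in> ball p \<delta>"
        using t \<theta>1(2) \<theta>2(2) by (intro convexD[OF convex_ball]) auto
      then have "v t \<in> ball p \<delta>" by (simp add: v_def u_def algebra_simps)
      then have pA: "p \<in> A" using \<delta>(2)[OF A(1)] A(2) by blast
      obtain l where l: "l \<in> ?V" "l \<noteq> 0" "A = {x\<in>?V. x \<bullet> l = 0}"
        by (rule subspace_normal[OF subspace_span \<A>[OF A(1)]])
      have det: "(\<Sum>i\<in>?N. ?q i) \<bullet> l = 0" using pA unfolding l(3) by (simp add: p_def det_wt_def)
      have ul: "u \<bullet> l \<noteq> 0"
      proof
        assume "u \<bullet> l = 0"
        then have "\<theta>1 \<in> A" using A(2) inV[OF C1(1) \<theta>1(1)] unfolding l(3) v_def by (simp add: inner_add_left)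
        then show False using \<theta>1(3)[OF A(1)] by blast
      qed
      have only: "only_on_hyperplane ?q ?N ?V A (v t)"
        unfolding only_on_hyperplane_def
      proof (intro conjI allI impI A(2))
        fix J assume J: "J \<subseteq> ?N" "dim (?q ` J) + 1 = dim ?V" "v t \<in> span (?q ` J)"
        define B where "B = span (?q ` J)"
        have B: "B \<in> \<A>" "v t \<in> B" using J unfolding \<A>_def B_def by blast+
        have "B = A"
        proof (rule ccontr)
          assume "B \<noteq> A"
          then have D: "span (insert \<theta>1 (A \<inter> B)) \<in> \<B>" using A(1) B(1) unfolding \<B>_def by blast
          have "v t \<in> span (insert \<theta>1 (A \<inter> B))" "\<theta>1 \<in> span (insert \<theta>1 (A \<inter> B))"
            using A(2) B(2) by (auto intro: span_base)
          then have "\<theta>1 + (1 / t) *\<^sub>R (v t - \<theta>1) \<in> span (insert \<theta>1 (A \<inter> B))"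
            by (intro span_add span_scale span_diff)
          moreover have "\<theta>1 + (1 / t) *\<^sub>R (v t - \<theta>1) = \<theta>2" using t0 by (simp add: v_def u_def)
          ultimately show False using \<theta>2(3) D by auto
        qed
        then show "span (?q ` J) = A" by (simp add: B_def)
      qed
      obtain c where c: "\<forall>\<^sub>F s in at_right 0. g (t + s) = c"
        using basis_count_eventually[OF G'(2) rf(2) uV(3) uV(1) subspace_span] unfolding g_def point_count_def vadd by blast
      have "\<forall>\<^sub>F s in at_right 0. g (t - s) = g (t + s)"
      proof (cases "0 < u \<bullet> l")
        case True
        have neg: "- u \<bullet> l < 0" using True by simp
        show ?thesis
          using basis_count_jump[OF G'(2) rf(3,2) subspace_span l qV uV(3) only uV(1) True uV(2) neg]
          unfolding g_def point_count_def vadd by (rule eventually_mono) (simp add: det)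
      next
        case False
        then have pos: "0 < - u \<bullet> l" and neg: "u \<bullet> l < 0" using ul by auto
        show ?thesis
          using basis_count_jump[OF G'(2) rf(3,2) subspace_span l qV uV(3) only uV(2) pos uV(1) neg]
          unfolding g_def point_count_def vadd by (rule eventually_mono) (simp add: det)
      qed
      then have "\<forall>\<^sub>F s in at_right 0. g (t - s) = c" using c by eventually_elim simp
      then show ?thesis using eventually_at_from_right[where P = "\<lambda>s. g s = c", OF c] by blast
    qed
  qed
  moreover have "X1 = semistable G (v 0)" "X2 = semistable G (v 1)"
    using phase_semistable[OF G'(2) C1(1) \<theta>1(1)] phase_semistable[OF G'(2) C2(1) \<theta>2(1)] by (auto simp: v_def u_def)
  ultimately show ?thesis by (simp add: phase_count_semistable g_def)
qed

section \<open>Decompositions\<close>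

lemma higgs_higgs: "B \<subseteq> A \<Longrightarrow> higgs (higgs G A) B = higgs G B"
  by (auto simp: higgs_def)

lemma higgs_span_chars:
  fixes G :: "('i, 'a::euclidean_space) git"
  assumes "spanning_git G"
  shows "higgs G (span (chars G)) = G"
proof -
  have "wt G ` idx G \<subseteq> span (chars G)"
    using assms span_superset[of "chars G"] by (auto simp: spanning_git_def)
  then show ?thesis using span_superset[of "chars G"] by (auto simp: higgs_def intro!: git.equality)
qed

lemma relevant_higgs_iff:
  assumes "subspace E" "span (chars G \<inter> E) = E" "E \<subseteq> span (chars G)"
  shows "relevant (higgs G E) H \<longleftrightarrow> relevant G H \<and> H \<subseteq> E"
proof -
  have "{i \<in> {i \<in> idx G. wt G i \<in> E}. wt G i \<in> H} = {i \<in> idx G. wt G i \<in> H}" if "H \<subseteq> E" using that by auto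
  then show ?thesis using assms by (auto simp: relevant_def wcone_def)
qed

definition minimal_phase :: "('i, 'a::euclidean_space) git \<Rightarrow> ('i \<Rightarrow> complex) set \<Rightarrow> bool" where
  "minimal_phase G X \<longleftrightarrow> spanning_git G \<and> (\<exists>C. phase_of_chamber G C X \<and> - det_wt G \<in> C)"

text \<open>
  If the negative of the sum of the weights lies in their cone, then so does the negative of each
  weight, and the cone is a linear subspace.
\<close>

lemma minimal_phase_relevant:
  assumes "minimal_phase G X"
  shows "relevant G (span (chars G))"
proof -
  have G: "spanning_git G" using assms by (simp add: minimal_phase_def)
  have fin: "finite (idx G)" and sp: "span (wt G ` idx G) = span (chars G)" "wt G ` idx G \<subseteq> chars G"
    using G by (auto simp: spanning_git_def)
  obtain C where C: "phase_of_chamber G C X" "- det_wt G \<in> C" using assms by (auto simp: minimal_phase_def)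
  have "C \<in> secondary_fan G" using C(1) by (simp add: phase_of_chamber_def chamber_def)
  then have d: "- det_wt G \<in> fcone (wt G) (idx G)" using secondary_fan_cone(4)[OF fin] C(2) by blast
  let ?K = "fcone (wt G) (idx G)"
  have neg: "- wt G j \<in> ?K" if j: "j \<in> idx G" for j
  proof -
    have "(\<Sum>i\<in>idx G - {j}. 1 *\<^sub>R wt G i) \<in> fcone (wt G) (idx G - {j})" using fin by (intro fconeI) auto
    then have "(\<Sum>i\<in>idx G - {j}. wt G i) \<in> ?K" using fcone_mono[of "idx G - {j}" "idx G" "wt G"] by auto
    then have "- det_wt G + (\<Sum>i\<in>idx G - {j}. wt G i) \<in> ?K" by (rule convex_cone_hull_add[OF d])
    then show ?thesis using fin j by (simp add: det_wt_def sum.remove)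
  qed
  have "span (wt G ` idx G) \<subseteq> ?K"
  proof
    fix x assume "x \<in> span (wt G ` idx G)"
    then show "x \<in> ?K"
    proof (induction rule: span_induct_alt)
      case base then show ?case by (rule convex_cone_hull_contains_0)
    next
      case (step c x y)
      then obtain j where j: "j \<in> idx G" "x = wt G j" by blast
      have "c *\<^sub>R x \<in> ?K"
      proof (cases "0 \<le> c")
        case True then show ?thesis using j by (intro convex_cone_hull_mul hull_inc) auto
      next
        case False
        then have "(- c) *\<^sub>R (- x) \<in> ?K" using neg[OF j(1)] j(2) by (intro convex_cone_hull_mul) auto
        then show ?thesis by simp
      qed
      then show ?case using step.IH by (intro convex_cone_hull_add)
    qed
  qed
  then have "?K = span (chars G)" using sp(1) fcone_subset_span[of "wt G" "idx G"] by blast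
  moreover have "{i \<in> idx G. wt G i \<in> span (chars G)} = idx G" using sp(2) span_superset[of "chars G"] by auto
  ultimately show ?thesis by (simp add: relevant_def wcone_def)
qed

text \<open>
  A factor is a phase whose chamber contains the negative of the determinant, so that the cone of
  the weights of its problem is a linear subspace. Inside the span of a wall, being relevant means
  the same for the problem and for the Higgs GIT problem of the wall.
\<close>

lemma decomposition_factors:
  assumes "decomposition G X fs" "spanning_git G" "f \<in> set fs"
  shows "\<exists>H'. relevant G H' \<and> fst f = higgs G H' \<and> minimal_phase (fst f) (snd f)"
  using assms
proof (induction arbitrary: f rule: decomposition.induct)
  case (minimal G C X)
  have m: "minimal_phase G X" using minimal by (auto simp: minimal_phase_def)
  then show ?case using minimal_phase_relevant[OF m] higgs_span_chars[OF minimal.prems(1)] minimal.prems(2)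
    by (intro exI[of _ "span (chars G)"]) simp
next
  case (minimal_empty G)
  then show ?case by simp
next
  case (crossing G X W \<kappa> X' fs Z gss)
  show ?case
  proof (cases "f \<in> set fs")
    case True then show ?thesis using crossing by blast
  next
    case False
    then obtain gs where gs: "gs \<in> set gss" "f \<in> set gs" using crossing.prems(2) by auto
    obtain C l where C: "wall G W" "wall_normal G W C l"
      using crossing.hyps(1) by (auto simp: wall_crossing_def)
    note hg = wall_normal_higgs[OF crossing.prems(1) C]
    have "\<exists>H'. relevant (higgs G (span W)) H' \<and> fst f = higgs (higgs G (span W)) H' \<and> minimal_phase (fst f) (snd f)"
      using crossing.IH(2) gs hg(4) by blast
    then obtain H' where H': "relevant (higgs G (span W)) H'" "fst f = higgs (higgs G (span W)) H'"
      "minimal_phase (fst f) (snd f)" by blast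
    have EV: "span W \<subseteq> span (chars G)" using hg(3) by blast
    have "relevant G H' \<and> H' \<subseteq> span W"
      using H'(1) relevant_higgs_iff[OF subspace_span _ EV] hg(5) by simp
    then show ?thesis using H'(2,3) higgs_higgs by metis
  qed
qed

lemma span_chars_higgs_relevant:
  assumes "spanning_git G" "relevant G H'"
  shows "span (chars (higgs G H')) = H'"
proof -
  have "H' = fcone (wt G) (idx_in G H')" using assms(2) by (simp add: relevant_def wcone_def idx_in_def)
  also have "\<dots> \<subseteq> span (wt G ` idx_in G H')" by (rule fcone_subset_span)
  also have "\<dots> \<subseteq> span (chars G \<inter> H')" using assms(1) by (intro span_mono) (auto simp: spanning_git_def idx_in_def)
  finally have "H' \<subseteq> span (chars G \<inter> H')" .
  moreover have "span (chars G \<inter> H') \<subseteq> H'" using assms(2) by (intro span_minimal) (auto simp: relevant_def)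
  ultimately show ?thesis by simp
qed

definition total_count :: "'a::euclidean_space set \<Rightarrow> (('i, 'a) git \<times> ('i \<Rightarrow> complex) set) list \<Rightarrow> real" where
  "total_count H fs = (\<Sum>f\<leftarrow>fs. phase_count (fst f) H (snd f))"

text \<open>
  The algorithm only redistributes the invariants. The second alternative of the last assumption
  is what the recursion produces when \<open>H\<close> is not contained in the span of the wall; then all
  terms vanish.
\<close>

theorem total_count_decomposition:
  assumes "decomposition G X fs" "spanning_git G" "subspace H" "relevant G H \<or> \<not> H \<subseteq> span (chars G)"
  shows "total_count H fs = phase_count G H X"
  using assms
proof (induction rule: decomposition.induct)
  case (minimal G C X)
  then show ?case by (simp add: total_count_def)
next
  case (minimal_empty G)
  then show ?case by (simp add: total_count_def)
next
  case (crossing G X W \<kappa> X' fs Z gss)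
  let ?E = "span W"
  obtain C l where C: "wall G W" "wall_normal G W C l"
    using crossing.hyps(1) by (auto simp: wall_crossing_def)
  note hg = wall_normal_higgs[OF crossing.prems(1) C]
  have EV: "?E \<subseteq> span (chars G)" using hg(3) by blast
  have rel: "relevant (higgs G ?E) H \<or> \<not> H \<subseteq> span (chars (higgs G ?E))"
    using crossing.prems(3) hg(5) EV relevant_higgs_iff[OF subspace_span _ EV] by auto
  have each: "total_count H gs = phase_count (higgs G ?E) H Z" if "gs \<in> set gss" for gs
    using crossing.IH(2) that hg(4) crossing.prems(2) rel by blast
  have "total_count H (concat gss) = (\<Sum>gs\<leftarrow>gss. total_count H gs)"
    by (induction gss) (simp_all add: total_count_def)
  also have "\<dots> = (\<Sum>gs\<leftarrow>gss. phase_count (higgs G ?E) H Z)"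
    using each by (intro arg_cong[where f = sum_list] map_cong) auto
  also have "\<dots> = of_nat \<kappa> * phase_count (higgs G ?E) H Z"
    using crossing.hyps(5) by (simp add: sum_list_triv)
  finally have copies: "total_count H (concat gss) = of_nat \<kappa> * phase_count (higgs G ?E) H Z" .
  have first: "total_count H fs = phase_count G H X'" by (rule crossing.IH(1)[OF crossing.prems])
  have "total_count H (fs @ concat gss) = phase_count G H X' + of_nat \<kappa> * phase_count (higgs G ?E) H Z"
    using first copies by (simp add: total_count_def)
  also have "\<dots> = phase_count G H X"
  proof (cases "relevant G H")
    case True
    then show ?thesis using phase_count_crossing[OF crossing.prems(1) crossing.hyps(1,4)] by simp
  next
    case False
    then have "\<not> H \<subseteq> span (chars G)" using crossing.prems(3) by blast
    moreover from this have "\<not> H \<subseteq> span (chars (higgs G ?E))" using EV hg(5) by blast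
    ultimately show ?thesis using crossing.prems(2) by (simp add: phase_count_not_subset)
  qed
  finally show ?case .
qed

text \<open>
  The diagonal entries of the triangular system: only the empty set of weights completes a basis
  of the whole space.
\<close>

lemma phase_count_top_pos:
  assumes "minimal_phase G X"
  shows "0 < phase_count G (span (chars G)) X"
proof -
  let ?H = "span (chars G)"
  have G: "spanning_git G" using assms by (simp add: minimal_phase_def)
  have fin: "finite (idx G)" and lat: "is_lattice (chars G)" and sub: "wt G ` idx G \<subseteq> chars G"
    using G by (auto simp: spanning_git_def)
  obtain C where C: "phase_of_chamber G C X" using assms by (auto simp: minimal_phase_def)
  then obtain \<theta> where \<theta>: "\<theta> \<in> rel_interior C" "X = semistable G \<theta>" by (auto simp: phase_of_chamber_def)
  have "C \<in> secondary_fan G" using C by (simp add: phase_of_chamber_def chamber_def)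
  then have \<theta>K: "\<theta> \<in> fcone (wt G) (idx G)" using secondary_fan_cone(4)[OF fin] \<theta>(1) rel_interior_subset[of C] by blast
  have top: "idx_in G ?H = idx G" using sub span_superset[of "chars G"] by (auto simp: idx_in_def)
  note K = basis_of_subspace[OF subspace_span[of "chars G"]]
  have "bases (wt G) (idx G) (basis_of ?H) ?H = {{}}"
  proof -
    have "I = {}" if I: "I \<in> bases (wt G) (idx G) (basis_of ?H) ?H" for I
    proof -
      have "basis_of ?H \<union> wt G ` I = basis_of ?H"
        by (rule spanning_subset_independent)
          (use I K span_superset[of "basis_of ?H \<union> wt G ` I"] in \<open>auto simp: bases_def\<close>)
      then show ?thesis using I by (auto simp: bases_def)
    qed
    moreover have "{} \<in> bases (wt G) (idx G) (basis_of ?H) ?H" using K by (simp add: bases_def)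
    ultimately show ?thesis by blast
  qed
  then have "point_count G ?H \<theta> = parallelotope_vol (basis_of ?H)"
    using \<theta>K top by (simp add: point_count_def basis_count_def)
  then show ?thesis unfolding \<theta>(2) phase_count_semistable using parallelotope_vol_pos[OF K(1)] covol_pos[OF lat] by simp
qed

lemma sum_list_map_eq_sum_count_mset:
  fixes f :: "'b \<Rightarrow> real"
  assumes "finite S" "set xs \<subseteq> S"
  shows "(\<Sum>x\<leftarrow>xs. f x) = (\<Sum>x\<in>S. of_nat (count (mset xs) x) * f x)"
  using assms(2)
proof (induction xs)
  case Nil then show ?case by simp
next
  case (Cons a xs)
  have "(\<Sum>x\<in>S. of_nat (count (mset (a # xs)) x) * f x) =
      (\<Sum>x\<in>S. of_nat (count (mset xs) x) * f x + (if x = a then f x else 0))"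
    by (intro sum.cong) (auto simp: distrib_right)
  also have "\<dots> = (\<Sum>x\<in>S. of_nat (count (mset xs) x) * f x) + f a"
    using Cons.prems assms(1) by (simp add: sum.distrib)
  finally show ?case using Cons by simp
qed

theorem theorem1:
  fixes G :: "('i, 'a::euclidean_space) git"
    and X :: "('i \<Rightarrow> complex) set"
    and H :: "'a set"
    and fs fs' :: "(('i, 'a) git \<times> ('i \<Rightarrow> complex) set) list"
  assumes "git_problem G"
    and "phase G X"
    and "relevant G H"
    and "decomposition G X fs"
    and "decomposition G X fs'"
  shows "factor_multiplicity G H fs = factor_multiplicity G H fs' \<and>
         mset (map fst fs) = mset (map fst fs')"
proof -
  note G = git_problem_spanning[OF assms(1)]
  let ?m = "mset (map fst fs)" and ?m' = "mset (map fst fs')"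
  let ?S = "fst ` (set fs \<union> set fs')"
  \<comment> \<open>The value depends on the factor only through its problem, not on the choice of a minimal phase.\<close>
  define \<mu> where "\<mu> H G' = phase_count G' H (SOME Z. minimal_phase G' Z)" for H :: "'a set" and G' :: "('i, 'a) git"
  have factor: "\<exists>H'. relevant G H' \<and> fst f = higgs G H' \<and> minimal_phase (fst f) (snd f)"
    if "f \<in> set fs \<union> set fs'" for f
    using that decomposition_factors[OF assms(4) G] decomposition_factors[OF assms(5) G] by blast
  have relS: "\<exists>H'. relevant G H' \<and> G' = higgs G H' \<and> minimal_phase G' (SOME Z. minimal_phase G' Z)"
    if "G' \<in> ?S" for G'
    using that factor someI[of "minimal_phase G'"] by fastforce
  have spanH: "span (chars (higgs G H')) = H'" if "relevant G H'" for H'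
    by (rule span_chars_higgs_relevant[OF G that])
  have \<mu>: "phase_count (fst f) H (snd f) = \<mu> H (fst f)" if H: "relevant G H" and f: "f \<in> set fs \<union> set fs'" for H f
  proof -
    obtain H' where H': "relevant G H'" "fst f = higgs G H'" "minimal_phase (fst f) (snd f)" using factor[OF f] by blast
    have some: "minimal_phase (fst f) (SOME Z. minimal_phase (fst f) Z)" using H'(3) by (rule someI)
    have subH: "subspace H" "subspace H'" "H' \<subseteq> span (chars G)" using H H'(1) by (auto simp: relevant_def)
    show ?thesis
    proof (cases "H \<subseteq> H'")
      case True
      have "relevant (fst f) H" unfolding H'(2)
        using relevant_higgs_iff[OF subH(2) _ subH(3)] spanH[OF H'(1)] H True by simp
      then show ?thesis using some H'(3) phase_count_minimal_unique unfolding \<mu>_def minimal_phase_def by blast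
    next
      case False
      then have "\<not> H \<subseteq> span (chars (fst f))" using H'(2) spanH[OF H'(1)] by simp
      then show ?thesis unfolding \<mu>_def using phase_count_not_subset[OF subH(1)] by metis
    qed
  qed
  have total: "(\<Sum>G'\<in>?S. of_nat (count (mset (map fst gs)) G') * \<mu> H G') = phase_count G H X"
    if H: "relevant G H" and gs: "set gs \<subseteq> set fs \<union> set fs'" "decomposition G X gs" for H gs
  proof -
    have "phase_count G H X = total_count H gs"
      using total_count_decomposition[OF gs(2) G, of H] H by (simp add: relevant_def)
    also have "\<dots> = (\<Sum>G'\<leftarrow>map fst gs. \<mu> H G')"
      unfolding total_count_def map_map using \<mu>[OF H] gs(1) by (intro arg_cong[where f = sum_list] map_cong) auto
    also have "\<dots> = (\<Sum>G'\<in>?S. of_nat (count (mset (map fst gs)) G') * \<mu> H G')"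
      by (rule sum_list_map_eq_sum_count_mset) (use gs(1) in auto)
    finally show ?thesis by (rule sym)
  qed
  \<comment> \<open>The linear system for the multiplicities is triangular; solve it downwards in the dimension of \<open>H\<close>.\<close>
  have count: "count ?m (higgs G H) = count ?m' (higgs G H)" if "relevant G H" for H
    using that
  proof (induction "DIM('a) - dim H" arbitrary: H rule: less_induct)
    case less
    show ?case
    proof (cases "higgs G H \<in> ?S")
      case False
      then have "higgs G H \<notin># ?m" "higgs G H \<notin># ?m'" by auto
      then show ?thesis by (simp only: not_in_iff)
    next
      case True
      let ?c = "\<lambda>G'. of_nat (count ?m G') * \<mu> H G' :: real" and ?c' = "\<lambda>G'. of_nat (count ?m' G') * \<mu> H G' :: real"
      have "(\<Sum>G'\<in>?S. ?c G') = (\<Sum>G'\<in>?S. ?c' G')"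
        using total[OF less.prems, of fs] total[OF less.prems, of fs'] assms(4,5) by simp
      moreover have "?c G' = ?c' G'" if G': "G' \<in> ?S - {higgs G H}" for G'
      proof -
        obtain H' where H': "relevant G H'" "G' = higgs G H'" using relS G' by blast
        show ?thesis
        proof (cases "H \<subseteq> H'")
          case True
          then have "H \<subset> H'" using H'(2) G' by blast
          moreover have "span H = H" "span H' = H'" using less.prems H'(1) by (simp_all add: relevant_def)
          ultimately have "span H \<subset> span H'" by (simp only:)
          then have "dim H < dim H'" by (rule dim_psubset)
          moreover have "dim H' \<le> DIM('a)" by (rule dim_subset_UNIV)
          ultimately have "count ?m (higgs G H') = count ?m' (higgs G H')" using H'(1) by (intro less.hyps) auto
          then show ?thesis using H'(2) by simp
        next
          case False
          then have "\<mu> H G' = 0"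
            unfolding \<mu>_def H'(2) using less.prems spanH[OF H'(1)] by (intro phase_count_not_subset) (auto simp: relevant_def)
          then show ?thesis by simp
        qed
      qed
      then have "(\<Sum>G'\<in>?S - {higgs G H}. ?c G') = (\<Sum>G'\<in>?S - {higgs G H}. ?c' G')" by (intro sum.cong) auto
      ultimately have "?c (higgs G H) = ?c' (higgs G H)" using True by (simp add: sum.remove)
      moreover have "0 < \<mu> H (higgs G H)"
      proof -
        have "minimal_phase (higgs G H) (SOME Z. minimal_phase (higgs G H) Z)" using relS[OF True] by blast
        then show ?thesis using phase_count_top_pos unfolding \<mu>_def using spanH[OF less.prems] by metis
      qed
      ultimately show ?thesis by simp
    qed
  qed
  have "?m = ?m'"
  proof (rule multiset_eqI)
    fix G'
    show "count ?m G' = count ?m' G'"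
    proof (cases "G' \<in> ?S")
      case True
      then obtain H' where "relevant G H'" "G' = higgs G H'" using relS by blast
      then show ?thesis using count by simp
    next
      case False
      then have "G' \<notin># ?m" "G' \<notin># ?m'" by auto
      then show ?thesis by (simp only: not_in_iff)
    qed
  qed
  moreover have "factor_multiplicity G H gs = count (mset (map fst gs)) (higgs G H)" for gs
    by (induction gs) (auto simp: factor_multiplicity_def)
  ultimately show ?thesis by simp
qed

end
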